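(* Let $(A,\bar{\mathfrak{m}})$ be a sequence-regular commutative noetherian local DG-ring, and let $\bar{a}_1,\dots,\bar{a}_n$ be a regular system of parameters of $A$. (1) If $\hat{a}_1,\dots,\hat{a}_n$ is another regular system of parameters of $A$, then there is a natural isomorphism in the homotopy category of DG-algebras over $A$: $$K(A;\bar{a}_1,\dots,\bar{a}_n) \cong K(A;\hat{a}_1,\dots,\hat{a}_n).$$ (2) If $(B,\bar{\mathfrak{n}})$ is another sequence-regular noetherian local DG-ring and $f:A \to B$ is a local homomorphism of DG-rings such that $\mathrm{H}^0(f)$ is flat and the fiber $\mathrm{H}^0(B)/\bar{\mathfrak{m}}\mathrm{H}^0(B)$ is a regular ring, then there exist a regular system of parameters $\bar{b}_1,\dots,\bar{b}_m$ of $B$ and a map of DG-rings $g:K(A;\bar{a}_1,\dots,\bar{a}_n) \to K(B;\bar{b}_1,\dots,\bar{b}_m)$ such that $g\circ \iota_A=\iota_B\circ f$, where $\iota_A:A\to K(A;\bar{a}_1,\dots,\bar{a}_n)$ and $\iota_B:B\to K(B;\bar{b}_1,\dots,\bar{b}_m)$ are the natural maps from a DG-ring to its Koszul complex.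
   Context: All DG-rings are unital, non-positively graded, $A=\bigoplus_{n\le 0}A^n$ with differential of degree $+1$ satisfying the graded Leibniz rule, and commutative: $ba=(-1)^{\deg(a)\deg(b)}ab$ for homogeneous $a,b$, and $a^2=0$ for $a$ of odd degree. There is a natural surjection $\pi_A^0:A^0\to \mathrm{H}^0(A)$. For a DG-module $M$, $\inf(M)=\inf\{n\mid \mathrm{H}^n(M)\neq 0\}$. $\mathsf{D}(A)$ is the derived category of DG-modules over $A$, and $\mathsf{D}^+(A)$ is its full subcategory of DG-modules with bounded below cohomology. The homotopy category of DG-rings (resp. of DG-algebras over $A$) is obtained by formally inverting quasi-isomorphisms. $A$ is noetherian if $\mathrm{H}^0(A)$ is a noetherian ring and each $\mathrm{H}^i(A)$, $i<0$, is a finitely generated $\mathrm{H}^0(A)$-module. $A$ has bounded cohomology if $\mathrm{H}^i(A)=0$ for $i\ll 0$. A noetherian local DG-ring $(A,\bar{\mathfrak{m}})$ is a noetherian DG-ring such that $\mathrm{H}^0(A)$ is a local ring with maximal ideal $\bar{\mathfrak{m}}$. A map $f:A\to B$ of noetherian local DG-rings is local if $\mathrm{H}^0(f)$ is a local homomorphism. Koszul complex: for $\bar a_1,\dots,\bar a_n\in \mathrm{H}^0(A)$ choose lifts $a_i\in A^0$ and set $K(A;\bar a_1,\dots,\bar a_n)=K(A^0;a_1,\dots,a_n)\otimes_{A^0}A$, a commutative DG-ring with a natural map from $A$, independent of the lifts up to isomorphism in the homotopy category; for $M\in\mathsf{D}(A)$, $K(M;\bar a_1,\dots,\bar a_n)=K(A;\bar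 a_1,\dots,\bar a_n)\otimes_A M$. Regular sequences: for a noetherian local DG-ring $(A,\bar{\mathfrak{m}})$ and $M\in\mathsf{D}^+(A)$, an element $\bar x\in\bar{\mathfrak{m}}$ is $M$-regular if multiplication by $\bar x$ on $\mathrm{H}^{\inf(M)}(M)$ is injective. A sequence $\bar a_1,\dots,\bar a_n\in\bar{\mathfrak{m}}$ is $M$-regular if $\bar a_1$ is $M$-regular and $\bar a_2,\dots,\bar a_n$ is $K(M;\bar a_1)$-regular. A noetherian local DG-ring $(A,\bar{\mathfrak{m}})$ with bounded cohomology is sequence-regular if $\bar{\mathfrak{m}}$ can be generated by an $A$-regular sequence. A regular system of parameters of a sequence-regular local DG-ring $(A,\bar{\mathfrak{m}})$ is a minimal generating sequence of $\bar{\mathfrak{m}}$. *)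

theory Defs
  imports
    "HOL-Algebra.Ring_Divisibility"
    "HOL-Algebra.Module"
    "HOL-Algebra.Free_Abelian_Groups"
    "HOL-Library.Sublist"
    "HOL-Library.Extended_Nat"
    "HOL-Library.Extended_Real"
begin

section \<open>Commutative algebra\<close>

definition local_ring :: "('r, 'z) ring_scheme \<Rightarrow> 'r set \<Rightarrow> bool" where
  "local_ring R m \<longleftrightarrow> cring R \<and> maximalideal m R \<and> (\<forall>m'. maximalideal m' R \<longrightarrow> m' = m)"

definition fg_module :: "('r, 'z) ring_scheme \<Rightarrow> ('r, 'm, 'y) module_scheme \<Rightarrow> bool" where
  "fg_module R M \<longleftrightarrow>
    (\<exists>X. finite X \<and> X \<subseteq> carrier M \<and>
      (\<forall>y \<in> carrier M. \<exists>r \<in> X \<rightarrow> carrier R. y = (\<Oplus>\<^bsub>M\<^esub>x\<in>X. r x \<odot>\<^bsub>M\<^esub> x)))"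

subsection \<open>Flatness\<close>

text \<open>The tensor product of modules, as the free abelian group on pairs modulo the usual
  bilinearity relations.\<close>

definition tensor_rels ::
  "('r, 'z) ring_scheme \<Rightarrow> ('r, 'm, 'y) module_scheme \<Rightarrow> ('r, 'n, 'x) module_scheme \<Rightarrow> ('m \<times> 'n \<Rightarrow>\<^sub>0 int) set"
  where
  "tensor_rels R M N =
     {frag_of (x \<oplus>\<^bsub>M\<^esub> x', y) - frag_of (x, y) - frag_of (x', y) | x x' y.
        x \<in> carrier M \<and> x' \<in> carrier M \<and> y \<in> carrier N} \<union>
     {frag_of (x, y \<oplus>\<^bsub>N\<^esub> y') - frag_of (x, y) - frag_of (x, y') | x y y'.
        x \<in> carrier M \<and> y \<in> carrier N \<and> y' \<in> carrier N} \<union>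
     {frag_of (r \<odot>\<^bsub>M\<^esub> x, y) - frag_of (x, r \<odot>\<^bsub>N\<^esub> y) | r x y.
        r \<in> carrier R \<and> x \<in> carrier M \<and> y \<in> carrier N}"

definition tensor_null ::
  "('r, 'z) ring_scheme \<Rightarrow> ('r, 'm, 'y) module_scheme \<Rightarrow> ('r, 'n, 'x) module_scheme \<Rightarrow> ('m \<times> 'n \<Rightarrow>\<^sub>0 int) set"
  where
  "tensor_null R M N =
     generate (free_Abelian_group (carrier M \<times> carrier N)) (tensor_rels R M N)"

definition tensor_group ::
  "('r, 'z) ring_scheme \<Rightarrow> ('r, 'm, 'y) module_scheme \<Rightarrow> ('r, 'n, 'x) module_scheme \<Rightarrow> ('m \<times> 'n \<Rightarrow>\<^sub>0 int) set monoid"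
  where
  "tensor_group R M N = free_Abelian_group (carrier M \<times> carrier N) Mod tensor_null R M N"

text \<open>The map \<open>i \<otimes> N\<close> on cosets, for a linear map \<open>i\<close> into \<open>M\<close>.\<close>

definition tensor_map ::
  "('r, 'z) ring_scheme \<Rightarrow> ('r, 'm, 'y) module_scheme \<Rightarrow> ('r, 'n, 'x) module_scheme \<Rightarrow> ('k \<Rightarrow> 'm) \<Rightarrow>
     ('k \<times> 'n \<Rightarrow>\<^sub>0 int) set \<Rightarrow> ('m \<times> 'n \<Rightarrow>\<^sub>0 int) set"
  where
  "tensor_map R M N i C =
     (\<Union>c\<in>C. tensor_null R M N #>\<^bsub>free_Abelian_group (carrier M \<times> carrier N)\<^esub>
               frag_extend (\<lambda>(x, y). frag_of (i x, y)) c)"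

definition module_hom ::
  "('r, 'z) ring_scheme \<Rightarrow> ('r, 'k, 'y) module_scheme \<Rightarrow> ('r, 'm, 'x) module_scheme \<Rightarrow> ('k \<Rightarrow> 'm) set"
  where
  "module_hom R L M =
     {i \<in> carrier L \<rightarrow> carrier M.
        (\<forall>x \<in> carrier L. \<forall>y \<in> carrier L. i (x \<oplus>\<^bsub>L\<^esub> y) = i x \<oplus>\<^bsub>M\<^esub> i y) \<and>
        (\<forall>r \<in> carrier R. \<forall>x \<in> carrier L. i (r \<odot>\<^bsub>L\<^esub> x) = r \<odot>\<^bsub>M\<^esub> i x)}"

text \<open>The test modules range over all modules whose underlying type is that of \<open>R\<close>. This type
  contains \<open>R\<close> and all of its ideals, so by the ideal criterion larger test modules would impose no
  further condition.\<close>

definition flat_module :: "('r, 'z) ring_scheme \<Rightarrow> ('r, 'n, 'y) module_scheme \<Rightarrow> bool" where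
  "flat_module R N \<longleftrightarrow> module R N \<and>
     (\<forall>(L :: ('r, 'r) module) (M :: ('r, 'r) module) i.
        module R L \<longrightarrow> module R M \<longrightarrow> i \<in> module_hom R L M \<longrightarrow> inj_on i (carrier L) \<longrightarrow>
        inj_on (tensor_map R M N i) (carrier (tensor_group R L N)))"

definition restrict_scalars :: "('s, 'z) ring_scheme \<Rightarrow> ('r \<Rightarrow> 's) \<Rightarrow> ('r, 's) module" where
  "restrict_scalars S \<phi> =
     \<lparr>carrier = carrier S, mult = mult S, one = one S, ring.zero = \<zero>\<^bsub>S\<^esub>, add = add S,
      smult = (\<lambda>r x. \<phi> r \<otimes>\<^bsub>S\<^esub> x)\<rparr>"

definition flat_hom :: "('r, 'z) ring_scheme \<Rightarrow> ('s, 'y) ring_scheme \<Rightarrow> ('r \<Rightarrow> 's) \<Rightarrow> bool" where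
  "flat_hom R S \<phi> \<longleftrightarrow> \<phi> \<in> ring_hom R S \<and> flat_module R (restrict_scalars S \<phi>)"

subsection \<open>Regular rings\<close>

definition krull_dim :: "('r, 'z) ring_scheme \<Rightarrow> enat" where
  "krull_dim R =
     Sup {enat k | k. \<exists>P :: nat \<Rightarrow> 'r set.
            (\<forall>i\<le>k. primeideal (P i) R) \<and> (\<forall>i<k. P i \<subset> P (Suc i))}"

definition regular_local_ring :: "('r, 'z) ring_scheme \<Rightarrow> bool" where
  "regular_local_ring R \<longleftrightarrow> noetherian_ring R \<and>
     (\<exists>m. local_ring R m \<and>
        (\<exists>X. finite X \<and> X \<subseteq> carrier R \<and> Idl\<^bsub>R\<^esub> X = m \<and> enat (card X) = krull_dim R))"

definition frac_rel :: "('r, 'z) ring_scheme \<Rightarrow> 'r set \<Rightarrow> (('r \<times> 'r) \<times> ('r \<times> 'r)) set" where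
  "frac_rel R p =
     {((r, s), (r', s')) | r s r' s'.
        r \<in> carrier R \<and> r' \<in> carrier R \<and> s \<in> carrier R - p \<and> s' \<in> carrier R - p \<and>
        (\<exists>t \<in> carrier R - p. t \<otimes>\<^bsub>R\<^esub> (r \<otimes>\<^bsub>R\<^esub> s') = t \<otimes>\<^bsub>R\<^esub> (r' \<otimes>\<^bsub>R\<^esub> s))}"

definition localization :: "('r, 'z) ring_scheme \<Rightarrow> 'r set \<Rightarrow> ('r \<times> 'r) set ring" where
  "localization R p =
     \<lparr>carrier = (carrier R \<times> (carrier R - p)) // frac_rel R p,
      mult = (\<lambda>X Y. \<Union>(r, s)\<in>X. \<Union>(r', s')\<in>Y. frac_rel R p `` {(r \<otimes>\<^bsub>R\<^esub> r', s \<otimes>\<^bsub>R\<^esub> s')}),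
      one = frac_rel R p `` {(\<one>\<^bsub>R\<^esub>, \<one>\<^bsub>R\<^esub>)},
      ring.zero = frac_rel R p `` {(\<zero>\<^bsub>R\<^esub>, \<one>\<^bsub>R\<^esub>)},
      add = (\<lambda>X Y. \<Union>(r, s)\<in>X. \<Union>(r', s')\<in>Y.
               frac_rel R p `` {(r \<otimes>\<^bsub>R\<^esub> s' \<oplus>\<^bsub>R\<^esub> r' \<otimes>\<^bsub>R\<^esub> s, s \<otimes>\<^bsub>R\<^esub> s')})\<rparr>"

definition regular_ring :: "('r, 'z) ring_scheme \<Rightarrow> bool" where
  "regular_ring R \<longleftrightarrow> cring R \<and> noetherian_ring R \<and>
     (\<forall>p. primeideal p R \<longrightarrow> regular_local_ring (localization R p))"


section \<open>DG-rings and DG-modules\<close>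

record 'a dg = "'a ring" +
  grd :: "int \<Rightarrow> 'a set"
  dif :: "'a \<Rightarrow> 'a"

text \<open>As for modules in the library, the multiplicative fields inherited from \<open>ring\<close> play no role in a
  DG-module.\<close>

record ('a, 'm) dgmod = "'m dg" +
  act :: "'a \<Rightarrow> 'm \<Rightarrow> 'm"

text \<open>\<open>(-1)\<^sup>k x\<close>\<close>

definition sgnpow :: "('a, 'z) ring_scheme \<Rightarrow> int \<Rightarrow> 'a \<Rightarrow> 'a" where
  "sgnpow A k x = (if even k then x else \<ominus>\<^bsub>A\<^esub> x)"

definition decomposition :: "('a, 'z) dg_scheme \<Rightarrow> 'a \<Rightarrow> (int \<Rightarrow> 'a) \<Rightarrow> bool" where
  "decomposition A x c \<longleftrightarrow>
     (\<forall>n. c n \<in> grd A n) \<and> finite {n. c n \<noteq> \<zero>\<^bsub>A\<^esub>} \<and> x = (\<Oplus>\<^bsub>A\<^esub>n\<in>{n. c n \<noteq> \<zero>\<^bsub>A\<^esub>}. c n)"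

definition dg_group :: "('a, 'z) dg_scheme \<Rightarrow> bool" where
  "dg_group A \<longleftrightarrow> abelian_group A \<and>
     (\<forall>n. additive_subgroup (grd A n) A) \<and>
     (\<forall>x \<in> carrier A. \<exists>!c. decomposition A x c) \<and>
     dif A \<in> carrier A \<rightarrow> carrier A \<and>
     (\<forall>x \<in> carrier A. \<forall>y \<in> carrier A. dif A (x \<oplus>\<^bsub>A\<^esub> y) = dif A x \<oplus>\<^bsub>A\<^esub> dif A y) \<and>
     (\<forall>n. \<forall>x \<in> grd A n. dif A x \<in> grd A (n + 1)) \<and>
     (\<forall>x \<in> carrier A. dif A (dif A x) = \<zero>\<^bsub>A\<^esub>)"

definition dg_ring :: "('a, 'z) dg_scheme \<Rightarrow> bool" where
  "dg_ring A \<longleftrightarrow> ring A \<and> dg_group A \<and>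
     (\<forall>n>0. grd A n = {\<zero>\<^bsub>A\<^esub>}) \<and>
     \<one>\<^bsub>A\<^esub> \<in> grd A 0 \<and>
     (\<forall>i j. \<forall>a \<in> grd A i. \<forall>b \<in> grd A j. a \<otimes>\<^bsub>A\<^esub> b \<in> grd A (i + j)) \<and>
     (\<forall>i j. \<forall>a \<in> grd A i. \<forall>b \<in> grd A j.
        dif A (a \<otimes>\<^bsub>A\<^esub> b) = dif A a \<otimes>\<^bsub>A\<^esub> b \<oplus>\<^bsub>A\<^esub> sgnpow A i (a \<otimes>\<^bsub>A\<^esub> dif A b)) \<and>
     (\<forall>i j. \<forall>a \<in> grd A i. \<forall>b \<in> grd A j. b \<otimes>\<^bsub>A\<^esub> a = sgnpow A (i * j) (a \<otimes>\<^bsub>A\<^esub> b)) \<and>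
     (\<forall>i. odd i \<longrightarrow> (\<forall>a \<in> grd A i. a \<otimes>\<^bsub>A\<^esub> a = \<zero>\<^bsub>A\<^esub>))"

definition dg_module :: "('a, 'z) dg_scheme \<Rightarrow> ('a, 'm, 'y) dgmod_scheme \<Rightarrow> bool" where
  "dg_module A M \<longleftrightarrow> dg_ring A \<and> dg_group M \<and>
     (\<forall>a \<in> carrier A. \<forall>x \<in> carrier M. act M a x \<in> carrier M) \<and>
     (\<forall>a \<in> carrier A. \<forall>b \<in> carrier A. \<forall>x \<in> carrier M.
        act M (a \<oplus>\<^bsub>A\<^esub> b) x = act M a x \<oplus>\<^bsub>M\<^esub> act M b x) \<and>
     (\<forall>a \<in> carrier A. \<forall>x \<in> carrier M. \<forall>y \<in> carrier M.
        act M a (x \<oplus>\<^bsub>M\<^esub> y) = act M a x \<oplus>\<^bsub>M\<^esub> act M a y) \<and>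
     (\<forall>a \<in> carrier A. \<forall>b \<in> carrier A. \<forall>x \<in> carrier M.
        act M (a \<otimes>\<^bsub>A\<^esub> b) x = act M a (act M b x)) \<and>
     (\<forall>x \<in> carrier M. act M \<one>\<^bsub>A\<^esub> x = x) \<and>
     (\<forall>i j. \<forall>a \<in> grd A i. \<forall>x \<in> grd M j. act M a x \<in> grd M (i + j)) \<and>
     (\<forall>i j. \<forall>a \<in> grd A i. \<forall>x \<in> grd M j.
        dif M (act M a x) = act M (dif A a) x \<oplus>\<^bsub>M\<^esub> sgnpow M i (act M a (dif M x)))"

definition dg_self :: "('a, 'z) dg_scheme \<Rightarrow> ('a, 'a) dgmod" where
  "dg_self A =
     \<lparr>carrier = carrier A, mult = mult A, one = one A, ring.zero = \<zero>\<^bsub>A\<^esub>, add = add A,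
      grd = grd A, dif = dif A, act = mult A\<rparr>"

definition dg_hom :: "('a, 'z) dg_scheme \<Rightarrow> ('b, 'y) dg_scheme \<Rightarrow> ('a \<Rightarrow> 'b) set" where
  "dg_hom A B =
     {f \<in> ring_hom A B. (\<forall>n. f ` grd A n \<subseteq> grd B n) \<and> (\<forall>x \<in> carrier A. f (dif A x) = dif B (f x))}"

subsection \<open>Cohomology\<close>

definition cocycles :: "('a, 'z) dg_scheme \<Rightarrow> int \<Rightarrow> 'a set" where
  "cocycles A n = {x \<in> grd A n. dif A x = \<zero>\<^bsub>A\<^esub>}"

definition coboundaries :: "('a, 'z) dg_scheme \<Rightarrow> int \<Rightarrow> 'a set" where
  "coboundaries A n = dif A ` grd A (n - 1)"

definition coh_set :: "('a, 'z) dg_scheme \<Rightarrow> int \<Rightarrow> 'a set set" where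
  "coh_set A n = (\<lambda>z. coboundaries A n +>\<^bsub>A\<^esub> z) ` cocycles A n"

text \<open>The ring \<open>H\<^sup>0(A)\<close> of a DG-ring: since the grading is non-positive, every element of \<open>A\<^sup>0\<close> is a
  cocycle.\<close>

definition deg0 :: "('a, 'z) dg_scheme \<Rightarrow> 'a ring" where
  "deg0 A = \<lparr>carrier = grd A 0, mult = mult A, one = one A, ring.zero = \<zero>\<^bsub>A\<^esub>, add = add A\<rparr>"

definition H0 :: "('a, 'z) dg_scheme \<Rightarrow> 'a set ring" where
  "H0 A = deg0 A Quot coboundaries A 0"

text \<open>\<open>H\<^sup>n(M)\<close> as a module over \<open>H\<^sup>0(A)\<close>.\<close>

definition cohomology :: "('a, 'm, 'z) dgmod_scheme \<Rightarrow> int \<Rightarrow> ('a set, 'm set) module" where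
  "cohomology M n =
     \<lparr>carrier = coh_set M n, mult = undefined, one = undefined,
      ring.zero = coboundaries M n, add = set_add M,
      smult = (\<lambda>X Y. \<Union>a\<in>X. \<Union>y\<in>Y. coboundaries M n +>\<^bsub>M\<^esub> act M a y)\<rparr>"

definition coh_map :: "('b, 'z) dg_scheme \<Rightarrow> ('a \<Rightarrow> 'b) \<Rightarrow> int \<Rightarrow> 'a set \<Rightarrow> 'b set" where
  "coh_map B f n X = (\<Union>x\<in>X. coboundaries B n +>\<^bsub>B\<^esub> f x)"

definition quasi_iso :: "('a, 'z) dg_scheme \<Rightarrow> ('b, 'y) dg_scheme \<Rightarrow> ('a \<Rightarrow> 'b) \<Rightarrow> bool" where
  "quasi_iso A B f \<longleftrightarrow> f \<in> dg_hom A B \<and> (\<forall>n. bij_betw (coh_map B f n) (coh_set A n) (coh_set B n))"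

text \<open>\<open>inf(M)\<close>; it is \<open>\<infinity>\<close> if \<open>M\<close> is acyclic.\<close>

definition coh_inf :: "('a, 'z) dg_scheme \<Rightarrow> ereal" where
  "coh_inf M = Inf {ereal (real_of_int n) | n. coh_set M n \<noteq> {coboundaries M n}}"

definition bounded_cohomology :: "('a, 'z) dg_scheme \<Rightarrow> bool" where
  "bounded_cohomology A \<longleftrightarrow> (\<exists>N. \<forall>i<N. coh_set A i = {coboundaries A i})"

definition noetherian_dg :: "('a, 'z) dg_scheme \<Rightarrow> bool" where
  "noetherian_dg A \<longleftrightarrow> dg_ring A \<and> noetherian_ring (H0 A) \<and>
     (\<forall>i<0. fg_module (H0 A) (cohomology (dg_self A) i))"

definition noetherian_local_dg :: "('a, 'z) dg_scheme \<Rightarrow> 'a set set \<Rightarrow> bool" where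
  "noetherian_local_dg A m \<longleftrightarrow> noetherian_dg A \<and> local_ring (H0 A) m"

definition local_dg_hom ::
  "('a, 'z) dg_scheme \<Rightarrow> 'a set set \<Rightarrow> ('b, 'y) dg_scheme \<Rightarrow> 'b set set \<Rightarrow> ('a \<Rightarrow> 'b) \<Rightarrow> bool" where
  "local_dg_hom A m B n f \<longleftrightarrow> f \<in> dg_hom A B \<and> coh_map B f 0 ` m \<subseteq> n"


section \<open>Koszul complexes\<close>

text \<open>The underlying graded module of \<open>K(A\<^sup>0; a\<^sub>0, \<dots>, a\<^sub>n\<^sub>-\<^sub>1)\<close> is the exterior algebra over \<open>A\<^sup>0\<close> on
  generators \<open>e\<^sub>i\<close> of degree \<open>-1\<close> with \<open>d e\<^sub>i = a\<^sub>i\<close>. It is free with basis the products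
  \<open>e\<^sub>S\<close>, taken in increasing order, for \<open>S \<subseteq> {..<n}\<close>. Hence an element of its tensor product with \<open>M\<close>
  is uniquely of the form \<open>\<Sum>\<^sub>S e\<^sub>S \<otimes> x\<^sub>S\<close>; it is represented by the coefficient function \<open>S \<mapsto> x\<^sub>S\<close>.
  The formulas below are those of the tensor product of DG-algebras and DG-modules:

  \<open>d (e\<^sub>S \<otimes> x) = (\<Sum>i\<in>S. (-1)^#{j\<in>S. j < i} e\<^bsub>S - {i}\<^esub> \<otimes> a\<^sub>i x) + (-1)^|S| e\<^sub>S \<otimes> d x\<close>,

  \<open>a (e\<^sub>S \<otimes> x) = (-1)^(deg a |S|) e\<^sub>S \<otimes> a x\<close>,

  \<open>(e\<^sub>T \<otimes> x)(e\<^sub>U \<otimes> y) = (-1)^(deg x |U|) e\<^sub>T e\<^sub>U \<otimes> x y\<close>.\<close>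

definition component :: "('a, 'z) dg_scheme \<Rightarrow> 'a \<Rightarrow> int \<Rightarrow> 'a" where
  "component A x = (THE c. decomposition A x c)"

text \<open>Multiplies the degree \<open>n\<close> component of \<open>x\<close> by \<open>(-1)^(k n)\<close>.\<close>

definition degsgn :: "('a, 'z) dg_scheme \<Rightarrow> nat \<Rightarrow> 'a \<Rightarrow> 'a" where
  "degsgn A k x =
     (\<Oplus>\<^bsub>A\<^esub>n\<in>{n. component A x n \<noteq> \<zero>\<^bsub>A\<^esub>}. sgnpow A (int k * n) (component A x n))"

definition koszul_mod ::
  "('a, 'z) dg_scheme \<Rightarrow> 'a list \<Rightarrow> ('a, 'm, 'y) dgmod_scheme \<Rightarrow> ('a, nat set \<Rightarrow> 'm) dgmod" where
  "koszul_mod A as M =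
     \<lparr>carrier = Pow {..<length as} \<rightarrow>\<^sub>E carrier M,
      mult = undefined, one = undefined,
      ring.zero = (\<lambda>S\<in>Pow {..<length as}. \<zero>\<^bsub>M\<^esub>),
      add = (\<lambda>x y. \<lambda>S\<in>Pow {..<length as}. x S \<oplus>\<^bsub>M\<^esub> y S),
      grd = (\<lambda>k. Pi\<^sub>E (Pow {..<length as}) (\<lambda>S. grd M (k + int (card S)))),
      dif = (\<lambda>x. \<lambda>S\<in>Pow {..<length as}.
               sgnpow M (int (card S)) (dif M (x S)) \<oplus>\<^bsub>M\<^esub>
               (\<Oplus>\<^bsub>M\<^esub>i\<in>{..<length as} - S.
                  sgnpow M (int (card {j \<in> S. j < i})) (act M (as ! i) (x (insert i S))))),
      act = (\<lambda>a x. \<lambda>S\<in>Pow {..<length as}. act M (degsgn A (card S) a) (x S))\<rparr>"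

definition koszul :: "('a, 'z) dg_scheme \<Rightarrow> 'a list \<Rightarrow> (nat set \<Rightarrow> 'a) dg" where
  "koszul A as =
     (let K = koszul_mod A as (dg_self A) in
      \<lparr>carrier = carrier K,
       mult = (\<lambda>x y. \<lambda>S\<in>Pow {..<length as}.
                \<Oplus>\<^bsub>A\<^esub>T\<in>Pow S.
                  sgnpow A (int (card {(t, u). t \<in> T \<and> u \<in> S - T \<and> u < t}))
                    (degsgn A (card (S - T)) (x T) \<otimes>\<^bsub>A\<^esub> y (S - T))),
       one = (\<lambda>S\<in>Pow {..<length as}. if S = {} then \<one>\<^bsub>A\<^esub> else \<zero>\<^bsub>A\<^esub>),
       ring.zero = \<zero>\<^bsub>K\<^esub>, add = add K, grd = grd K, dif = dif K\<rparr>)"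

definition koszul_incl :: "('a, 'z) dg_scheme \<Rightarrow> 'a list \<Rightarrow> 'a \<Rightarrow> nat set \<Rightarrow> 'a" where
  "koszul_incl A as x = (\<lambda>S\<in>Pow {..<length as}. if S = {} then x else \<zero>\<^bsub>A\<^esub>)"

text \<open>Elements of \<open>H\<^sup>0(A)\<close> are cosets in \<open>A\<^sup>0\<close>, so a lift of an element of \<open>H\<^sup>0(A)\<close> is just one of its
  members.\<close>

definition lifts :: "'a list \<Rightarrow> 'a set list \<Rightarrow> bool" where
  "lifts as xs \<longleftrightarrow> list_all2 (\<in>) as xs"


section \<open>Regular sequences\<close>

text \<open>Meant for \<open>M\<close> with bounded below cohomology. If \<open>M\<close> is acyclic, \<open>inf(M)\<close> is not an integer and
  every element of \<open>m\<close> is regular.\<close>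

definition regular_elem ::
  "'a set set \<Rightarrow> ('a, 'm, 'y) dgmod_scheme \<Rightarrow> 'a set \<Rightarrow> bool" where
  "regular_elem m M x \<longleftrightarrow> x \<in> m \<and>
     (\<forall>n. ereal (real_of_int n) = coh_inf M \<longrightarrow>
        inj_on (\<lambda>y. x \<odot>\<^bsub>cohomology M n\<^esub> y) (carrier (cohomology M n)))"

text \<open>The defining recursion, \<open>x\<close> is \<open>M\<close>-regular and \<open>xs\<close> is \<open>K(M; x)\<close>-regular, changes the type of the
  module, so it is unrolled here: \<open>x\<^sub>i\<close> is regular on \<open>K(M; x\<^sub>0, \<dots>, x\<^sub>i\<^sub>-\<^sub>1)\<close>. The recursive form is the lemma
  \<open>regular_seq_Cons\<close> below.\<close>

definition regular_seq ::
  "('a, 'z) dg_scheme \<Rightarrow> 'a set set \<Rightarrow> ('a, 'm, 'y) dgmod_scheme \<Rightarrow> 'a set list \<Rightarrow> bool" where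
  "regular_seq A m M xs \<longleftrightarrow>
     (\<forall>i<length xs. \<forall>as. lifts as (take i xs) \<longrightarrow> regular_elem m (koszul_mod A as M) (xs ! i))"

definition sequence_regular :: "('a, 'z) dg_scheme \<Rightarrow> 'a set set \<Rightarrow> bool" where
  "sequence_regular A m \<longleftrightarrow> noetherian_local_dg A m \<and> bounded_cohomology A \<and>
     (\<exists>xs. regular_seq A m (dg_self A) xs \<and> Idl\<^bsub>H0 A\<^esub> (set xs) = m)"

definition regular_system_of_parameters :: "('a, 'z) dg_scheme \<Rightarrow> 'a set set \<Rightarrow> 'a set list \<Rightarrow> bool" where
  "regular_system_of_parameters A m xs \<longleftrightarrow> set xs \<subseteq> m \<and> Idl\<^bsub>H0 A\<^esub> (set xs) = m \<and>
     (\<forall>ys. strict_subseq ys xs \<longrightarrow> Idl\<^bsub>H0 A\<^esub> (set ys) \<noteq> m)"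


section \<open>The homotopy category of DG-algebras over a DG-ring\<close>

type_synonym ('a, 'c) dgalg = "'c dg \<times> ('a \<Rightarrow> 'c)"

definition dg_alg :: "'a dg \<Rightarrow> ('a, 'c) dgalg \<Rightarrow> bool" where
  "dg_alg A X \<longleftrightarrow> dg_ring A \<and> dg_ring (fst X) \<and> snd X \<in> dg_hom A (fst X)"

definition alg_hom :: "'a dg \<Rightarrow> ('a, 'c) dgalg \<Rightarrow> ('a, 'c) dgalg \<Rightarrow> ('c \<Rightarrow> 'c) set" where
  "alg_hom A X Y =
     {f \<in> dg_hom (fst X) (fst Y). dg_alg A X \<and> dg_alg A Y \<and> (\<forall>a \<in> carrier A. f (snd X a) = snd Y a)}"

definition alg_qis :: "'a dg \<Rightarrow> ('a, 'c) dgalg \<Rightarrow> ('a, 'c) dgalg \<Rightarrow> ('c \<Rightarrow> 'c) set" where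
  "alg_qis A X Y = {f \<in> alg_hom A X Y. quasi_iso (fst X) (fst Y) f}"

text \<open>The localization of the category of DG-algebras over \<open>A\<close> (on a fixed carrier type) at the
  quasi-isomorphisms: morphisms are zigzags, read from left to right, modulo the congruence generated by
  the identities and compositions of the category and the invertibility of quasi-isomorphisms.
  \<open>Inv Y f X\<close> is the formal inverse \<open>Y \<rightarrow> X\<close> of \<open>f : X \<rightarrow> Y\<close>. An isomorphism obtained with a fixed carrier
  type remains one when more DG-algebras are admitted as objects.\<close>

datatype ('a, 'c) arrow =
    Mor "('a, 'c) dgalg" "'c \<Rightarrow> 'c" "('a, 'c) dgalg"
  | Inv "('a, 'c) dgalg" "'c \<Rightarrow> 'c" "('a, 'c) dgalg"

inductive zigzag :: "'a dg \<Rightarrow> ('a, 'c) dgalg \<Rightarrow> ('a, 'c) arrow list \<Rightarrow> ('a, 'c) dgalg \<Rightarrow> bool"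
  for A :: "'a dg" where
  zigzag_Nil: "dg_alg A X \<Longrightarrow> zigzag A X [] X"
| zigzag_Mor: "f \<in> alg_hom A X Y \<Longrightarrow> zigzag A Y p Z \<Longrightarrow> zigzag A X (Mor X f Y # p) Z"
| zigzag_Inv: "f \<in> alg_qis A Y X \<Longrightarrow> zigzag A Y p Z \<Longrightarrow> zigzag A X (Inv X f Y # p) Z"

inductive zigzag_eq ::
  "'a dg \<Rightarrow> ('a, 'c) dgalg \<Rightarrow> ('a, 'c) dgalg \<Rightarrow> ('a, 'c) arrow list \<Rightarrow> ('a, 'c) arrow list \<Rightarrow> bool"
  for A :: "'a dg" where
  zigzag_eq_refl: "zigzag A X p Y \<Longrightarrow> zigzag_eq A X Y p p"
| zigzag_eq_sym: "zigzag_eq A X Y p q \<Longrightarrow> zigzag_eq A X Y q p"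
| zigzag_eq_trans: "zigzag_eq A X Y p q \<Longrightarrow> zigzag_eq A X Y q r \<Longrightarrow> zigzag_eq A X Y p r"
| zigzag_eq_cong:
    "zigzag A X u X' \<Longrightarrow> zigzag_eq A X' Y' p q \<Longrightarrow> zigzag A Y' v Y \<Longrightarrow>
     zigzag_eq A X Y (u @ p @ v) (u @ q @ v)"
| zigzag_eq_id:
    "f \<in> alg_hom A X X \<Longrightarrow> (\<And>x. x \<in> carrier (fst X) \<Longrightarrow> f x = x) \<Longrightarrow> zigzag_eq A X X [Mor X f X] []"
| zigzag_eq_comp:
    "f \<in> alg_hom A X Y \<Longrightarrow> g \<in> alg_hom A Y Z \<Longrightarrow> h \<in> alg_hom A X Z \<Longrightarrow>
     (\<And>x. x \<in> carrier (fst X) \<Longrightarrow> h x = g (f x)) \<Longrightarrow>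
     zigzag_eq A X Z [Mor X f Y, Mor Y g Z] [Mor X h Z]"
| zigzag_eq_inv_right: "f \<in> alg_qis A X Y \<Longrightarrow> zigzag_eq A X X [Mor X f Y, Inv Y f X] []"
| zigzag_eq_inv_left: "f \<in> alg_qis A X Y \<Longrightarrow> zigzag_eq A Y Y [Inv Y f X, Mor X f Y] []"

definition ho_iso :: "'a dg \<Rightarrow> ('a, 'c) dgalg \<Rightarrow> ('a, 'c) dgalg \<Rightarrow> bool" where
  "ho_iso A X Y \<longleftrightarrow>
     (\<exists>p q. zigzag A X p Y \<and> zigzag A Y q X \<and> zigzag_eq A X X (p @ q) [] \<and> zigzag_eq A Y Y (q @ p) [])"

definition koszul_alg :: "'a dg \<Rightarrow> 'a list \<Rightarrow> ('a, nat set \<Rightarrow> 'a) dgalg" where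
  "koszul_alg A as = (koszul A as, koszul_incl A as)"


section \<open>The recursive form of regular sequences\<close>

text \<open>\<open>regular_seq_Nil\<close> and \<open>regular_seq_Cons\<close> show that \<open>regular_seq\<close> satisfies the recursion by which
  regular sequences are usually defined, up to the identification of \<open>K(K(M; a); as)\<close> with
  \<open>K(M; a, as)\<close>. The recursion holds for every choice of the lift \<open>a\<close> of \<open>x\<close>.\<close>

lemma sgnpow_closed: "abelian_group M \<Longrightarrow> x \<in> carrier M \<Longrightarrow> sgnpow M k x \<in> carrier M"
  by (simp add: sgnpow_def abelian_group.a_inv_closed)

lemma sgnpow_sgnpow: "abelian_group M \<Longrightarrow> x \<in> carrier M \<Longrightarrow> sgnpow M k (sgnpow M l x) = sgnpow M (k + l) x"
  by (auto simp: sgnpow_def abelian_group.minus_minus)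

lemma sgnpow_even: "even k \<Longrightarrow> sgnpow M k x = x"
  by (simp add: sgnpow_def)

lemma sgnpow_add:
  assumes "abelian_group M" "x \<in> carrier M" "y \<in> carrier M"
  shows "sgnpow M k (x \<oplus>\<^bsub>M\<^esub> y) = sgnpow M k x \<oplus>\<^bsub>M\<^esub> sgnpow M k y"
  using assms by (simp add: sgnpow_def abelian_group.minus_add)

lemma sgnpow_hom:
  assumes "abelian_group M" "abelian_group N" and f: "f \<in> carrier M \<rightarrow> carrier N"
    and add: "\<And>x y. x \<in> carrier M \<Longrightarrow> y \<in> carrier M \<Longrightarrow> f (x \<oplus>\<^bsub>M\<^esub> y) = f x \<oplus>\<^bsub>N\<^esub> f y"
    and x: "x \<in> carrier M"
  shows "f (sgnpow M k x) = sgnpow N k (f x)"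
proof -
  interpret M: abelian_group M by fact
  interpret N: abelian_group N by fact
  have "abelian_group_hom M N f"
    by (rule abelian_group_homI) (use f add in \<open>auto intro!: M.abelian_group_axioms N.abelian_group_axioms simp: hom_def group_hom_def group_hom_axioms_def M.a_group N.a_group\<close>)
  then show ?thesis
    using x by (simp add: sgnpow_def abelian_group_hom.hom_a_inv)
qed

lemma sgnpow_finsum:
  assumes "abelian_group M" "finite I" "f \<in> I \<rightarrow> carrier M"
  shows "sgnpow M k (finsum M f I) = (\<Oplus>\<^bsub>M\<^esub>i\<in>I. sgnpow M k (f i))"
  using assms(2,3)
proof (induction I)
  case empty
  interpret abelian_group M by fact
  show ?case by (simp add: sgnpow_def)
next
  case (insert i I)
  interpret abelian_group M by fact
  have "(\<lambda>i. sgnpow M k (f i)) \<in> I \<rightarrow> carrier M" "sgnpow M k (f i) \<in> carrier M"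
    using insert.prems by (auto intro!: sgnpow_closed assms(1))
  then show ?case
    using insert by (simp add: finsum_insert sgnpow_add[OF assms(1)] Pi_iff)
qed

lemma dg_groupD:
  assumes "dg_group A"
  shows "abelian_group A" and "grd A n \<subseteq> carrier A"
    and "\<And>x y. x \<in> grd A n \<Longrightarrow> y \<in> grd A n \<Longrightarrow> x \<oplus>\<^bsub>A\<^esub> y \<in> grd A n"
    and "\<And>k x. x \<in> grd A n \<Longrightarrow> sgnpow A k x \<in> grd A n"
    and "\<zero>\<^bsub>A\<^esub> \<in> grd A n"
    and "dif A \<in> carrier A \<rightarrow> carrier A"
    and "\<And>x y. x \<in> carrier A \<Longrightarrow> y \<in> carrier A \<Longrightarrow> dif A (x \<oplus>\<^bsub>A\<^esub> y) = dif A x \<oplus>\<^bsub>A\<^esub> dif A y"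
proof -
  show ag: "abelian_group A" using assms by (simp add: dg_group_def)
  have s: "additive_subgroup (grd A n) A" using assms by (simp add: dg_group_def)
  show "grd A n \<subseteq> carrier A" using additive_subgroup.a_subset[OF s] .
  show "\<And>x y. x \<in> grd A n \<Longrightarrow> y \<in> grd A n \<Longrightarrow> x \<oplus>\<^bsub>A\<^esub> y \<in> grd A n"
    using additive_subgroup.a_closed[OF s] .
  show "\<zero>\<^bsub>A\<^esub> \<in> grd A n" using additive_subgroup.zero_closed[OF s] .
  show "\<And>k x. x \<in> grd A n \<Longrightarrow> sgnpow A k x \<in> grd A n"
    using additive_subgroup.a_inv_closed[OF s] ag by (auto simp: sgnpow_def)
  show "dif A \<in> carrier A \<rightarrow> carrier A"
    "\<And>x y. x \<in> carrier A \<Longrightarrow> y \<in> carrier A \<Longrightarrow> dif A (x \<oplus>\<^bsub>A\<^esub> y) = dif A x \<oplus>\<^bsub>A\<^esub> dif A y"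
    using assms by (auto simp: dg_group_def)
qed

lemma degsgn_deg0:
  assumes A: "dg_group A" and a: "a \<in> grd A 0"
  shows "degsgn A k a = a"
proof -
  interpret abelian_group A using dg_groupD(1)[OF A] .
  define c where "c = (\<lambda>n::int. if n = 0 then a else \<zero>\<^bsub>A\<^esub>)"
  have ac: "a \<in> carrier A" using dg_groupD(2)[OF A] a by blast
  have supp: "{n. c n \<noteq> \<zero>\<^bsub>A\<^esub>} = (if a = \<zero>\<^bsub>A\<^esub> then {} else {0})" by (auto simp: c_def)
  have dec: "decomposition A a c"
    using a dg_groupD(5)[OF A] ac by (auto simp: decomposition_def supp) (auto simp: c_def)
  have "component A a = c"
    unfolding component_def using A ac dec by (intro the1_equality) (auto simp: dg_group_def)
  then have eq: "degsgn A k a = (\<Oplus>\<^bsub>A\<^esub>n\<in>{n. c n \<noteq> \<zero>\<^bsub>A\<^esub>}. sgnpow A (int k * n) (c n))"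
    by (simp add: degsgn_def)
  show ?thesis
  proof (cases "a = \<zero>\<^bsub>A\<^esub>")
    case False
    then show ?thesis using ac by (simp add: eq supp) (simp add: c_def sgnpow_def)
  qed (use eq supp in simp)
qed

lemma regular_elem_iso:
  assumes M: "\<And>n. grd M n \<subseteq> carrier M" 
    and add_closed: "\<And>y z. y \<in> carrier M \<Longrightarrow> z \<in> carrier M \<Longrightarrow> y \<oplus>\<^bsub>M\<^esub> z \<in> carrier M"
    and zero_closed: "\<zero>\<^bsub>M\<^esub> \<in> carrier M"
    and dif_closed: "\<And>y. y \<in> carrier M \<Longrightarrow> dif M y \<in> carrier M"
    and act_closed: "\<And>a y. a \<in> x \<Longrightarrow> y \<in> carrier M \<Longrightarrow> act M a y \<in> carrier M"
    and inj: "inj_on \<phi> (carrier M)"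
    and grd: "\<And>n. grd N n = \<phi> ` grd M n"
    and add: "\<And>y z. y \<in> carrier M \<Longrightarrow> z \<in> carrier M \<Longrightarrow> \<phi> (y \<oplus>\<^bsub>M\<^esub> z) = \<phi> y \<oplus>\<^bsub>N\<^esub> \<phi> z"
    and zero: "\<zero>\<^bsub>N\<^esub> = \<phi> \<zero>\<^bsub>M\<^esub>"
    and dif: "\<And>y. y \<in> carrier M \<Longrightarrow> \<phi> (dif M y) = dif N (\<phi> y)"
    and act: "\<And>a y. a \<in> x \<Longrightarrow> y \<in> carrier M \<Longrightarrow> \<phi> (act M a y) = act N a (\<phi> y)"
  shows "regular_elem m N x \<longleftrightarrow> regular_elem m M x"
proof -
  have B: "coboundaries N n = \<phi> ` coboundaries M n" for n
    unfolding coboundaries_def grd image_image using subsetD[OF M] dif by (intro image_cong) auto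
  have Bc: "coboundaries M n \<subseteq> carrier M" for n
    unfolding coboundaries_def using M dif_closed by blast
  have Z: "cocycles N n = \<phi> ` cocycles M n" for n
  proof -
    have "dif N (\<phi> y) = \<zero>\<^bsub>N\<^esub> \<longleftrightarrow> dif M y = \<zero>\<^bsub>M\<^esub>" if "y \<in> grd M n" for y
      using that M[of n] inj_onD[OF inj] dif_closed zero_closed by (auto simp: zero dif[symmetric])
    then show ?thesis by (auto simp: cocycles_def grd)
  qed
  have cos: "coboundaries N n +>\<^bsub>N\<^esub> \<phi> y = \<phi> ` (coboundaries M n +>\<^bsub>M\<^esub> y)"
    and cosc: "coboundaries M n +>\<^bsub>M\<^esub> y \<subseteq> carrier M" if "y \<in> carrier M" for y n
    proof -
    have *: "\<phi> (b \<oplus>\<^bsub>M\<^esub> y) = \<phi> b \<oplus>\<^bsub>N\<^esub> \<phi> y" if "b \<in> coboundaries M n" for b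
      using add[of b y] Bc[of n] that \<open>y \<in> carrier M\<close> by blast
    show "coboundaries N n +>\<^bsub>N\<^esub> \<phi> y = \<phi> ` (coboundaries M n +>\<^bsub>M\<^esub> y)"
      by (simp add: B a_r_coset_def r_coset_def image_UN *)
    show "coboundaries M n +>\<^bsub>M\<^esub> y \<subseteq> carrier M"
      using that Bc[of n] add_closed by (auto simp: a_r_coset_def r_coset_def)
  qed
  have C: "coh_set N n = image \<phi> ` coh_set M n" for n
    unfolding coh_set_def Z image_image
  proof (intro image_cong refl)
    fix z assume "z \<in> cocycles M n"
    then have "z \<in> carrier M" using M by (auto simp: cocycles_def)
    then show "coboundaries N n +>\<^bsub>N\<^esub> \<phi> z = \<phi> ` (coboundaries M n +>\<^bsub>M\<^esub> z)" by (rule cos)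
  qed
  have Cc: "coh_set M n \<subseteq> Pow (carrier M)" for n
    unfolding coh_set_def using cosc M[of n] by (auto simp: cocycles_def)
  have injP: "inj_on (image \<phi>) (Pow (carrier M))" using inj by (rule inj_on_image_Pow)
  have "coh_set N n = {coboundaries N n} \<longleftrightarrow> coh_set M n = {coboundaries M n}" for n
  proof -
    have "coh_set N n = {coboundaries N n} \<longleftrightarrow> image \<phi> ` coh_set M n = image \<phi> ` {coboundaries M n}"
      by (simp add: C B)
    also have "\<dots> \<longleftrightarrow> coh_set M n = {coboundaries M n}"
      using inj_on_image_eq_iff[OF injP, of "coh_set M n" "{coboundaries M n}"] Cc Bc by auto
    finally show ?thesis .
  qed
  then have inf: "coh_inf N = coh_inf M" by (simp add: coh_inf_def)
  let ?g = "\<lambda>n Y. x \<odot>\<^bsub>cohomology M n\<^esub> Y" and ?h = "\<lambda>n Y. x \<odot>\<^bsub>cohomology N n\<^esub> Y"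
  have g: "?g n Y \<in> Pow (carrier M)" "?h n (\<phi> ` Y) = \<phi> ` ?g n Y" if "Y \<in> coh_set M n" for n Y
  proof -
    have Y: "Y \<subseteq> carrier M" using that Cc by blast
    show "?g n Y \<in> Pow (carrier M)"
      using cosc act_closed Y by (auto simp: cohomology_def) blast
    have "?h n (\<phi> ` Y) = (\<Union>a\<in>x. \<Union>y\<in>Y. coboundaries N n +>\<^bsub>N\<^esub> act N a (\<phi> y))"
      by (simp add: cohomology_def)
    also have "\<dots> = (\<Union>a\<in>x. \<Union>y\<in>Y. \<phi> ` (coboundaries M n +>\<^bsub>M\<^esub> act M a y))"
      using Y act[symmetric] cos act_closed by (intro SUP_cong refl) auto
    finally show "?h n (\<phi> ` Y) = \<phi> ` ?g n Y" by (auto simp: cohomology_def)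
  qed
  have "inj_on (?h n) (coh_set N n) \<longleftrightarrow> inj_on (?g n) (coh_set M n)" for n
  proof -
    have "inj_on (?h n) (coh_set N n) \<longleftrightarrow> inj_on (?h n \<circ> image \<phi>) (coh_set M n)"
      unfolding C using comp_inj_on_iff[OF inj_on_subset[OF injP Cc]] by metis
    also have "\<dots> \<longleftrightarrow> inj_on (image \<phi> \<circ> ?g n) (coh_set M n)"
      using g(2) by (intro inj_on_cong) auto
    also have "\<dots> \<longleftrightarrow> inj_on (?g n) (coh_set M n)"
    proof
      assume "inj_on (?g n) (coh_set M n)"
      then show "inj_on (image \<phi> \<circ> ?g n) (coh_set M n)"
        using g(1) by (intro comp_inj_on inj_on_subset[OF injP]) auto
    qed (rule inj_on_imageI2)
    finally show ?thesis .
  qed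
  moreover have "carrier (cohomology M n) = coh_set M n" "carrier (cohomology N n) = coh_set N n" for n
    by (simp_all add: cohomology_def)
  ultimately show ?thesis by (simp add: regular_elem_def inf)
qed

lemma koszul_mod_sel [simp]:
  "carrier (koszul_mod A as M) = Pow {..<length as} \<rightarrow>\<^sub>E carrier M"
  "\<zero>\<^bsub>koszul_mod A as M\<^esub> = (\<lambda>S\<in>Pow {..<length as}. \<zero>\<^bsub>M\<^esub>)"
  "x \<oplus>\<^bsub>koszul_mod A as M\<^esub> y = (\<lambda>S\<in>Pow {..<length as}. x S \<oplus>\<^bsub>M\<^esub> y S)"
  "grd (koszul_mod A as M) k = Pi\<^sub>E (Pow {..<length as}) (\<lambda>S. grd M (k + int (card S)))"
  "act (koszul_mod A as M) a x = (\<lambda>S\<in>Pow {..<length as}. act M (degsgn A (card S) a) (x S))"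
  by (simp_all add: koszul_mod_def)

lemma abelian_group_koszul_mod:
  assumes "abelian_group M"
  shows "abelian_group (koszul_mod A as M)"
proof -
  interpret M: abelian_group M by fact
  show ?thesis
  proof (rule abelian_groupI)
    fix x assume x: "x \<in> carrier (koszul_mod A as M)"
    show "\<exists>y\<in>carrier (koszul_mod A as M). y \<oplus>\<^bsub>koszul_mod A as M\<^esub> x = \<zero>\<^bsub>koszul_mod A as M\<^esub>"
      using x by (intro bexI[of _ "\<lambda>S\<in>Pow {..<length as}. \<ominus>\<^bsub>M\<^esub> x S"]) (auto intro!: restrict_ext M.l_neg)
  qed (auto intro!: ext M.a_assoc M.a_comm simp: PiE_iff restrict_def extensional_def; blast intro: M.l_zero)+
qed

lemma finsum_koszul_mod:
  assumes M: "abelian_group M" and I: "finite I"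
    and f: "f \<in> I \<rightarrow> carrier (koszul_mod A as M)" and S: "S \<subseteq> {..<length as}"
  shows "finsum (koszul_mod A as M) f I S = (\<Oplus>\<^bsub>M\<^esub>i\<in>I. f i S)"
  using I f
proof (induction I)
  case empty
  interpret abelian_group M by fact
  interpret K: abelian_group "koszul_mod A as M" using abelian_group_koszul_mod[OF M] .
  show ?case using S by (simp add: K.finsum_empty del: koszul_mod_sel) (simp add: S)
next
  case (insert i I)
  interpret abelian_group M by fact
  interpret K: abelian_group "koszul_mod A as M" using abelian_group_koszul_mod[OF M] .
  have "(\<lambda>i. f i S) \<in> I \<rightarrow> carrier M" "f i S \<in> carrier M"
    using insert.prems S by (auto simp: Pi_iff PiE_iff)
  moreover have "finsum (koszul_mod A as M) f (insert i I)
      = f i \<oplus>\<^bsub>koszul_mod A as M\<^esub> finsum (koszul_mod A as M) f I"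
    using insert by (intro K.finsum_insert) auto
  ultimately show ?case using insert S by (simp add: finsum_insert)
qed


lemma koszul_mod_dif:
  "S \<subseteq> {..<length as} \<Longrightarrow> dif (koszul_mod A as M) x S =
     sgnpow M (int (card S)) (dif M (x S)) \<oplus>\<^bsub>M\<^esub>
     (\<Oplus>\<^bsub>M\<^esub>i\<in>{..<length as} - S.
        sgnpow M (int (card {j \<in> S. j < i})) (act M (as ! i) (x (insert i S))))"
  by (simp add: koszul_mod_def)

lemma koszul_mod_closed:
  assumes A: "dg_group A" and M: "abelian_group M"
    and grd: "\<And>n. grd M n \<subseteq> carrier M"
    and dif: "\<And>y. y \<in> carrier M \<Longrightarrow> dif M y \<in> carrier M"
    and act: "\<And>a y. a \<in> grd A 0 \<Longrightarrow> y \<in> carrier M \<Longrightarrow> act M a y \<in> carrier M"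
    and as: "set as \<subseteq> grd A 0"
  shows "\<And>n. grd (koszul_mod A as M) n \<subseteq> carrier (koszul_mod A as M)"
    and "\<And>y. y \<in> carrier (koszul_mod A as M) \<Longrightarrow> dif (koszul_mod A as M) y \<in> carrier (koszul_mod A as M)"
    and "\<And>a y. a \<in> grd A 0 \<Longrightarrow> y \<in> carrier (koszul_mod A as M) \<Longrightarrow>
           act (koszul_mod A as M) a y \<in> carrier (koszul_mod A as M)"
proof -
  interpret M: abelian_group M by fact
  show "grd (koszul_mod A as M) n \<subseteq> carrier (koszul_mod A as M)" for n
    using grd by (auto simp: PiE_iff)
  show "act (koszul_mod A as M) a y \<in> carrier (koszul_mod A as M)"
    if "a \<in> grd A 0" "y \<in> carrier (koszul_mod A as M)" for a y
    using that act by (auto simp: degsgn_deg0[OF A])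
  fix y assume y: "y \<in> carrier (koszul_mod A as M)"
  have "dif (koszul_mod A as M) y S \<in> carrier M" if S: "S \<subseteq> {..<length as}" for S
    unfolding koszul_mod_dif[OF S]
  proof (intro M.a_closed M.finsum_closed sgnpow_closed[OF M] dif Pi_I act)
    show "y S \<in> carrier M" using y S by auto
    fix i assume i: "i \<in> {..<length as} - S"
    show "as ! i \<in> grd A 0" using i as by auto
    have "insert i S \<in> Pow {..<length as}" using i S by auto
    then show "y (insert i S) \<in> carrier M" using y by (auto simp del: Pow_iff)
  qed
  then show "dif (koszul_mod A as M) y \<in> carrier (koszul_mod A as M)"
    by (auto simp: PiE_iff) (simp add: koszul_mod_def)
qed

lemma dg_moduleD:
  assumes "dg_module A M"
  shows "dg_group A" "dg_group M" "abelian_group M"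
    and "\<And>n. grd M n \<subseteq> carrier M"
    and "\<And>y. y \<in> carrier M \<Longrightarrow> dif M y \<in> carrier M"
    and "\<And>a y. a \<in> grd A 0 \<Longrightarrow> y \<in> carrier M \<Longrightarrow> act M a y \<in> carrier M"
    and "\<And>k y. y \<in> carrier M \<Longrightarrow> dif M (sgnpow M k y) = sgnpow M k (dif M y)"
    and "\<And>a k y. a \<in> grd A 0 \<Longrightarrow> y \<in> carrier M \<Longrightarrow> act M a (sgnpow M k y) = sgnpow M k (act M a y)"
proof -
  show A: "dg_group A" and M: "dg_group M"
    using assms by (auto simp: dg_module_def dg_ring_def)
  show ag: "abelian_group M" and g: "\<And>n. grd M n \<subseteq> carrier M"
    and d: "\<And>y. y \<in> carrier M \<Longrightarrow> dif M y \<in> carrier M"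
    using dg_groupD[OF M] by auto
  have A0: "a \<in> carrier A" if "a \<in> grd A 0" for a using dg_groupD(2)[OF A] that by blast
  then show act: "\<And>a y. a \<in> grd A 0 \<Longrightarrow> y \<in> carrier M \<Longrightarrow> act M a y \<in> carrier M"
    using assms by (auto simp: dg_module_def)
  show "\<And>k y. y \<in> carrier M \<Longrightarrow> dif M (sgnpow M k y) = sgnpow M k (dif M y)"
    by (rule sgnpow_hom[OF ag ag]) (use dg_groupD[OF M] in auto)
  show "\<And>a k y. a \<in> grd A 0 \<Longrightarrow> y \<in> carrier M \<Longrightarrow> act M a (sgnpow M k y) = sgnpow M k (act M a y)"
    by (rule sgnpow_hom[OF ag ag]) (use act A0 assms in \<open>auto simp: dg_module_def\<close>)
qed

lemma regular_elem_koszul_Nil: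
  assumes M: "dg_module A M" and x: "x \<subseteq> grd A 0"
  shows "regular_elem m (koszul_mod A [] M) x \<longleftrightarrow> regular_elem m M x"
proof -
  note D = dg_moduleD[OF M]
  interpret M: abelian_group M using D by simp
  have [simp]: "sgnpow M 0 y = y" for y by (simp add: sgnpow_def)
  show ?thesis
  proof (rule regular_elem_iso[where \<phi> = "\<lambda>y. \<lambda>S\<in>{{}}. y"])
    show "inj_on (\<lambda>y. \<lambda>S\<in>{{}::nat set}. y) (carrier M)"
      by (rule inj_onI) (metis restrict_apply singletonI)
    show "grd (koszul_mod A [] M) n = (\<lambda>y. \<lambda>S\<in>{{}}. y) ` grd M n" for n
    proof (intro equalityI subsetI)
      fix z assume "z \<in> grd (koszul_mod A [] M) n"
      then have z: "z \<in> extensional {{}}" "z {} \<in> grd M n" by (auto simp: PiE_iff)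
      then have "z = (\<lambda>S\<in>{{}}. z {})" by (intro ext) (simp add: extensional_def)
      then show "z \<in> (\<lambda>y. \<lambda>S\<in>{{}}. y) ` grd M n" using z(2) by (rule image_eqI)
    next
      fix z assume "z \<in> (\<lambda>y. \<lambda>S\<in>{{} :: nat set}. y) ` grd M n"
      then show "z \<in> grd (koszul_mod A [] M) n" by (elim imageE) (simp add: PiE_iff)
    qed
    show "(\<lambda>S\<in>{{}}. act M a y) = act (koszul_mod A [] M) a (\<lambda>S\<in>{{}}. y)"
      if "a \<in> x" "y \<in> carrier M" for a y
      using that x by (auto simp: degsgn_deg0[OF D(1)] subset_iff)
    show "(\<lambda>S\<in>{{}}. dif M y) = dif (koszul_mod A [] M) (\<lambda>S\<in>{{}}. y)" if "y \<in> carrier M" for y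
      using that D(5) by (auto simp: koszul_mod_def)
  qed (use D x in auto)
qed

lemma regular_elem_koszul_Cons:
  assumes M: "dg_module A M" and a: "a \<in> grd A 0" and as: "set as \<subseteq> grd A 0" and x: "x \<subseteq> grd A 0"
  shows "regular_elem m (koszul_mod A (a # as) M) x \<longleftrightarrow>
         regular_elem m (koszul_mod A as (koszul_mod A [a] M)) x"
proof -
  note D = dg_moduleD[OF M]
  interpret M: abelian_group M using D by simp
  define K where "K = koszul_mod A [a] M"
  define L where "L = koszul_mod A as K"
  define N where "N = koszul_mod A (a # as) M"
  define n where "n = length as"
  have Kag: "abelian_group K" unfolding K_def using D by (intro abelian_group_koszul_mod)
  have Lag: "abelian_group L" unfolding L_def using Kag by (intro abelian_group_koszul_mod)
  have Kc: "\<And>k. grd K k \<subseteq> carrier K" "\<And>y. y \<in> carrier K \<Longrightarrow> dif K y \<in> carrier K"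
    "\<And>b y. b \<in> grd A 0 \<Longrightarrow> y \<in> carrier K \<Longrightarrow> act K b y \<in> carrier K"
    unfolding K_def using D(1,3-6) a koszul_mod_closed[of A M "[a]"] by (simp_all del: koszul_mod_sel)
  have Lc: "\<And>k. grd L k \<subseteq> carrier L" "\<And>y. y \<in> carrier L \<Longrightarrow> dif L y \<in> carrier L"
    "\<And>b y. b \<in> grd A 0 \<Longrightarrow> y \<in> carrier L \<Longrightarrow> act L b y \<in> carrier L"
    unfolding L_def using D(1) Kag Kc as koszul_mod_closed[of A K as]
    by (simp_all del: koszul_mod_sel)
  have Kcar: "carrier K = Pow {0} \<rightarrow>\<^sub>E carrier M"
    and Kgrd: "grd K k = Pi\<^sub>E (Pow {0}) (\<lambda>S. grd M (k + int (card S)))" for k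
    by (simp_all add: K_def lessThan_Suc)
  have Lcar: "carrier L = Pow {..<n} \<rightarrow>\<^sub>E carrier K"
    and Lgrd: "grd L k = Pi\<^sub>E (Pow {..<n}) (\<lambda>S. grd K (k + int (card S)))" for k
    by (simp_all add: L_def n_def)
  have Ncar: "carrier N = Pow {..<Suc n} \<rightarrow>\<^sub>E carrier M"
    and Ngrd: "grd N k = Pi\<^sub>E (Pow {..<Suc n}) (\<lambda>S. grd M (k + int (card S)))" for k
    by (simp_all add: N_def n_def)
  define p where "p S = {k. Suc k \<in> S}" for S
  define q where "q S = S \<inter> {0::nat}" for S
  have pq: "p S \<subseteq> {..<n}" "q S \<subseteq> {0}" if "S \<subseteq> {..<Suc n}" for S
    using that by (auto simp: p_def q_def)
  have pqS: "S = q S \<union> Suc ` p S" for S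
    by (auto simp: p_def q_def image_iff) (metis not0_implies_Suc)
  have pq_Un: "p (U \<union> Suc ` T) = T" "q (U \<union> Suc ` T) = U" if "U \<subseteq> {0}" for U T
    using that by (auto simp: p_def q_def)
  have fin: "finite T" if "T \<subseteq> {..<k}" for T and k :: nat
    using that finite_subset by blast
  have finU: "finite U" if "U \<subseteq> {0::nat}" for U using that finite_subset by blast
  have card: "card (U \<union> Suc ` T) = card U + card T" if "U \<subseteq> {0}" "T \<subseteq> {..<n}" for U T
    using that fin[OF that(2)] finU[OF that(1)] by (subst card_Un_disjoint) (auto simp: card_image)
  define \<phi> where "\<phi> y = (\<lambda>S\<in>Pow {..<Suc n}. sgnpow M (int (card (p S) * card (q S))) (y (p S) (q S)))" for y
  define \<psi> where "\<psi> z = (\<lambda>T\<in>Pow {..<n}. \<lambda>U\<in>Pow {0}. sgnpow M (int (card T * card U)) (z (U \<union> Suc ` T)))" for z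
  have Lel: "y T U \<in> carrier M" if "y \<in> carrier L" "T \<subseteq> {..<n}" "U \<subseteq> {0}" for y T U
  proof -
    have "y T \<in> carrier K" using that unfolding Lcar by auto
    then show ?thesis using that unfolding Kcar by auto
  qed
  have Lgel: "y T U \<in> grd M (k + int (card T) + int (card U))"
    if "y \<in> grd L k" "T \<subseteq> {..<n}" "U \<subseteq> {0}" for y T U k
  proof -
    have "y T \<in> grd K (k + int (card T))" using that unfolding Lgrd by auto
    then show ?thesis using that unfolding Kgrd by auto
  qed
  have USn: "U \<union> Suc ` T \<subseteq> {..<Suc n}" if "T \<subseteq> {..<n}" "U \<subseteq> {0}" for T U
    using that by auto
  have cardS: "card S = card (q S) + card (p S)" if "S \<subseteq> {..<Suc n}" for S
    using card[OF pq(2,1)[OF that]] pqS[of S] by simp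
  have \<phi>g: "\<phi> y \<in> grd N k" if "y \<in> grd L k" for y k
    unfolding Ngrd \<phi>_def
  proof (intro restrict_PiE_iff[THEN iffD2] ballI dg_groupD(4)[OF D(2)])
    fix S assume "S \<in> Pow {..<Suc n}"
    then have S: "S \<subseteq> {..<Suc n}" by simp
    show "y (p S) (q S) \<in> grd M (k + int (card S))"
      using Lgel[OF that pq[OF S]] by (simp add: cardS[OF S] algebra_simps)
  qed
  have \<psi>g: "\<psi> z \<in> grd L k" if "z \<in> grd N k" for z k
    unfolding Lgrd Kgrd \<psi>_def
  proof (intro restrict_PiE_iff[THEN iffD2] ballI dg_groupD(4)[OF D(2)])
    fix T U :: "nat set" assume "T \<in> Pow {..<n}" "U \<in> Pow {0}"
    then have TU: "T \<subseteq> {..<n}" "U \<subseteq> {0}" by simp_all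
    have "z (U \<union> Suc ` T) \<in> grd M (k + int (card (U \<union> Suc ` T)))"
      using PiE_mem[OF that[unfolded Ngrd], of "U \<union> Suc ` T"] USn[OF TU] by simp
    then show "z (U \<union> Suc ` T) \<in> grd M (k + int (card T) + int (card U))"
      by (simp add: card TU algebra_simps)
  qed
  have \<psi>\<phi>: "\<psi> (\<phi> y) = y" if y: "y \<in> carrier L" for y
  proof (rule PiE_ext[of _ "Pow {..<n}" "\<lambda>_. carrier K"])
    have 1: "\<psi> (\<phi> y) T U = y T U" if TU: "T \<subseteq> {..<n}" "U \<subseteq> {0}" for T U
      using TU USn[OF TU] Lel[OF y TU]
      by (simp add: \<psi>_def \<phi>_def pq_Un sgnpow_sgnpow[OF D(3)] sgnpow_even)
    have 2: "\<psi> (\<phi> y) T \<in> Pow {0} \<rightarrow>\<^sub>E carrier M" if "T \<subseteq> {..<n}" for T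
      using that 1 Lel[OF y] by (auto simp: PiE_iff) (simp add: \<psi>_def)
    show "\<psi> (\<phi> y) \<in> Pow {..<n} \<rightarrow>\<^sub>E carrier K"
      using 2 by (auto simp: PiE_iff Kcar) (simp_all add: \<psi>_def)
    show y': "y \<in> Pow {..<n} \<rightarrow>\<^sub>E carrier K" using y by (simp add: Lcar)
    fix T assume "T \<in> Pow {..<n}"
    then have T: "T \<subseteq> {..<n}" by simp
    show "\<psi> (\<phi> y) T = y T"
    proof (rule PiE_ext[OF 2[OF T]])
      show "y T \<in> Pow {0} \<rightarrow>\<^sub>E carrier M" using y' T by (auto simp: Kcar)
    qed (use 1 T in auto)
  qed
  have \<phi>\<psi>: "\<phi> (\<psi> z) = z" if z: "z \<in> carrier N" for z
  proof (rule PiE_ext[of _ "Pow {..<Suc n}" "\<lambda>_. carrier M"])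
    have zc: "z S \<in> carrier M" if "S \<subseteq> {..<Suc n}" for S using z that unfolding Ncar by auto
    have 1: "\<phi> (\<psi> z) S = z S" if S: "S \<subseteq> {..<Suc n}" for S
      using S pq[OF S] zc[OF S] pqS[of S, symmetric]
      by (simp add: \<psi>_def \<phi>_def sgnpow_sgnpow[OF D(3)] sgnpow_even)
    show "\<phi> (\<psi> z) \<in> Pow {..<Suc n} \<rightarrow>\<^sub>E carrier M"
      using 1 zc by (auto simp: PiE_iff) (simp add: \<phi>_def)
    show "z \<in> Pow {..<Suc n} \<rightarrow>\<^sub>E carrier M" using z by (simp add: Ncar)
    show "\<phi> (\<psi> z) S = z S" if "S \<in> Pow {..<Suc n}" for S using 1 that by simp
  qed
  have dif: "\<phi> (dif L y) = dif N (\<phi> y)" if y: "y \<in> carrier L" for y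
  proof
    fix S
    show "\<phi> (dif L y) S = dif N (\<phi> y) S"
    proof (cases "S \<subseteq> {..<Suc n}")
      case False
      then show ?thesis by (simp add: \<phi>_def N_def koszul_mod_def n_def)
    next
      case S: True
      define T where "T = p S"
      define U where "U = q S"
      have TU: "T \<subseteq> {..<n}" "U \<subseteq> {0}" using pq[OF S] by (auto simp: T_def U_def)
      have SE: "S = U \<union> Suc ` T" using pqS[of S] by (simp add: T_def U_def)
      let ?s = "sgnpow M"
      have ins: "insert k T \<subseteq> {..<n}" if "k \<in> {..<n} - T" for k using that TU by auto
      have asc: "as ! k \<in> grd A 0" if "k < n" for k using as that by (auto simp: n_def)
      note ss = sgnpow_sgnpow[OF D(3)] sgnpow_closed[OF D(3)]
      have yT: "y T \<in> carrier K" using y TU by (auto simp: Lcar)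
      have ev: "sgnpow K k z U = ?s k (z U)" if "z \<in> carrier K" for k z
        by (rule sgnpow_hom[OF Kag D(3) _ _ that, where f = "\<lambda>z. z U"])
           (use TU in \<open>auto simp: Kcar\<close>, simp add: K_def lessThan_Suc)
      define d where "d = dif M (y T U)"
      define F where "F k = act M (as ! k) (y (insert k T) U)" for k
      define E where "E = (if U = {} then act M a (y T {0}) else \<zero>\<^bsub>M\<^esub>)"
      have dc: "d \<in> carrier M" unfolding d_def using D(5) Lel[OF y TU] .
      have Fc: "F k \<in> carrier M" if "k \<in> {..<n} - T" for k
        unfolding F_def using D(6) asc Lel[OF y ins TU(2)] that by auto
      have Ec: "E \<in> carrier M" unfolding E_def using D(6)[OF a] Lel[OF y TU(1)] by auto
      have U: "U = {} \<or> U = {0}" using TU(2) by auto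
      have dK: "dif K (y T) U = ?s (int (card U)) d \<oplus>\<^bsub>M\<^esub> E"
      proof -
        have "dif K (y T) U = ?s (int (card U)) (dif M (y T U)) \<oplus>\<^bsub>M\<^esub>
            (\<Oplus>\<^bsub>M\<^esub>i\<in>{..<Suc 0} - U. ?s (int (card {j \<in> U. j < i})) (act M ([a] ! i) (y T (insert i U))))"
          unfolding K_def using TU by (subst koszul_mod_dif) (auto simp: lessThan_Suc)
        also have "(\<Oplus>\<^bsub>M\<^esub>i\<in>{..<Suc 0} - U. ?s (int (card {j \<in> U. j < i})) (act M ([a] ! i) (y T (insert i U)))) = E"
          using U Ec by (auto simp: E_def lessThan_Suc sgnpow_def)
        finally show ?thesis by (simp add: d_def)
      qed
      let ?g = "\<lambda>i. sgnpow K (int (card {j \<in> T. j < i})) (act K (as ! i) (y (insert i T)))"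
      have actK: "act K (as ! i) (y (insert i T)) \<in> carrier K" if "i \<in> {..<n} - T" for i
        using that ins[OF that] y by (intro Kc asc) (auto simp: Lcar)
      have gc: "?g \<in> {..<n} - T \<rightarrow> carrier K"
        using actK by (auto intro!: sgnpow_closed[OF Kag])
      have gU: "?g i U = ?s (int (card {j \<in> T. j < i})) (F i)" if "i \<in> {..<n} - T" for i
      proof -
        have "?g i U = ?s (int (card {j \<in> T. j < i})) (act K (as ! i) (y (insert i T)) U)"
          using ev[OF actK[OF that]] .
        also have "act K (as ! i) (y (insert i T)) U = F i"
          using that TU asc[of i] by (simp add: K_def F_def lessThan_Suc degsgn_deg0[OF D(1)])
        finally show ?thesis .
      qed
      have "dif L y T U = (sgnpow K (int (card T)) (dif K (y T)) \<oplus>\<^bsub>K\<^esub> finsum K ?g ({..<n} - T)) U"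
        unfolding L_def n_def using TU by (subst koszul_mod_dif) (auto simp: n_def)
      also have "\<dots> = sgnpow K (int (card T)) (dif K (y T)) U \<oplus>\<^bsub>M\<^esub> finsum K ?g ({..<n} - T) U"
        using TU by (simp add: K_def lessThan_Suc)
      also have "finsum K ?g ({..<n} - T) U = (\<Oplus>\<^bsub>M\<^esub>i\<in>{..<n} - T. ?g i U)"
        unfolding K_def by (rule finsum_koszul_mod[OF D(3)])
          (use gc TU in \<open>auto simp: K_def[symmetric] lessThan_Suc\<close>)
      also have "\<dots> = (\<Oplus>\<^bsub>M\<^esub>i\<in>{..<n} - T. ?s (int (card {j \<in> T. j < i})) (F i))"
        using gU Fc by (intro M.finsum_cong') (auto intro!: ss)
      also have "sgnpow K (int (card T)) (dif K (y T)) U = ?s (int (card T)) (dif K (y T) U)"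
        using ev[OF Kc(2)[OF yT]] .
      finally have LHS0: "dif L y T U = ?s (int (card T)) (?s (int (card U)) d \<oplus>\<^bsub>M\<^esub> E) \<oplus>\<^bsub>M\<^esub>
          (\<Oplus>\<^bsub>M\<^esub>i\<in>{..<n} - T. ?s (int (card {j \<in> T. j < i})) (F i))"
        by (simp add: dK)
      let ?c = "int (card T * card U)"
      have SF: "(\<Oplus>\<^bsub>M\<^esub>i\<in>{..<n} - T. ?s (int (card {j \<in> T. j < i})) (F i)) \<in> carrier M"
        using Fc by (intro M.finsum_closed) (auto intro!: ss)
      have "\<phi> (dif L y) S = ?s ?c (dif L y T U)"
        using S by (simp add: \<phi>_def T_def U_def)
      also have "\<dots> = ?s (?c + int (card T) + int (card U)) d \<oplus>\<^bsub>M\<^esub> ?s (?c + int (card T)) E \<oplus>\<^bsub>M\<^esub>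
          (\<Oplus>\<^bsub>M\<^esub>i\<in>{..<n} - T. ?s (?c + int (card {j \<in> T. j < i})) (F i))"
      proof -
        have "?s ?c (\<Oplus>\<^bsub>M\<^esub>i\<in>{..<n} - T. ?s (int (card {j \<in> T. j < i})) (F i)) =
            (\<Oplus>\<^bsub>M\<^esub>i\<in>{..<n} - T. ?s ?c (?s (int (card {j \<in> T. j < i})) (F i)))"
          using Fc by (intro sgnpow_finsum[OF D(3)]) (auto intro!: ss)
        also have "\<dots> = (\<Oplus>\<^bsub>M\<^esub>i\<in>{..<n} - T. ?s (?c + int (card {j \<in> T. j < i})) (F i))"
          using Fc by (intro M.finsum_cong') (auto simp: ss)
        finally show ?thesis
          unfolding LHS0 using dc Ec SF by (simp add: sgnpow_add[OF D(3)] ss add.assoc)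
      qed
      finally have LHS: "\<phi> (dif L y) S = \<dots>" .
      have phiS: "\<phi> y (U' \<union> Suc ` T') = ?s (int (card T' * card U')) (y T' U')"
        if "T' \<subseteq> {..<n}" "U' \<subseteq> {0}" for T' U'
        using that USn[OF that] by (simp add: \<phi>_def pq_Un)
      have cS: "card S = card U + card T" using card TU by (simp add: SE)
      let ?h = "\<lambda>i. ?s (int (card {j \<in> S. j < i})) (act M ((a # as) ! i) (\<phi> y (insert i S)))"
      have h0: "(\<Oplus>\<^bsub>M\<^esub>i\<in>{0} - U. ?h i) = ?s (?c + int (card T)) E"
        and h0c: "?h \<in> {0} - U \<rightarrow> carrier M"
      proof -
        have "?h 0 = ?s (int (card T)) E \<and> ?h 0 \<in> carrier M" if "U = {}"
        proof -
          have "\<phi> y (insert 0 S) = ?s (int (card T)) (y T {0})"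
            using phiS[of T "{0}"] TU that by (simp add: SE)
          then show ?thesis using that Lel[OF y TU(1), of "{0}"] Ec
            by (simp add: sgnpow_even D(8)[OF a] E_def ss)
        qed
        then show "(\<Oplus>\<^bsub>M\<^esub>i\<in>{0} - U. ?h i) = ?s (?c + int (card T)) E" "?h \<in> {0} - U \<rightarrow> carrier M"
          using U by (auto simp: E_def sgnpow_def)
      qed
      have hS: "?h (Suc i) = ?s (?c + int (card {j \<in> T. j < i})) (F i)" if i: "i \<in> {..<n} - T" for i
      proof -
        have "insert (Suc i) S = U \<union> Suc ` insert i T" by (auto simp: SE)
        then have "\<phi> y (insert (Suc i) S) = ?s (int (card (insert i T) * card U)) (y (insert i T) U)"
          using phiS[OF ins[OF i] TU(2)] by simp
        moreover have "card (insert i T) = Suc (card T)" using i fin[OF TU(1)] by simp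
        moreover have "{j \<in> S. j < Suc i} = U \<union> Suc ` {j \<in> T. j < i}"
          using TU(2) by (auto simp: SE)
        then have "card {j \<in> S. j < Suc i} = card U + card {j \<in> T. j < i}"
          using card[of U "{j \<in> T. j < i}"] TU by auto
        ultimately have "?h (Suc i) = ?s (int (card U + card {j \<in> T. j < i}) + int (Suc (card T) * card U)) (F i)"
          using Lel[OF y ins[OF i] TU(2)] asc[of i] i D(6) by (simp add: D(8) F_def ss)
        also have "\<dots> = ?s (?c + int (card {j \<in> T. j < i})) (F i)"
          by (simp add: sgnpow_def)
        finally show ?thesis .
      qed
      have split: "{..<Suc n} - S = ({0} - U) \<union> Suc ` ({..<n} - T)"
        using TU(2) by (auto simp: SE image_iff) (metis lessThan_iff not_less_eq old.nat.exhaust DiffI)+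
      have hSc: "?h \<in> Suc ` ({..<n} - T) \<rightarrow> carrier M"
      proof (rule Pi_I, elim imageE)
        fix j i assume "j = Suc i" and i: "i \<in> {..<n} - T"
        then show "?h j \<in> carrier M" using ss(2)[OF Fc[OF i]] by (simp only: hS[OF i])
      qed
      have "(\<Oplus>\<^bsub>M\<^esub>i\<in>{..<Suc n} - S. ?h i) = (\<Oplus>\<^bsub>M\<^esub>i\<in>{0} - U. ?h i) \<oplus>\<^bsub>M\<^esub> (\<Oplus>\<^bsub>M\<^esub>i\<in>Suc ` ({..<n} - T). ?h i)"
        unfolding split using h0c hSc by (intro M.finsum_Un_disjoint) auto
      also have "(\<Oplus>\<^bsub>M\<^esub>i\<in>Suc ` ({..<n} - T). ?h i) = (\<Oplus>\<^bsub>M\<^esub>i\<in>{..<n} - T. ?h (Suc i))"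
        using hSc by (intro M.finsum_reindex) auto
      also have "\<dots> = (\<Oplus>\<^bsub>M\<^esub>i\<in>{..<n} - T. ?s (?c + int (card {j \<in> T. j < i})) (F i))"
        by (intro M.finsum_cong' refl Pi_I) (rule ss(2)[OF Fc], assumption, rule hS)
      finally have sum: "(\<Oplus>\<^bsub>M\<^esub>i\<in>{..<Suc n} - S. ?h i) = ?s (?c + int (card T)) E \<oplus>\<^bsub>M\<^esub> \<dots>"
        by (simp only: h0)
      have "dif N (\<phi> y) S = ?s (int (card S)) (dif M (\<phi> y S)) \<oplus>\<^bsub>M\<^esub> (\<Oplus>\<^bsub>M\<^esub>i\<in>{..<Suc n} - S. ?h i)"
        unfolding N_def using S by (subst koszul_mod_dif) (auto simp: n_def)
      also have "?s (int (card S)) (dif M (\<phi> y S)) = ?s (?c + int (card T) + int (card U)) d"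
        using phiS[OF TU] Lel[OF y TU] dc
        by (simp add: SE[symmetric] D(7) d_def[symmetric] ss cS algebra_simps)
      finally show ?thesis
        unfolding LHS sum using dc Ec Fc by (subst M.a_assoc) (auto intro!: ss M.finsum_closed)
    qed
  qed
  have LN: "regular_elem m N x \<longleftrightarrow> regular_elem m L x"
  proof (rule regular_elem_iso[where \<phi> = \<phi>])
    show "inj_on \<phi> (carrier L)" by (rule inj_on_inverseI[where g = \<psi>]) (rule \<psi>\<phi>)
    show "grd N k = \<phi> ` grd L k" for k
    proof
      show "\<phi> ` grd L k \<subseteq> grd N k" using \<phi>g by auto
      have "z \<in> carrier N" if "z \<in> grd N k" for z
        using that D(4) unfolding Ngrd Ncar by (auto simp: PiE_iff)
      then show "grd N k \<subseteq> \<phi> ` grd L k" using \<psi>g \<phi>\<psi> by (metis image_eqI subsetI)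
    qed
    show "\<phi> (y \<oplus>\<^bsub>L\<^esub> z) = \<phi> y \<oplus>\<^bsub>N\<^esub> \<phi> z" if "y \<in> carrier L" "z \<in> carrier L" for y z
    proof
      fix S
      show "\<phi> (y \<oplus>\<^bsub>L\<^esub> z) S = (\<phi> y \<oplus>\<^bsub>N\<^esub> \<phi> z) S"
        using that pq[of S] Lel
        by (auto simp: \<phi>_def N_def L_def K_def n_def[symmetric] lessThan_Suc[of 0] sgnpow_add[OF D(3)])
    qed
    show "\<zero>\<^bsub>N\<^esub> = \<phi> \<zero>\<^bsub>L\<^esub>"
    proof
      have s0: "sgnpow M k \<zero>\<^bsub>M\<^esub> = \<zero>\<^bsub>M\<^esub>" for k
        using sgnpow_finsum[OF D(3), of "{}"] by simp
      fix S
      show "\<zero>\<^bsub>N\<^esub> S = \<phi> \<zero>\<^bsub>L\<^esub> S"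
        using pq[of S]
        by (auto simp: \<phi>_def N_def L_def K_def n_def[symmetric] lessThan_Suc[of 0] s0)
    qed
    show "\<phi> (act L b y) = act N b (\<phi> y)" if "b \<in> x" "y \<in> carrier L" for b y
    proof
      fix S
      have b: "b \<in> grd A 0" using that x by auto
      show "\<phi> (act L b y) S = act N b (\<phi> y) S"
        using that(2) pq[of S] Lel b
        by (auto simp: \<phi>_def N_def L_def K_def n_def[symmetric] lessThan_Suc[of 0] degsgn_deg0[OF D(1)] D(8))
    qed
    interpret L: abelian_group L by fact
    show "y \<oplus>\<^bsub>L\<^esub> z \<in> carrier L" if "y \<in> carrier L" "z \<in> carrier L" for y z using that by simp
    show "\<zero>\<^bsub>L\<^esub> \<in> carrier L" by simp
  qed (use Lc dif x in auto)
  then show ?thesis by (simp add: L_def N_def K_def)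
qed

lemma regular_seq_Nil: "regular_seq A m M []"
  by (simp add: regular_seq_def)

lemma regular_seq_Cons:
  assumes M: "dg_module A M" and x: "x \<subseteq> grd A 0" and xs: "\<And>y. y \<in> set xs \<Longrightarrow> y \<subseteq> grd A 0"
  shows "regular_seq A m M (x # xs) \<longleftrightarrow>
           regular_elem m M x \<and> (\<forall>a\<in>x. regular_seq A m (koszul_mod A [a] M) xs)"
proof -
  have "(\<forall>as. lifts as (take (Suc i) (x # xs)) \<longrightarrow> regular_elem m (koszul_mod A as M) ((x # xs) ! Suc i)) \<longleftrightarrow>
        (\<forall>a\<in>x. \<forall>as. lifts as (take i xs) \<longrightarrow>
            regular_elem m (koszul_mod A as (koszul_mod A [a] M)) (xs ! i))" (is "?l \<longleftrightarrow> ?r")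
    if i: "i < length xs" for i
  proof -
    have "?l \<longleftrightarrow> (\<forall>a\<in>x. \<forall>as. lifts as (take i xs) \<longrightarrow>
            regular_elem m (koszul_mod A (a # as) M) (xs ! i))"
      by (auto simp: lifts_def list_all2_Cons2)
    also have "\<dots> \<longleftrightarrow> ?r"
    proof (intro ball_cong refl all_cong1 imp_cong)
      fix a as assume a: "a \<in> x" and as: "lifts as (take i xs)"
      have "set as \<subseteq> grd A 0"
      proof
        fix b assume "b \<in> set as"
        then obtain y where "y \<in> set xs" "b \<in> y"
          using as unfolding lifts_def by (metis in_set_takeD list_all2_conv_all_nth in_set_conv_nth)
        then show "b \<in> grd A 0" using xs by auto
      qed
      then show "regular_elem m (koszul_mod A (a # as) M) (xs ! i) \<longleftrightarrow>
          regular_elem m (koszul_mod A as (koszul_mod A [a] M)) (xs ! i)"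
        using a x xs i by (intro regular_elem_koszul_Cons[OF M]) auto
    qed
    finally show ?thesis .
  qed
  moreover have "(\<forall>as. lifts as (take 0 (x # xs)) \<longrightarrow> regular_elem m (koszul_mod A as M) ((x # xs) ! 0)) \<longleftrightarrow>
      regular_elem m M x"
    by (simp add: lifts_def regular_elem_koszul_Nil[OF M x])
  ultimately show ?thesis
    unfolding regular_seq_def by (auto simp: All_less_Suc2)
qed

end

theory Submission
  imports Defs
begin

text \<open>
  The Koszul DG-ring \<open>K(A; a\<^sub>1, \<dots>, a\<^sub>n)\<close> arises from \<open>A\<close> by successively adjoining exterior variables \<open>e\<^sub>i\<close> of
  degree \<open>-1\<close> with \<open>d e\<^sub>i = a\<^sub>i\<close>. Hence a DG-ring map \<open>f\<close> from \<open>A\<close> to a commutative DG-ring \<open>L\<close> extends to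
  it as soon as elements \<open>\<xi>\<^sub>i\<close> of degree \<open>-1\<close> with \<open>d \<xi>\<^sub>i = f a\<^sub>i\<close> are given, and two extensions whose values
  on every \<open>e\<^sub>i\<close> differ by a coboundary are homotopic. In (2), \<open>f a\<^sub>i\<close> lies in the ideal generated by \<^emph>\<open>any\<close>
  regular system of parameters of \<open>B\<close> up to a coboundary, so that such \<open>\<xi>\<^sub>i\<close> exist in the Koszul complex
  of \<open>B\<close>.

  For (1), let \<open>\<phi>\<close> be an \<open>A\<close>-algebra map from \<open>K(A; a'\<^sub>1, \<dots>, a'\<^sub>k)\<close> to \<open>K(A; a\<^sub>1, \<dots>, a\<^sub>n)\<close>. It maps the
  variables to \<open>c\<^sub>i + \<Sum>\<^sub>l r\<^sub>i\<^sub>l e\<^sub>l\<close>. If the classes of the \<open>a\<^sub>l\<close> generate the maximal ideal minimally, then the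
  matrix \<open>r\<close> has a left inverse over \<open>H\<^sup>0(A)\<close> by Nakayama's lemma. Lifting it, and correcting the result by
  elements of \<open>A\<close> of degree \<open>-1\<close>, one finds an \<open>A\<close>-algebra map \<open>\<psi>\<close> in the opposite direction for which
  \<open>\<phi> \<circ> \<psi>\<close> changes every \<open>e\<^sub>l\<close> only by a coboundary, so that it induces the identity on cohomology.
  Applying this twice makes \<open>\<psi>\<close> a quasi-isomorphism.
\<close>

section \<open>Commutative DG-rings\<close>

text \<open>The Koszul DG-ring consists of coefficient functions on finite sets with explicit signs.
  Checking associativity and the Leibniz rule on them directly would mean computing with inversion
  counts. The locale \<open>exterior_ext\<close> avoids this: one exterior variable is described by
  two coordinates, and only the passage from \<open>as\<close> to \<open>a # as\<close> is compared
  with the sign formulas.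

  In (1), \<open>A\<close> need not be local in degree 0, so that the matrix has a left inverse only
  after passing to \<open>H0 A\<close>. Its lift is a left inverse up to coboundaries of
  \<open>A\<close>, and these are absorbed by elements of degree -2 in the Koszul DG-ring; this is
  why homotopies appear instead of strict inverses. The two systems may have different lengths
  throughout the argument: \<open>\<psi>\<close> is injective on cohomology because of
  \<open>\<phi> \<circ> \<psi>\<close> and surjective because of
  \<open>\<psi> \<circ> \<phi>'\<close>, where \<open>\<phi>'\<close> comes from the second
  application and is never compared with \<open>\<phi>\<close>.\<close>

locale comm_dg_ring = ring A for A :: "('a, 'z) dg_scheme" (structure) +
  assumes dg_ring: "dg_ring A"

lemma comm_dg_ring_iff: "comm_dg_ring A \<longleftrightarrow> dg_ring A"
  by (auto simp: comm_dg_ring_def comm_dg_ring_axioms_def dg_ring_def)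

context comm_dg_ring
begin

lemma dg_group: "dg_group A"
  using dg_ring by (simp add: dg_ring_def)

lemma grd_carrier: "x \<in> grd A n \<Longrightarrow> x \<in> carrier A"
  using dg_groupD(2)[OF dg_group] by blast

lemmas grd_add = dg_groupD(3)[OF dg_group]
lemmas grd_sgnpow = dg_groupD(4)[OF dg_group]
lemmas grd_zero = dg_groupD(5)[OF dg_group]

lemma sgn_closed [simp]: "x \<in> carrier A \<Longrightarrow> sgnpow A k x \<in> carrier A"
  by (rule sgnpow_closed) (rule is_abelian_group)

lemma grd_neg: "x \<in> grd A n \<Longrightarrow> \<ominus> x \<in> grd A n"
  using grd_sgnpow[of x n 1] by (simp add: sgnpow_def)

lemma grd_minus: "x \<in> grd A n \<Longrightarrow> y \<in> grd A n \<Longrightarrow> x \<ominus> y \<in> grd A n"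
  by (simp add: a_minus_def grd_add grd_neg)

lemma grd_finsum: "f \<in> I \<rightarrow> grd A n \<Longrightarrow> finsum A f I \<in> grd A n"
proof (induction I rule: infinite_finite_induct)
  case (insert i I)
  then show ?case
    by (subst finsum_insert) (auto intro!: grd_add intro: grd_carrier)
qed (auto simp: grd_zero)

lemma dif_closed [simp]: "x \<in> carrier A \<Longrightarrow> dif A x \<in> carrier A"
  using dg_groupD(6)[OF dg_group] by blast

lemmas dif_add = dg_groupD(7)[OF dg_group]

lemma dif_grd: "x \<in> grd A n \<Longrightarrow> dif A x \<in> grd A (n + 1)"
  and dif_dif: "x \<in> carrier A \<Longrightarrow> dif A (dif A x) = \<zero>"
  using dg_group by (auto simp: dg_group_def)

lemma dif_zero [simp]: "dif A \<zero> = \<zero>"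
  using dif_add[of \<zero> \<zero>] add.r_cancel_one[of "dif A \<zero>" "dif A \<zero>"] by simp

lemma dif_neg: "x \<in> carrier A \<Longrightarrow> dif A (\<ominus> x) = \<ominus> dif A x"
  using dif_add[of "\<ominus> x" x] by (simp add: l_neg minus_equality[symmetric])

lemma dif_finsum: "f \<in> I \<rightarrow> carrier A \<Longrightarrow> dif A (finsum A f I) = (\<Oplus>i\<in>I. dif A (f i))"
proof (induction I rule: infinite_finite_induct)
  case (insert i I)
  then show ?case
    by (auto simp: dif_add Pi_iff)
qed auto

lemma grd_pos: "n > 0 \<Longrightarrow> grd A n = {\<zero>}"
  and grd_one: "\<one> \<in> grd A 0"
  and grd_mult: "x \<in> grd A i \<Longrightarrow> y \<in> grd A j \<Longrightarrow> x \<otimes> y \<in> grd A (i + j)"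
  and dif_mult: "x \<in> grd A i \<Longrightarrow> y \<in> grd A j \<Longrightarrow>
        dif A (x \<otimes> y) = dif A x \<otimes> y \<oplus> sgnpow A i (x \<otimes> dif A y)"
  and graded_comm: "x \<in> grd A i \<Longrightarrow> y \<in> grd A j \<Longrightarrow> y \<otimes> x = sgnpow A (i * j) (x \<otimes> y)"
  and odd_square: "odd i \<Longrightarrow> x \<in> grd A i \<Longrightarrow> x \<otimes> x = \<zero>"
  using dg_ring unfolding dg_ring_def by blast+

lemma dif_grd0: "x \<in> grd A 0 \<Longrightarrow> dif A x = \<zero>"
  using dif_grd[of x 0] grd_pos[of 1] by auto

lemma dif_one: "dif A \<one> = \<zero>"
  using dif_grd0[OF grd_one] .

lemma grd_mult0: "x \<in> grd A 0 \<Longrightarrow> y \<in> grd A n \<Longrightarrow> x \<otimes> y \<in> grd A n"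
  using grd_mult[of x 0 y n] by simp

section \<open>Signs, homogeneous decompositions and graded commutativity\<close>

lemma sgn_mult:
  assumes "x \<in> carrier A" "y \<in> carrier A"
  shows "sgnpow A k x \<otimes> y = sgnpow A k (x \<otimes> y)" "x \<otimes> sgnpow A k y = sgnpow A k (x \<otimes> y)"
  using assms by (auto simp: sgnpow_def l_minus r_minus)

text \<open>Replaces the exact support by any finite superset, so that several decompositions can be
  summed over one common index set.\<close>

lemma decomposition_iff:
  assumes "finite F" "\<And>n. n \<notin> F \<Longrightarrow> c n = \<zero>"
  shows "decomposition A x c \<longleftrightarrow> (\<forall>n. c n \<in> grd A n) \<and> x = (\<Oplus>n\<in>F. c n)"
proof -
  have "(\<Oplus>n\<in>{n. c n \<noteq> \<zero>}. c n) = (\<Oplus>n\<in>F. c n)" if "\<forall>n. c n \<in> grd A n"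
    using assms that by (intro add.finprod_mono_neutral_cong_left) (auto intro: grd_carrier)
  moreover have "finite {n. c n \<noteq> \<zero>}"
    using assms by (metis (mono_tags, lifting) finite_subset mem_Collect_eq subsetI)
  ultimately show ?thesis by (auto simp: decomposition_def)
qed

lemma decomposition_component: "x \<in> carrier A \<Longrightarrow> decomposition A x (component A x)"
  unfolding component_def using dg_group unfolding dg_group_def by (blast intro: theI'[of "decomposition A x"])

lemma component_eqI:
  assumes "decomposition A x c"
  shows "component A x = c"
proof -
  have "x \<in> carrier A"
    using assms grd_carrier by (auto simp: decomposition_def intro!: finsum_closed)
  then have "\<exists>!c. decomposition A x c"
    using dg_group unfolding dg_group_def by blast
  then show ?thesis
    using assms unfolding component_def by (blast intro: the1_equality)
qed

text \<open>Every element is a finite sum of its components. Additive identities about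
  \<open>degsgn\<close>, products and maps therefore need to be checked on homogeneous elements
  only.\<close>

lemma homogeneous_induct [consumes 1, case_names zero homogeneous add]:
  assumes x: "x \<in> carrier A" and zero: "P \<zero>" and hom: "\<And>n x. x \<in> grd A n \<Longrightarrow> P x"
    and add: "\<And>x y. x \<in> carrier A \<Longrightarrow> y \<in> carrier A \<Longrightarrow> P x \<Longrightarrow> P y \<Longrightarrow> P (x \<oplus> y)"
  shows "P x"
proof -
  obtain c where c: "\<And>n. c n \<in> grd A n" "finite {n. c n \<noteq> \<zero>}" "x = (\<Oplus>n\<in>{n. c n \<noteq> \<zero>}. c n)"
    using decomposition_component[OF x] by (auto simp: decomposition_def)
  have "P (\<Oplus>n\<in>F. c n)" if "finite F" for F
    using that
  proof induction
    case (insert n F)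
    then show ?case
      using hom[OF c(1)] grd_carrier[OF c(1)] by (auto intro!: add finsum_closed)
  qed (simp add: zero)
  then show ?thesis using c by simp
qed

lemma degsgn_eq:
  assumes "decomposition A x c" "finite F" "\<And>n. n \<notin> F \<Longrightarrow> c n = \<zero>"
  shows "degsgn A k x = (\<Oplus>n\<in>F. sgnpow A (int k * n) (c n))"
proof -
  have "c n \<in> carrier A" for n using assms(1) grd_carrier by (auto simp: decomposition_def)
  then show ?thesis
    unfolding degsgn_def component_eqI[OF assms(1)] using assms(2,3)
    by (intro add.finprod_mono_neutral_cong_left) (auto simp: sgnpow_def)
qed

lemma degsgn_homogeneous:
  assumes x: "x \<in> grd A n"
  shows "degsgn A k x = sgnpow A (int k * n) x"
proof -
  define c where "c = (\<lambda>i. if i = n then x else \<zero>)"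
  have "decomposition A x c"
    using x grd_zero grd_carrier by (subst decomposition_iff[of "{n}"]) (auto simp: c_def)
  then have "degsgn A k x = (\<Oplus>i\<in>{n}. sgnpow A (int k * i) (c i))"
    by (rule degsgn_eq) (auto simp: c_def)
  then show ?thesis using x grd_carrier by (simp add: c_def)
qed

lemma degsgn_add:
  assumes x: "x \<in> carrier A" and y: "y \<in> carrier A"
  shows "degsgn A k (x \<oplus> y) = degsgn A k x \<oplus> degsgn A k y"
proof -
  define c where "c = component A x"
  define d where "d = component A y"
  have c: "decomposition A x c" and d: "decomposition A y d"
    using decomposition_component x y by (auto simp: c_def d_def)
  \<comment> \<open>A common index set: the support of the sum may be smaller than the union of the
    supports, because components can cancel.\<close>
  define F where "F = {n. c n \<noteq> \<zero>} \<union> {n. d n \<noteq> \<zero>}"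
  have F: "finite F" "\<And>n. n \<notin> F \<Longrightarrow> c n = \<zero>" "\<And>n. n \<notin> F \<Longrightarrow> d n = \<zero>"
    using c d by (auto simp: F_def decomposition_def)
  have g: "c n \<in> grd A n" "d n \<in> grd A n" for n using c d by (auto simp: decomposition_def)
  note gc = g[THEN grd_carrier]
  have "x = (\<Oplus>n\<in>F. c n)" "y = (\<Oplus>n\<in>F. d n)"
    using c d F decomposition_iff[of F] by metis+
  then have "decomposition A (x \<oplus> y) (\<lambda>n. c n \<oplus> d n)"
    using F g gc by (subst decomposition_iff[of F]) (auto intro!: grd_add finsum_addf[symmetric])
  then have "degsgn A k (x \<oplus> y) = (\<Oplus>n\<in>F. sgnpow A (int k * n) (c n \<oplus> d n))"
    using F by (intro degsgn_eq) auto
  also have "\<dots> = (\<Oplus>n\<in>F. sgnpow A (int k * n) (c n)) \<oplus> (\<Oplus>n\<in>F. sgnpow A (int k * n) (d n))"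
    using gc by (subst finsum_addf[symmetric]) (auto simp: sgnpow_add[OF is_abelian_group])
  also have "\<dots> = degsgn A k x \<oplus> degsgn A k y"
    using c d F by (simp add: degsgn_eq[of x c F] degsgn_eq[of y d F])
  finally show ?thesis .
qed

lemma degsgn_closed [simp]: "x \<in> carrier A \<Longrightarrow> degsgn A k x \<in> carrier A"
proof (induction x rule: homogeneous_induct)
  case zero
  then show ?case using degsgn_homogeneous[OF grd_zero, of k 0] by simp
qed (auto simp: degsgn_homogeneous degsgn_add grd_carrier)

lemma degsgn_zero [simp]: "degsgn A k \<zero> = \<zero>"
  using degsgn_homogeneous[OF grd_zero, of k 0] by (simp add: sgnpow_def)

lemma degsgn_grd: "x \<in> grd A n \<Longrightarrow> degsgn A k x \<in> grd A n"
  by (simp add: degsgn_homogeneous grd_sgnpow)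

lemma degsgn_sgn: "x \<in> carrier A \<Longrightarrow> degsgn A k (sgnpow A l x) = sgnpow A l (degsgn A k x)"
  by (rule sgnpow_hom[OF is_abelian_group is_abelian_group]) (auto simp: degsgn_add)

lemma degsgn_degsgn: "x \<in> carrier A \<Longrightarrow> degsgn A k (degsgn A l x) = degsgn A (k + l) x"
proof (induction x rule: homogeneous_induct)
  case (homogeneous n x)
  then show ?case
    using degsgn_homogeneous[OF grd_sgnpow[OF homogeneous]]
    by (simp add: degsgn_homogeneous grd_carrier sgnpow_sgnpow[OF is_abelian_group] algebra_simps)
qed (auto simp: degsgn_add)

text \<open>Degrees add under multiplication, so the signs (-1)^(k n) multiply. Associativity of the
  twisted product in \<open>exterior_ext\<close> rests on this.\<close>

lemma degsgn_mult:
  assumes x: "x \<in> carrier A" and y: "y \<in> carrier A"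
  shows "degsgn A k (x \<otimes> y) = degsgn A k x \<otimes> degsgn A k y"
  using x
proof (induction x rule: homogeneous_induct)
  case (homogeneous i x)
  show ?case using y
  proof (induction y rule: homogeneous_induct)
    case (homogeneous j y)
    then show ?case
      using \<open>x \<in> grd A i\<close>
      by (simp add: degsgn_homogeneous[OF grd_mult] degsgn_homogeneous grd_carrier sgn_mult
        sgnpow_sgnpow[OF is_abelian_group] algebra_simps)
  qed (use homogeneous grd_carrier in \<open>auto simp: r_distr degsgn_add\<close>)
qed (use y in \<open>auto simp: l_distr degsgn_add\<close>)

lemma degsgn_one: "degsgn A k \<one> = \<one>"
  using degsgn_deg0[OF dg_group grd_one] .

text \<open>Only the degree of the first factor enters the sign, so the second factor may be
  inhomogeneous. The first factor will be a scalar of degree 0, a variable, or an element of degree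
  -2.\<close>

lemma dif_mult':
  assumes x: "x \<in> grd A i" and y: "y \<in> carrier A"
  shows "dif A (x \<otimes> y) = dif A x \<otimes> y \<oplus> sgnpow A i (x \<otimes> dif A y)"
  using y
proof (induction y rule: homogeneous_induct)
  case (add y z)
  have "dif A (x \<otimes> (y \<oplus> z)) = (dif A x \<otimes> y \<oplus> sgnpow A i (x \<otimes> dif A y)) \<oplus> (dif A x \<otimes> z \<oplus> sgnpow A i (x \<otimes> dif A z))"
    using add x grd_carrier[OF x] by (simp add: r_distr dif_add)
  also have "\<dots> = dif A x \<otimes> (y \<oplus> z) \<oplus> sgnpow A i (x \<otimes> dif A (y \<oplus> z))"
    using add x grd_carrier[OF x] by (simp add: r_distr dif_add sgnpow_add[OF is_abelian_group] a_ac)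
  finally show ?case .
qed (use x grd_carrier[OF x] in \<open>auto simp: dif_mult sgnpow_def\<close>)

text \<open>Moving an element of degree -1 past a component of degree n costs (-1)^n, which is
  \<open>degsgn A 1\<close> componentwise. It serves to bring exterior variables to the
  front.\<close>

lemma mult_odd_comm:
  assumes x: "x \<in> grd A (-1)" and y: "y \<in> carrier A"
  shows "y \<otimes> x = x \<otimes> degsgn A 1 y"
  using y
proof (induction y rule: homogeneous_induct)
  case (homogeneous n y)
  then show ?case
    using graded_comm[OF x, of y n] x
    by (simp add: degsgn_homogeneous grd_carrier sgnpow_def r_minus)
qed (use grd_carrier[OF x] in \<open>auto simp: l_distr r_distr degsgn_add\<close>)

lemma mult_deg0_comm:
  assumes x: "x \<in> grd A 0" and y: "y \<in> carrier A"
  shows "y \<otimes> x = x \<otimes> y"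
  using y
proof (induction y rule: homogeneous_induct)
  case (homogeneous n y)
  then show ?case using graded_comm[OF x, of y n] by (simp add: sgnpow_def)
qed (use grd_carrier[OF x] in \<open>auto simp: l_distr r_distr\<close>)

end

section \<open>Homomorphisms of DG-rings\<close>

lemma dg_homD:
  assumes "f \<in> dg_hom A B"
  shows "\<And>x. x \<in> carrier A \<Longrightarrow> f x \<in> carrier B"
    and "\<And>x y. x \<in> carrier A \<Longrightarrow> y \<in> carrier A \<Longrightarrow> f (x \<oplus>\<^bsub>A\<^esub> y) = f x \<oplus>\<^bsub>B\<^esub> f y"
    and "\<And>x y. x \<in> carrier A \<Longrightarrow> y \<in> carrier A \<Longrightarrow> f (x \<otimes>\<^bsub>A\<^esub> y) = f x \<otimes>\<^bsub>B\<^esub> f y"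
    and "f \<one>\<^bsub>A\<^esub> = \<one>\<^bsub>B\<^esub>"
    and "\<And>n x. x \<in> grd A n \<Longrightarrow> f x \<in> grd B n"
    and "\<And>x. x \<in> carrier A \<Longrightarrow> f (dif A x) = dif B (f x)"
  using assms unfolding dg_hom_def ring_hom_def by blast+

lemma dg_hom_comp: "f \<in> dg_hom A B \<Longrightarrow> g \<in> dg_hom B C \<Longrightarrow> g \<circ> f \<in> dg_hom A C"
  by (auto simp: dg_hom_def ring_hom_def Pi_iff image_subset_iff)

locale dg_ring_hom = A: comm_dg_ring A + B: comm_dg_ring B
  for A :: "('a, 'y) dg_scheme" and B :: "('b, 'z) dg_scheme" +
  fixes f
  assumes hom: "f \<in> dg_hom A B"
begin

lemmas f_closed [simp] = dg_homD(1)[OF hom]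
lemmas f_add = dg_homD(2)[OF hom]
lemmas f_mult = dg_homD(3)[OF hom]
lemmas f_one = dg_homD(4)[OF hom]
lemmas f_grd = dg_homD(5)[OF hom]
lemmas f_dif = dg_homD(6)[OF hom]

lemma f_zero [simp]: "f \<zero>\<^bsub>A\<^esub> = \<zero>\<^bsub>B\<^esub>"
  using f_add[of "\<zero>\<^bsub>A\<^esub>" "\<zero>\<^bsub>A\<^esub>"] B.add.r_cancel_one[of "f \<zero>\<^bsub>A\<^esub>" "f \<zero>\<^bsub>A\<^esub>"] by simp

lemma f_sgn: "x \<in> carrier A \<Longrightarrow> f (sgnpow A k x) = sgnpow B k (f x)"
  by (rule sgnpow_hom[OF A.is_abelian_group B.is_abelian_group]) (auto simp: f_add)

lemma f_neg: "x \<in> carrier A \<Longrightarrow> f (\<ominus>\<^bsub>A\<^esub> x) = \<ominus>\<^bsub>B\<^esub> f x"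
  using f_sgn[of x 1] by (simp add: sgnpow_def)

lemma f_minus: "x \<in> carrier A \<Longrightarrow> y \<in> carrier A \<Longrightarrow> f (x \<ominus>\<^bsub>A\<^esub> y) = f x \<ominus>\<^bsub>B\<^esub> f y"
  by (simp add: a_minus_def f_neg f_add)

lemma f_finsum: "g \<in> I \<rightarrow> carrier A \<Longrightarrow> f (finsum A g I) = (\<Oplus>\<^bsub>B\<^esub>i\<in>I. f (g i))"
proof (induction I rule: infinite_finite_induct)
  case (insert i I)
  then have "(\<lambda>i. f (g i)) \<in> I \<rightarrow> carrier B" by (auto simp: Pi_iff)
  then show ?case using insert by (auto simp: f_add)
qed auto

lemma f_degsgn: "x \<in> carrier A \<Longrightarrow> f (degsgn A k x) = degsgn B k (f x)"
proof (induction x rule: A.homogeneous_induct)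
  case (homogeneous n x)
  then show ?case
    using B.degsgn_homogeneous[OF f_grd[OF homogeneous]]
    by (simp add: A.degsgn_homogeneous f_sgn A.grd_carrier)
qed (auto simp: A.degsgn_add B.degsgn_add f_add)

end

section \<open>Adjoining an exterior variable\<close>

text \<open>An element \<open>x\<close> of \<open>E\<close> is thought of as \<open>p x + e (q x)\<close>, where \<open>e\<close> is an exterior variable of
  degree \<open>-1\<close> with \<open>d e = a\<close>.\<close>

locale exterior_ext = C: comm_dg_ring C
  for C :: "('c, 'y) dg_scheme" and E :: "('e, 'z) dg_scheme" and a p q +
  assumes a: "a \<in> grd C 0"
    and p_closed [simp]: "x \<in> carrier E \<Longrightarrow> p x \<in> carrier C"
    and q_closed [simp]: "x \<in> carrier E \<Longrightarrow> q x \<in> carrier C"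
    and pq_eqI: "x \<in> carrier E \<Longrightarrow> y \<in> carrier E \<Longrightarrow> p x = p y \<Longrightarrow> q x = q y \<Longrightarrow> x = y"
    and surj: "u \<in> carrier C \<Longrightarrow> v \<in> carrier C \<Longrightarrow> \<exists>x\<in>carrier E. p x = u \<and> q x = v"
    and add_closed: "x \<in> carrier E \<Longrightarrow> y \<in> carrier E \<Longrightarrow> x \<oplus>\<^bsub>E\<^esub> y \<in> carrier E"
    and p_add: "x \<in> carrier E \<Longrightarrow> y \<in> carrier E \<Longrightarrow> p (x \<oplus>\<^bsub>E\<^esub> y) = p x \<oplus>\<^bsub>C\<^esub> p y"
    and q_add: "x \<in> carrier E \<Longrightarrow> y \<in> carrier E \<Longrightarrow> q (x \<oplus>\<^bsub>E\<^esub> y) = q x \<oplus>\<^bsub>C\<^esub> q y"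
    and zero_closed: "\<zero>\<^bsub>E\<^esub> \<in> carrier E" and p_zero: "p \<zero>\<^bsub>E\<^esub> = \<zero>\<^bsub>C\<^esub>" and q_zero: "q \<zero>\<^bsub>E\<^esub> = \<zero>\<^bsub>C\<^esub>"
    and one_closed: "\<one>\<^bsub>E\<^esub> \<in> carrier E" and p_one: "p \<one>\<^bsub>E\<^esub> = \<one>\<^bsub>C\<^esub>" and q_one: "q \<one>\<^bsub>E\<^esub> = \<zero>\<^bsub>C\<^esub>"
    and mult_closed: "x \<in> carrier E \<Longrightarrow> y \<in> carrier E \<Longrightarrow> x \<otimes>\<^bsub>E\<^esub> y \<in> carrier E"
    and p_mult: "x \<in> carrier E \<Longrightarrow> y \<in> carrier E \<Longrightarrow> p (x \<otimes>\<^bsub>E\<^esub> y) = p x \<otimes>\<^bsub>C\<^esub> p y"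
    and q_mult: "x \<in> carrier E \<Longrightarrow> y \<in> carrier E \<Longrightarrow>
      q (x \<otimes>\<^bsub>E\<^esub> y) = q x \<otimes>\<^bsub>C\<^esub> p y \<oplus>\<^bsub>C\<^esub> degsgn C 1 (p x) \<otimes>\<^bsub>C\<^esub> q y"
    and dif_closed: "x \<in> carrier E \<Longrightarrow> dif E x \<in> carrier E"
    and p_dif: "x \<in> carrier E \<Longrightarrow> p (dif E x) = dif C (p x) \<oplus>\<^bsub>C\<^esub> a \<otimes>\<^bsub>C\<^esub> q x"
    and q_dif: "x \<in> carrier E \<Longrightarrow> q (dif E x) = \<ominus>\<^bsub>C\<^esub> dif C (q x)"
    and grd_iff: "x \<in> grd E n \<longleftrightarrow> x \<in> carrier E \<and> p x \<in> grd C n \<and> q x \<in> grd C (n + 1)"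
begin

lemmas pq_simps = p_add q_add p_zero q_zero p_one q_one p_mult q_mult p_dif q_dif
  add_closed zero_closed one_closed mult_closed dif_closed

lemma abelian_group: "abelian_group E"
proof (rule abelian_groupI)
  fix x assume x: "x \<in> carrier E"
  obtain y where y: "y \<in> carrier E" "p y = \<ominus>\<^bsub>C\<^esub> p x" "q y = \<ominus>\<^bsub>C\<^esub> q x"
    using surj[of "\<ominus>\<^bsub>C\<^esub> p x" "\<ominus>\<^bsub>C\<^esub> q x"] x by auto
  show "\<exists>y\<in>carrier E. y \<oplus>\<^bsub>E\<^esub> x = \<zero>\<^bsub>E\<^esub>"
    using x y by (intro bexI[of _ y] pq_eqI) (auto simp: pq_simps C.l_neg)
qed (auto intro!: pq_eqI simp: pq_simps C.a_ac)

text \<open>All axioms are compared in the two coordinates. In (u + e v)(u' + e v') moving e past u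
  gives \<open>degsgn C 1 u\<close>, and e^2 = 0 removes the last term; this is the origin of
  \<open>q_mult\<close>. Likewise d(e v) = a v - e (d v) is the origin of \<open>p_dif\<close> and
  \<open>q_dif\<close>.\<close>

lemma E_ring: "ring E"
proof (rule ringI[OF abelian_group])
  show "monoid E"
    by (rule monoidI)
       (auto intro!: pq_eqI simp: pq_simps C.m_assoc C.degsgn_mult C.degsgn_one C.l_distr C.r_distr C.a_assoc)
qed (auto intro!: pq_eqI simp: pq_simps C.degsgn_add C.l_distr C.r_distr C.a_ac)

sublocale E: ring E
  by (rule E_ring)

lemma p_sgn: "x \<in> carrier E \<Longrightarrow> p (sgnpow E k x) = sgnpow C k (p x)"
  by (rule sgnpow_hom[OF abelian_group C.is_abelian_group]) (auto simp: p_add)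

lemma q_sgn: "x \<in> carrier E \<Longrightarrow> q (sgnpow E k x) = sgnpow C k (q x)"
  by (rule sgnpow_hom[OF abelian_group C.is_abelian_group]) (auto simp: q_add)

lemma sgn_closed: "x \<in> carrier E \<Longrightarrow> sgnpow E k x \<in> carrier E"
  by (rule sgnpow_closed[OF abelian_group])

lemma p_finsum: "f \<in> I \<rightarrow> carrier E \<Longrightarrow> p (finsum E f I) = (\<Oplus>\<^bsub>C\<^esub>i\<in>I. p (f i))"
proof (induction I rule: infinite_finite_induct)
  case (insert i I)
  then have "(\<lambda>i. p (f i)) \<in> I \<rightarrow> carrier C" by (auto simp: Pi_iff)
  then show ?case using insert by (auto simp: p_add)
qed (auto simp: p_zero)

lemma q_finsum: "f \<in> I \<rightarrow> carrier E \<Longrightarrow> q (finsum E f I) = (\<Oplus>\<^bsub>C\<^esub>i\<in>I. q (f i))"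
proof (induction I rule: infinite_finite_induct)
  case (insert i I)
  then have "(\<lambda>i. q (f i)) \<in> I \<rightarrow> carrier C" by (auto simp: Pi_iff)
  then show ?case using insert by (auto simp: q_add)
qed (auto simp: q_zero)

lemma additive_subgroup_grd: "additive_subgroup (grd E n) E"
proof (rule additive_subgroup.intro, rule E.add.subgroupI)
  have "\<zero>\<^bsub>E\<^esub> \<in> grd E n" by (simp add: grd_iff zero_closed p_zero q_zero C.grd_zero)
  then show "grd E n \<noteq> {}" by blast
next
  fix x assume x: "x \<in> grd E n"
  have "\<ominus>\<^bsub>E\<^esub> x = sgnpow E 1 x" by (simp add: sgnpow_def)
  also have "\<dots> \<in> grd E n"
    using x by (simp add: grd_iff sgn_closed p_sgn q_sgn C.grd_sgnpow)
  finally show "\<ominus>\<^bsub>E\<^esub> x \<in> grd E n" .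
qed (auto simp: grd_iff pq_simps C.grd_add)

text \<open>Since e has degree -1, the \<open>q\<close> coordinate of a component of degree n has
  degree n + 1. Hence the shift by one in the second family.\<close>

lemma decomposition_imp_components:
  assumes "decomposition E x c"
  shows "decomposition C (p x) (\<lambda>n. p (c n))" "decomposition C (q x) (\<lambda>n. q (c (n - 1)))"
proof -
  define F where "F = {n. c n \<noteq> \<zero>\<^bsub>E\<^esub>}"
  have c: "\<And>n. c n \<in> grd E n" and F: "finite F" and x: "x = finsum E c F"
    using assms by (auto simp: decomposition_def F_def)
  have cc: "c n \<in> carrier E" for n using c by (simp add: grd_iff)
  have "p x = (\<Oplus>\<^bsub>C\<^esub>n\<in>F. p (c n))"
    unfolding x using cc by (intro p_finsum) auto
  then show "decomposition C (p x) (\<lambda>n. p (c n))"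
    using c F by (subst C.decomposition_iff[OF F]) (auto simp: F_def p_zero grd_iff)
  have "q x = (\<Oplus>\<^bsub>C\<^esub>n\<in>F. q (c n))"
    unfolding x using cc by (intro q_finsum) auto
  also have "\<dots> = (\<Oplus>\<^bsub>C\<^esub>n\<in>(\<lambda>n. n + 1) ` F. q (c (n - 1)))"
    using cc by (subst C.add.finprod_reindex) auto
  finally have qx: "q x = \<dots>" .
  have "q (c (n - 1)) \<in> grd C n" for n using c[of "n - 1"] by (simp add: grd_iff)
  moreover have "q (c (n - 1)) = \<zero>\<^bsub>C\<^esub>" if "n \<notin> (\<lambda>n. n + 1) ` F" for n
  proof -
    have "n - 1 \<notin> F" using that by (auto simp: image_iff)
    then show ?thesis by (simp add: F_def q_zero)
  qed
  ultimately show "decomposition C (q x) (\<lambda>n. q (c (n - 1)))"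
    using F qx by (subst C.decomposition_iff[of "(\<lambda>n. n + 1) ` F"]) auto
qed

lemma decomposition_exists:
  assumes x: "x \<in> carrier E"
  shows "\<exists>c. decomposition E x c"
proof -
  define u where "u = component C (p x)"
  define v where "v = component C (q x)"
  have u: "decomposition C (p x) u" and v: "decomposition C (q x) v"
    using C.decomposition_component x by (auto simp: u_def v_def)
  have g: "u n \<in> grd C n" "v n \<in> grd C n" for n
    using u v by (auto simp: decomposition_def)
  note gc = g[THEN C.grd_carrier]
  have "\<forall>n. \<exists>z. z \<in> carrier E \<and> p z = u n \<and> q z = v (n + 1)"
    using surj[OF gc] by blast
  then obtain c where c: "\<And>n. c n \<in> carrier E" "\<And>n. p (c n) = u n" "\<And>n. q (c n) = v (n + 1)"
    by metis
  \<comment> \<open>The second set is shifted down because \<open>v (n + 1)\<close> belongs to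
    degree n of \<open>E\<close>.\<close>
  define F where "F = {n. u n \<noteq> \<zero>\<^bsub>C\<^esub>} \<union> (\<lambda>n. n - 1) ` {n. v n \<noteq> \<zero>\<^bsub>C\<^esub>}"
  have F: "finite F" using u v by (auto simp: F_def decomposition_def)
  have 0: "u n = \<zero>\<^bsub>C\<^esub>" "v (n + 1) = \<zero>\<^bsub>C\<^esub>" if "n \<notin> F" for n
    using that by (force simp: F_def)+
  have "(\<Oplus>\<^bsub>C\<^esub>n\<in>F. v (n + 1)) = (\<Oplus>\<^bsub>C\<^esub>n\<in>(\<lambda>n. n + 1) ` F. v n)"
    using gc by (subst C.add.finprod_reindex) auto
  also have "\<dots> = q x"
    using v F 0(2)[of "_ - 1"] C.decomposition_iff[of "(\<lambda>n. n + 1) ` F" v "q x"] by (force simp: image_iff)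
  finally have qx: "q x = (\<Oplus>\<^bsub>C\<^esub>n\<in>F. v (n + 1))" by simp
  have px: "p x = (\<Oplus>\<^bsub>C\<^esub>n\<in>F. u n)"
    using u C.decomposition_iff[OF F, of u "p x"] 0(1) by auto
  have "x = finsum E c F"
    using x c px qx by (intro pq_eqI) (auto simp: p_finsum q_finsum)
  moreover have "c n = \<zero>\<^bsub>E\<^esub>" if "n \<notin> F" for n
    using 0[OF that] c by (intro pq_eqI) (auto simp: pq_simps)
  then have sub: "{n. c n \<noteq> \<zero>\<^bsub>E\<^esub>} \<subseteq> F" by blast
  moreover have "finsum E c {n. c n \<noteq> \<zero>\<^bsub>E\<^esub>} = finsum E c F"
    using F sub c by (intro E.add.finprod_mono_neutral_cong_left) auto
  ultimately have "decomposition E x c"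
    using F c g finite_subset[OF sub F] by (simp add: decomposition_def grd_iff)
  then show ?thesis by blast
qed

lemma decomposition_unique:
  assumes "decomposition E x c" "decomposition E x d"
  shows "c = d"
proof
  fix n
  have "(\<lambda>n. p (c n)) = (\<lambda>n. p (d n))" "(\<lambda>n. q (c (n - 1))) = (\<lambda>n. q (d (n - 1)))"
    using C.component_eqI decomposition_imp_components assms by metis+
  \<comment> \<open>The second family is evaluated at \<open>n + 1\<close> to undo its
    shift.\<close>
  then have "p (c n) = p (d n)" "q (c (n + 1 - 1)) = q (d (n + 1 - 1))"
    by metis+
  moreover have "c n \<in> carrier E" "d n \<in> carrier E"
    using assms by (auto simp: decomposition_def grd_iff)
  ultimately show "c n = d n" by (intro pq_eqI) auto
qed

lemma E_dg_group: "dg_group E"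
  unfolding dg_group_def
proof (intro conjI allI ballI)
  fix x assume x: "x \<in> carrier E"
  show "\<exists>!c. decomposition E x c"
    using decomposition_exists[OF x] decomposition_unique by blast
  \<comment> \<open>As \<open>a\<close> has degree 0, it is a cocycle. So the \<open>p\<close>
    coordinate of the double differential, d(a v) + a (- d v) with v = \<open>q x\<close>,
    vanishes.\<close>
  have "dif C (a \<otimes>\<^bsub>C\<^esub> q x) = a \<otimes>\<^bsub>C\<^esub> dif C (q x)"
    using x C.dif_mult'[OF a, of "q x"] a C.grd_carrier[OF a] by (simp add: C.dif_grd0 sgnpow_def)
  then show "dif E (dif E x) = \<zero>\<^bsub>E\<^esub>"
    using x C.grd_carrier[OF a]
    by (intro pq_eqI) (auto simp: pq_simps C.dif_add C.dif_neg C.dif_dif C.r_minus C.r_neg)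
  fix y assume y: "y \<in> carrier E"
  show "dif E (x \<oplus>\<^bsub>E\<^esub> y) = dif E x \<oplus>\<^bsub>E\<^esub> dif E y"
    using x y C.grd_carrier[OF a]
    by (intro pq_eqI) (auto simp: pq_simps C.dif_add C.minus_add C.r_distr C.a_ac)
next
  fix n x assume x: "x \<in> grd E n"
  then show "dif E x \<in> grd E (n + 1)"
    using C.dif_grd[of "q x" "n + 1"] C.grd_mult0[OF a, of "q x"]
    by (auto simp: grd_iff pq_simps intro!: C.grd_add C.grd_neg C.dif_grd)
qed (auto simp: abelian_group additive_subgroup_grd dif_closed)

lemma E_dg_ring: "dg_ring E"
  unfolding dg_ring_def
proof (intro conjI allI ballI impI)
  show "grd E n = {\<zero>\<^bsub>E\<^esub>}" if "n > 0" for n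
    using that C.grd_pos[of n] C.grd_pos[of "n + 1"]
    by (auto intro!: pq_eqI simp: grd_iff pq_simps)
  show "\<one>\<^bsub>E\<^esub> \<in> grd E 0"
    by (simp add: grd_iff pq_simps C.grd_one C.grd_zero)
next
  fix i j x y assume x: "x \<in> grd E i" and y: "y \<in> grd E j"
  have c: "x \<in> carrier E" "y \<in> carrier E" using x y by (auto simp: grd_iff)
  have g: "p x \<in> grd C i" "q x \<in> grd C (i + 1)" "p y \<in> grd C j" "q y \<in> grd C (j + 1)"
    using x y by (auto simp: grd_iff)
  note gc = g[THEN C.grd_carrier]
  note s = C.degsgn_homogeneous[OF g(1)] C.degsgn_homogeneous[OF g(3)] C.sgn_mult
  show "x \<otimes>\<^bsub>E\<^esub> y \<in> grd E (i + j)"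
    using c g C.grd_mult[OF g(2,3)] C.grd_mult[OF C.degsgn_grd[OF g(1)] g(4)]
    by (auto simp: grd_iff pq_simps C.grd_mult algebra_simps intro!: C.grd_add)
  have comm: "p y \<otimes>\<^bsub>C\<^esub> p x = sgnpow C (i * j) (p x \<otimes>\<^bsub>C\<^esub> p y)"
    "q y \<otimes>\<^bsub>C\<^esub> p x = sgnpow C (i * (j + 1)) (p x \<otimes>\<^bsub>C\<^esub> q y)"
    "p y \<otimes>\<^bsub>C\<^esub> q x = sgnpow C ((i + 1) * j) (q x \<otimes>\<^bsub>C\<^esub> p y)"
    using g by (auto intro: C.graded_comm)
  show "y \<otimes>\<^bsub>E\<^esub> x = sgnpow E (i * j) (x \<otimes>\<^bsub>E\<^esub> y)"
  proof (rule pq_eqI)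
    show "q (y \<otimes>\<^bsub>E\<^esub> x) = q (sgnpow E (i * j) (x \<otimes>\<^bsub>E\<^esub> y))"
      using c gc by (simp add: pq_simps q_sgn s comm)
        (auto simp: sgnpow_def C.minus_add C.a_ac)
  qed (use c comm in \<open>auto simp: pq_simps p_sgn sgn_closed\<close>)
  have ax: "a \<in> carrier C" using C.grd_carrier[OF a] .
  have d: "dif C (p x \<otimes>\<^bsub>C\<^esub> p y) = dif C (p x) \<otimes>\<^bsub>C\<^esub> p y \<oplus>\<^bsub>C\<^esub> sgnpow C i (p x \<otimes>\<^bsub>C\<^esub> dif C (p y))"
    "dif C (p x \<otimes>\<^bsub>C\<^esub> q y) = dif C (p x) \<otimes>\<^bsub>C\<^esub> q y \<oplus>\<^bsub>C\<^esub> sgnpow C i (p x \<otimes>\<^bsub>C\<^esub> dif C (q y))"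
    "dif C (q x \<otimes>\<^bsub>C\<^esub> p y) = dif C (q x) \<otimes>\<^bsub>C\<^esub> p y \<oplus>\<^bsub>C\<^esub> sgnpow C (i + 1) (q x \<otimes>\<^bsub>C\<^esub> dif C (p y))"
    using g by (auto intro: C.dif_mult)
  have axy: "p x \<otimes>\<^bsub>C\<^esub> (a \<otimes>\<^bsub>C\<^esub> q y) = a \<otimes>\<^bsub>C\<^esub> (p x \<otimes>\<^bsub>C\<^esub> q y)"
    "q x \<otimes>\<^bsub>C\<^esub> (a \<otimes>\<^bsub>C\<^esub> q y) = a \<otimes>\<^bsub>C\<^esub> (q x \<otimes>\<^bsub>C\<^esub> q y)"
    using ax gc C.mult_deg0_comm[OF a] by (simp_all add: C.m_assoc[symmetric])
  have sd: "degsgn C 1 (dif C (p x)) = sgnpow C (i + 1) (dif C (p x))"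
    "degsgn C 1 (a \<otimes>\<^bsub>C\<^esub> q x) = sgnpow C (i + 1) (a \<otimes>\<^bsub>C\<^esub> q x)"
    using C.degsgn_homogeneous[OF C.dif_grd[OF g(1)]]
      C.degsgn_homogeneous[OF C.grd_mult0[OF a g(2)]] by auto
  \<comment> \<open>In the \<open>q\<close> coordinate, the Leibniz rule leaves two terms a (q x) (q
    y) with opposite signs: one from applying \<open>degsgn\<close> to \<open>p (dif E x)\<close>,
    one from \<open>p (dif E y)\<close>. They have to be brought together across the other
    summands.\<close>
  have cancel: "u \<oplus>\<^bsub>C\<^esub> (v \<oplus>\<^bsub>C\<^esub> (w \<oplus>\<^bsub>C\<^esub> \<ominus>\<^bsub>C\<^esub> u)) = v \<oplus>\<^bsub>C\<^esub> w"
    if "u \<in> carrier C" "v \<in> carrier C" "w \<in> carrier C" for u v w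
  proof -
    have "u \<oplus>\<^bsub>C\<^esub> (v \<oplus>\<^bsub>C\<^esub> (w \<oplus>\<^bsub>C\<^esub> \<ominus>\<^bsub>C\<^esub> u)) = (u \<oplus>\<^bsub>C\<^esub> \<ominus>\<^bsub>C\<^esub> u) \<oplus>\<^bsub>C\<^esub> (v \<oplus>\<^bsub>C\<^esub> w)"
      using that by (simp only: C.a_ac C.a_closed C.a_inv_closed)
    then show ?thesis using that by (simp add: C.r_neg)
  qed
  note sd = sd sd[unfolded One_nat_def]
  show "dif E (x \<otimes>\<^bsub>E\<^esub> y) = dif E x \<otimes>\<^bsub>E\<^esub> y \<oplus>\<^bsub>E\<^esub> sgnpow E i (x \<otimes>\<^bsub>E\<^esub> dif E y)"
  proof (rule pq_eqI)
    show "p (dif E (x \<otimes>\<^bsub>E\<^esub> y)) = p (dif E x \<otimes>\<^bsub>E\<^esub> y \<oplus>\<^bsub>E\<^esub> sgnpow E i (x \<otimes>\<^bsub>E\<^esub> dif E y))"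
      using c gc ax
      by (simp add: pq_simps p_sgn sgn_closed s d C.l_distr C.r_distr axy C.m_assoc)
         (auto simp: sgnpow_def C.minus_add C.r_minus C.a_ac axy)
    show "q (dif E (x \<otimes>\<^bsub>E\<^esub> y)) = q (dif E x \<otimes>\<^bsub>E\<^esub> y \<oplus>\<^bsub>E\<^esub> sgnpow E i (x \<otimes>\<^bsub>E\<^esub> dif E y))"
      using c gc ax
      by (simp add: pq_simps q_sgn sgn_closed s d sd C.l_distr C.r_distr axy C.m_assoc C.degsgn_add C.dif_add)
         (auto simp: sgnpow_def C.minus_add C.r_minus C.l_minus C.a_ac axy C.dif_neg d cancel)
  qed (use c in \<open>auto simp: pq_simps sgn_closed\<close>)
next
  fix i x assume i: "odd i" and x: "x \<in> grd E i"
  have c: "x \<in> carrier E" using x by (auto simp: grd_iff)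
  have g: "p x \<in> grd C i" "q x \<in> grd C (i + 1)" using x by (auto simp: grd_iff)
  note gc = g[THEN C.grd_carrier]
  \<comment> \<open>For odd i, the \<open>q\<close> coordinate of the square is (q x)(p x) - (p x)(q
    x). This is zero because \<open>q x\<close> has the even degree i + 1 and so commutes with
    \<open>p x\<close>.\<close>
  show "x \<otimes>\<^bsub>E\<^esub> x = \<zero>\<^bsub>E\<^esub>"
    using c i gc C.odd_square[OF i g(1)] C.graded_comm[OF g]
    by (intro pq_eqI) (auto simp: pq_simps C.degsgn_homogeneous[OF g(1)] sgnpow_def C.l_minus C.r_neg)
qed (auto simp: E_ring E_dg_group)

sublocale E: comm_dg_ring E
  using E_dg_ring by (simp add: comm_dg_ring_iff)

end

text \<open>A homotopy that is a twisted derivation need not respect the relation \<open>e\<^sup>2 = 0\<close>. Therefore \<open>h\<close> is only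
  required to be linear over a set \<open>B\<close> of scalars of degree 0, which suffices to extend it to \<open>p + e q\<close>.\<close>

definition dg_homotopy ::
  "('c, 'y) dg_scheme \<Rightarrow> ('l, 'z) dg_scheme \<Rightarrow> 'c set \<Rightarrow> ('c \<Rightarrow> 'l) \<Rightarrow> ('c \<Rightarrow> 'l) \<Rightarrow> ('c \<Rightarrow> 'l) \<Rightarrow> bool" where
  "dg_homotopy C L B f g h \<longleftrightarrow> h \<in> carrier C \<rightarrow> carrier L \<and>
     (\<forall>x\<in>carrier C. \<forall>y\<in>carrier C. h (x \<oplus>\<^bsub>C\<^esub> y) = h x \<oplus>\<^bsub>L\<^esub> h y) \<and>
     (\<forall>n. \<forall>x\<in>grd C n. h x \<in> grd L (n - 1)) \<and>
     (\<forall>b\<in>B. f b = g b) \<and>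
     (\<forall>b\<in>B. \<forall>x\<in>carrier C. h (b \<otimes>\<^bsub>C\<^esub> x) = f b \<otimes>\<^bsub>L\<^esub> h x) \<and>
     (\<forall>x\<in>carrier C. f x = g x \<oplus>\<^bsub>L\<^esub> (dif L (h x) \<oplus>\<^bsub>L\<^esub> h (dif C x)))"

context exterior_ext
begin

text \<open>The universal property of an exterior variable. The products match because \<xi> can be
  moved to the front at the cost of \<open>degsgn\<close> and squares to zero; the differentials
  match because d(\<xi> y) = f(a) y - \<xi> (d y) mirrors \<open>p_dif\<close> and
  \<open>q_dif\<close>.\<close>

lemma hom_extend:
  fixes L :: "('l, 'x) dg_scheme"
  assumes f: "f \<in> dg_hom C L" and L: "dg_ring L" and \<xi>: "\<xi> \<in> grd L (-1)" and d\<xi>: "dif L \<xi> = f a"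
  shows "(\<lambda>x. f (p x) \<oplus>\<^bsub>L\<^esub> \<xi> \<otimes>\<^bsub>L\<^esub> f (q x)) \<in> dg_hom E L" (is "?g \<in> _")
proof -
  interpret L: comm_dg_ring L using L by (simp add: comm_dg_ring_iff)
  interpret f: dg_ring_hom C L f using f by unfold_locales
  have \<xi>c [simp]: "\<xi> \<in> carrier L" using L.grd_carrier[OF \<xi>] .
  have \<xi>2: "\<xi> \<otimes>\<^bsub>L\<^esub> \<xi> = \<zero>\<^bsub>L\<^esub>" using L.odd_square[OF _ \<xi>] by simp
  have cm: "f y \<otimes>\<^bsub>L\<^esub> (\<xi> \<otimes>\<^bsub>L\<^esub> z) = \<xi> \<otimes>\<^bsub>L\<^esub> (degsgn L 1 (f y) \<otimes>\<^bsub>L\<^esub> z)"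
    if "y \<in> carrier C" "z \<in> carrier L" for y z
    using that L.mult_odd_comm[OF \<xi>, of "f y"] by (simp add: L.m_assoc[symmetric])
  have cm0: "\<xi> \<otimes>\<^bsub>L\<^esub> (\<xi> \<otimes>\<^bsub>L\<^esub> z) = \<zero>\<^bsub>L\<^esub>" if "z \<in> carrier L" for z
    using that \<xi>2 by (simp add: L.m_assoc[symmetric])
  have d: "dif L (\<xi> \<otimes>\<^bsub>L\<^esub> y) = f a \<otimes>\<^bsub>L\<^esub> y \<oplus>\<^bsub>L\<^esub> \<ominus>\<^bsub>L\<^esub> (\<xi> \<otimes>\<^bsub>L\<^esub> dif L y)" if "y \<in> carrier L" for y
    using L.dif_mult'[OF \<xi> that] by (simp add: d\<xi> sgnpow_def)
  have ac: "a \<in> carrier C" using C.grd_carrier[OF a] .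
  have "?g x \<otimes>\<^bsub>L\<^esub> ?g y = ?g (x \<otimes>\<^bsub>E\<^esub> y)" if "x \<in> carrier E" "y \<in> carrier E" for x y
    using that by (simp add: pq_simps f.f_add f.f_mult f.f_degsgn L.l_distr L.r_distr L.m_assoc cm cm0 L.a_ac)
  moreover have "?g (dif E x) = dif L (?g x)" if "x \<in> carrier E" for x
    using that ac by (simp add: pq_simps f.f_add f.f_mult f.f_neg f.f_dif L.dif_add d L.r_minus L.a_ac)
  moreover have "?g x \<in> grd L n" if "x \<in> grd E n" for n x
  proof -
    have "f (q x) \<in> grd L (n + 1)" "f (p x) \<in> grd L n" using that f.f_grd by (auto simp: grd_iff)
    then show ?thesis using L.grd_mult[OF \<xi>, of "f (q x)" "n + 1"] by (auto intro!: L.grd_add)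
  qed
  ultimately show ?thesis
    by (auto simp: dg_hom_def ring_hom_def pq_simps f.f_add f.f_one L.r_distr L.a_ac)
qed

text \<open>The locale knows \<open>E\<close> only through the coordinates \<open>p\<close> and
  \<open>q\<close>, so elements with given coordinates are obtained by description. For Koszul
  DG-rings they are identified in \<open>koszul_Cons_gens\<close>.\<close>

definition incl :: "'c \<Rightarrow> 'e" where
  "incl c = (THE x. x \<in> carrier E \<and> p x = c \<and> q x = \<zero>\<^bsub>C\<^esub>)"

definition var :: 'e where
  "var = (THE x. x \<in> carrier E \<and> p x = \<zero>\<^bsub>C\<^esub> \<and> q x = \<one>\<^bsub>C\<^esub>)"

lemma incl_eqI: "x \<in> carrier E \<Longrightarrow> p x = c \<Longrightarrow> q x = \<zero>\<^bsub>C\<^esub> \<Longrightarrow> incl c = x"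
  unfolding incl_def by (rule the_equality) (simp, metis pq_eqI)

lemma var_eqI: "x \<in> carrier E \<Longrightarrow> p x = \<zero>\<^bsub>C\<^esub> \<Longrightarrow> q x = \<one>\<^bsub>C\<^esub> \<Longrightarrow> var = x"
  unfolding var_def by (rule the_equality) (simp, metis pq_eqI)

lemma incl: assumes "c \<in> carrier C" shows "incl c \<in> carrier E" "p (incl c) = c" "q (incl c) = \<zero>\<^bsub>C\<^esub>"
  using surj[OF assms C.zero_closed] incl_eqI by metis+

lemma var: "var \<in> carrier E" "p var = \<zero>\<^bsub>C\<^esub>" "q var = \<one>\<^bsub>C\<^esub>"
  using surj[OF C.zero_closed C.one_closed] var_eqI by metis+

lemma var_grd: "var \<in> grd E (-1)"
  using var C.grd_zero C.grd_one by (simp add: grd_iff)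

lemma incl_hom: "incl \<in> dg_hom C E"
proof -
  have "incl c \<in> grd E n" if "c \<in> grd C n" for c n
    using that incl[OF C.grd_carrier[OF that]] by (simp add: grd_iff C.grd_zero)
  then show ?thesis
    using C.grd_carrier[OF a]
    by (auto simp: dg_hom_def ring_hom_def incl intro!: incl_eqI simp: pq_simps)
qed

lemma decompose: "x \<in> carrier E \<Longrightarrow> x = incl (p x) \<oplus>\<^bsub>E\<^esub> var \<otimes>\<^bsub>E\<^esub> incl (q x)"
  by (intro pq_eqI) (auto simp: pq_simps incl var)

text \<open>The formula is the one forced on a twisted derivation of degree -1: h(e v) = h(e) G(v) -
  F(e) h(v), the sign coming from deg e = -1, with the value \<zeta> chosen for h(e). That value
  satisfies the homotopy equation at e because F(e) - G(e) = d \<zeta>.\<close>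

lemma homotopy_extend:
  fixes L :: "('l, 'x) dg_scheme"
  assumes F: "F \<in> dg_hom E L" and G: "G \<in> dg_hom E L" and L: "dg_ring L"
    and h: "dg_homotopy C L B (F \<circ> incl) (G \<circ> incl) h"
    and B: "B \<subseteq> grd C 0" "a \<in> B"
    and \<zeta>: "\<zeta> \<in> grd L (-2)" and var\<zeta>: "F var = G var \<oplus>\<^bsub>L\<^esub> dif L \<zeta>"
  shows "dg_homotopy E L (incl ` B) F G
           (\<lambda>x. h (p x) \<oplus>\<^bsub>L\<^esub> \<zeta> \<otimes>\<^bsub>L\<^esub> G (incl (q x)) \<ominus>\<^bsub>L\<^esub> F var \<otimes>\<^bsub>L\<^esub> h (q x))" (is "dg_homotopy _ _ _ _ _ ?h")
proof -
  interpret L: comm_dg_ring L using L by (simp add: comm_dg_ring_iff)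
  interpret F: dg_ring_hom E L F using F by unfold_locales
  interpret G: dg_ring_hom E L G using G by unfold_locales
  interpret i: dg_ring_hom C E incl using incl_hom by unfold_locales
  have hc [simp]: "\<And>x. x \<in> carrier C \<Longrightarrow> h x \<in> carrier L"
    and h_add: "\<And>x y. x \<in> carrier C \<Longrightarrow> y \<in> carrier C \<Longrightarrow> h (x \<oplus>\<^bsub>C\<^esub> y) = h x \<oplus>\<^bsub>L\<^esub> h y"
    and h_grd: "\<And>x n. x \<in> grd C n \<Longrightarrow> h x \<in> grd L (n - 1)"
    and FG: "\<And>b. b \<in> B \<Longrightarrow> F (incl b) = G (incl b)"
    and h_lin: "\<And>b x. b \<in> B \<Longrightarrow> x \<in> carrier C \<Longrightarrow> h (b \<otimes>\<^bsub>C\<^esub> x) = F (incl b) \<otimes>\<^bsub>L\<^esub> h x"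
    and hom: "\<And>x. x \<in> carrier C \<Longrightarrow> F (incl x) = G (incl x) \<oplus>\<^bsub>L\<^esub> (dif L (h x) \<oplus>\<^bsub>L\<^esub> h (dif C x))"
    using h by (auto simp: dg_homotopy_def)
  define \<xi> where "\<xi> = F var"
  define \<eta> where "\<eta> = G var"
  have \<xi>: "\<xi> \<in> grd L (-1)" and \<eta>: "\<eta> \<in> grd L (-1)"
    using F.f_grd G.f_grd var_grd by (auto simp: \<xi>_def \<eta>_def)
  have \<zeta>c [simp]: "\<zeta> \<in> carrier L" and \<xi>c [simp]: "\<xi> \<in> carrier L" and \<eta>c [simp]: "\<eta> \<in> carrier L"
    using L.grd_carrier \<zeta> \<xi> \<eta> by blast+
  have \<xi>\<zeta>: "\<xi> = \<eta> \<oplus>\<^bsub>L\<^esub> dif L \<zeta>" using var\<zeta> by (simp add: \<xi>_def \<eta>_def)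
  have ac [simp]: "a \<in> carrier C" using C.grd_carrier[OF a] .
  have h_zero: "h \<zero>\<^bsub>C\<^esub> = \<zero>\<^bsub>L\<^esub>"
    using h_add[of "\<zero>\<^bsub>C\<^esub>" "\<zero>\<^bsub>C\<^esub>"] L.add.r_cancel_one[of "h \<zero>\<^bsub>C\<^esub>" "h \<zero>\<^bsub>C\<^esub>"] by simp
  have h_neg: "h (\<ominus>\<^bsub>C\<^esub> x) = \<ominus>\<^bsub>L\<^esub> h x" if "x \<in> carrier C" for x
    using sgnpow_hom[OF C.is_abelian_group L.is_abelian_group, of h x 1] that h_add
    by (auto simp: sgnpow_def)
  have dvar: "dif E var = incl a"
    using var by (intro pq_eqI) (auto simp: pq_simps incl C.dif_one)
  have d\<xi>: "dif L \<xi> = F (incl a)"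
    using F.f_dif[OF var(1)] by (simp add: \<xi>_def dvar)
  have dm\<xi>: "dif L (\<xi> \<otimes>\<^bsub>L\<^esub> y) = F (incl a) \<otimes>\<^bsub>L\<^esub> y \<oplus>\<^bsub>L\<^esub> \<ominus>\<^bsub>L\<^esub> (\<xi> \<otimes>\<^bsub>L\<^esub> dif L y)"
    and dm\<zeta>: "dif L (\<zeta> \<otimes>\<^bsub>L\<^esub> y) = dif L \<zeta> \<otimes>\<^bsub>L\<^esub> y \<oplus>\<^bsub>L\<^esub> \<zeta> \<otimes>\<^bsub>L\<^esub> dif L y" if "y \<in> carrier L" for y
    using L.dif_mult'[OF \<xi> that] L.dif_mult'[OF \<zeta> that] by (simp_all add: d\<xi> sgnpow_def)
  note ic [simp] = incl(1)
  have homE: "F x = G x \<oplus>\<^bsub>L\<^esub> (dif L (?h x) \<oplus>\<^bsub>L\<^esub> ?h (dif E x))" if x: "x \<in> carrier E" for x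
  proof -
    define u where "u = p x"
    define v where "v = q x"
    have [simp]: "u \<in> carrier C" "v \<in> carrier C" using x by (auto simp: u_def v_def)
    define hu where "hu = dif L (h u) \<oplus>\<^bsub>L\<^esub> h (dif C u)"
    define hv where "hv = dif L (h v) \<oplus>\<^bsub>L\<^esub> h (dif C v)"
    define gu where "gu = G (incl u)"
    define gv where "gv = G (incl v)"
    define dg where "dg = G (incl (dif C v))"
    have [simp]: "hu \<in> carrier L" "hv \<in> carrier L" "gu \<in> carrier L" "gv \<in> carrier L" "dg \<in> carrier L"
      by (auto simp: hu_def hv_def gu_def gv_def dg_def)
    have dgv: "dif L gv = dg"
      by (simp add: gv_def dg_def G.f_dif[symmetric] i.f_dif)
    \<comment> \<open>This term arises twice with opposite signs: from the differential of \<xi> (h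
      v), where d \<xi> is F of \<open>a\<close>, and from h(a v). The second occurrence is where
      linearity of \<open>h\<close> over \<open>a\<close> enters.\<close>
    define fh where "fh = F (incl a) \<otimes>\<^bsub>L\<^esub> h v"
    have [simp]: "fh \<in> carrier L" by (auto simp: fh_def)
    have 1: "dif L (?h x) = dif L (h u) \<oplus>\<^bsub>L\<^esub> (dif L \<zeta> \<otimes>\<^bsub>L\<^esub> gv \<oplus>\<^bsub>L\<^esub> \<zeta> \<otimes>\<^bsub>L\<^esub> dg) \<oplus>\<^bsub>L\<^esub>
        \<ominus>\<^bsub>L\<^esub> (fh \<oplus>\<^bsub>L\<^esub> \<ominus>\<^bsub>L\<^esub> (\<xi> \<otimes>\<^bsub>L\<^esub> dif L (h v)))"
      by (simp add: L.minus_eq L.dif_add L.dif_neg dm\<zeta> dm\<xi> flip: u_def v_def gv_def \<xi>_def fh_def)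
         (simp add: dgv)
    have 2: "?h (dif E x) = (h (dif C u) \<oplus>\<^bsub>L\<^esub> fh) \<oplus>\<^bsub>L\<^esub> \<ominus>\<^bsub>L\<^esub> (\<zeta> \<otimes>\<^bsub>L\<^esub> dg) \<oplus>\<^bsub>L\<^esub> \<xi> \<otimes>\<^bsub>L\<^esub> h (dif C v)"
      using x by (simp add: pq_simps h_add h_lin[OF B(2)] h_neg i.f_neg G.f_neg L.minus_eq L.r_minus
          flip: u_def v_def dg_def \<xi>_def fh_def)
    have Fx: "F x = (gu \<oplus>\<^bsub>L\<^esub> hu) \<oplus>\<^bsub>L\<^esub> \<xi> \<otimes>\<^bsub>L\<^esub> (gv \<oplus>\<^bsub>L\<^esub> hv)"
      by (subst decompose[OF x])
        (use var in \<open>simp add: F.f_add F.f_mult hom flip: u_def v_def gu_def gv_def \<xi>_def hu_def hv_def\<close>)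
    have Gx: "G x = gu \<oplus>\<^bsub>L\<^esub> \<eta> \<otimes>\<^bsub>L\<^esub> gv"
      by (subst decompose[OF x])
        (use var in \<open>simp add: G.f_add G.f_mult flip: u_def v_def gu_def gv_def \<eta>_def\<close>)
    have "G x \<oplus>\<^bsub>L\<^esub> (dif L (?h x) \<oplus>\<^bsub>L\<^esub> ?h (dif E x)) =
       gu \<oplus>\<^bsub>L\<^esub> (dif L (h u) \<oplus>\<^bsub>L\<^esub> h (dif C u)) \<oplus>\<^bsub>L\<^esub> (\<eta> \<otimes>\<^bsub>L\<^esub> gv \<oplus>\<^bsub>L\<^esub> dif L \<zeta> \<otimes>\<^bsub>L\<^esub> gv)
       \<oplus>\<^bsub>L\<^esub> (\<xi> \<otimes>\<^bsub>L\<^esub> dif L (h v) \<oplus>\<^bsub>L\<^esub> \<xi> \<otimes>\<^bsub>L\<^esub> h (dif C v)) \<oplus>\<^bsub>L\<^esub> (fh \<oplus>\<^bsub>L\<^esub> \<ominus>\<^bsub>L\<^esub> fh)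
       \<oplus>\<^bsub>L\<^esub> (\<zeta> \<otimes>\<^bsub>L\<^esub> dg \<oplus>\<^bsub>L\<^esub> \<ominus>\<^bsub>L\<^esub> (\<zeta> \<otimes>\<^bsub>L\<^esub> dg))"
      unfolding 1 2 Gx by (simp add: L.minus_add L.a_ac)
    also have "\<dots> = F x"
      unfolding Fx
      by (simp add: L.r_neg hu_def[symmetric] hv_def[symmetric] L.l_distr[symmetric] L.r_distr[symmetric] \<xi>\<zeta>[symmetric])
         (simp add: hv_def L.r_distr L.a_ac)
    finally show ?thesis by simp
  qed
  have grdE: "?h x \<in> grd L (n - 1)" if x: "x \<in> grd E n" for x n
  proof -
    have u: "p x \<in> grd C n" and v: "q x \<in> grd C (n + 1)" using x by (auto simp: grd_iff)
    have "\<zeta> \<otimes>\<^bsub>L\<^esub> G (incl (q x)) \<in> grd L (n - 1)"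
      using L.grd_mult[OF \<zeta> G.f_grd[OF i.f_grd[OF v]]] by simp
    moreover have "\<xi> \<otimes>\<^bsub>L\<^esub> h (q x) \<in> grd L (n - 1)"
      using L.grd_mult[OF \<xi> h_grd[OF v]] by simp
    ultimately show ?thesis
      using h_grd[OF u] by (auto intro!: L.grd_add L.grd_minus simp: \<xi>_def)
  qed
  \<comment> \<open>The next variable will again require linearity. In the summand with \<zeta> the
    scalar comes out through \<open>G\<close>, in the others through \<open>F\<close>; this is why
    both maps have to agree on \<open>B\<close>.\<close>
  have linE: "?h (incl b \<otimes>\<^bsub>E\<^esub> x) = F (incl b) \<otimes>\<^bsub>L\<^esub> ?h x" if b: "b \<in> B" and x: "x \<in> carrier E" for b x
  proof -
    have b0: "b \<in> grd C 0" using b B by blast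
    have bc [simp]: "b \<in> carrier C" using C.grd_carrier[OF b0] .
    have F0: "F (incl b) \<in> grd L 0" using F.f_grd[OF i.f_grd[OF b0]] .
    have Fc [simp]: "F (incl b) \<in> carrier L" by simp
    have cm: "y \<otimes>\<^bsub>L\<^esub> (F (incl b) \<otimes>\<^bsub>L\<^esub> z) = F (incl b) \<otimes>\<^bsub>L\<^esub> (y \<otimes>\<^bsub>L\<^esub> z)"
      if "y \<in> carrier L" "z \<in> carrier L" for y z
      using that L.mult_deg0_comm[OF F0, of y] by (simp add: L.m_assoc[symmetric])
    have pq: "p (incl b \<otimes>\<^bsub>E\<^esub> x) = b \<otimes>\<^bsub>C\<^esub> p x" "q (incl b \<otimes>\<^bsub>E\<^esub> x) = b \<otimes>\<^bsub>C\<^esub> q x"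
      using x by (auto simp: pq_simps incl degsgn_deg0[OF C.dg_group b0])
    show ?thesis
      using x unfolding pq
      by (simp add: h_lin[OF b] i.f_mult G.f_mult FG[OF b, symmetric] cm L.r_distr L.minus_eq L.r_minus flip: \<xi>_def)
  qed
  show ?thesis
    unfolding dg_homotopy_def
  proof (intro conjI ballI allI)
    show "?h \<in> carrier E \<rightarrow> carrier L" by (auto simp flip: \<xi>_def)
    show "?h (x \<oplus>\<^bsub>E\<^esub> y) = ?h x \<oplus>\<^bsub>L\<^esub> ?h y" if "x \<in> carrier E" "y \<in> carrier E" for x y
      using that
      by (simp add: pq_simps h_add i.f_add G.f_add L.r_distr L.minus_eq L.minus_add L.a_ac flip: \<xi>_def)
  qed (use grdE linE homE FG in auto)
qed

end

section \<open>Cohomology of maps\<close>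

context comm_dg_ring
begin

lemma coboundaries_sub: "x \<in> coboundaries A n \<Longrightarrow> x \<in> grd A n"
  using dif_grd[of _ "n - 1"] by (auto simp: coboundaries_def)

lemma coboundaries_subgroup: "additive_subgroup (coboundaries A n) A"
proof (rule additive_subgroup.intro, rule add.subgroupI)
  show "coboundaries A n \<noteq> {}" using grd_zero by (auto simp: coboundaries_def)
next
  fix x assume "x \<in> coboundaries A n"
  then obtain u where u: "u \<in> grd A (n - 1)" "x = dif A u" by (auto simp: coboundaries_def)
  then have "\<ominus> x = dif A (\<ominus> u)" by (simp add: dif_neg grd_carrier)
  then show "\<ominus> x \<in> coboundaries A n" using u by (auto simp: coboundaries_def intro!: grd_neg)
next
  fix x y assume "x \<in> coboundaries A n" "y \<in> coboundaries A n"
  then obtain u v where "u \<in> grd A (n - 1)" "x = dif A u" "v \<in> grd A (n - 1)" "y = dif A v"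
    by (auto simp: coboundaries_def)
  then have "x \<oplus> y = dif A (u \<oplus> v)" "u \<oplus> v \<in> grd A (n - 1)"
    by (auto simp: dif_add grd_carrier grd_add)
  then show "x \<oplus> y \<in> coboundaries A n" by (auto simp: coboundaries_def)
qed (auto intro: grd_carrier coboundaries_sub)

lemma coset_eq:
  assumes "y \<in> carrier A" "c \<in> coboundaries A n"
  shows "coboundaries A n +> (c \<oplus> y) = coboundaries A n +> y"
    "coboundaries A n +> (y \<oplus> c) = coboundaries A n +> y"
proof -
  have "c \<oplus> y \<in> coboundaries A n +> y" using assms by (auto simp: a_r_coset_def r_coset_def)
  then show "coboundaries A n +> (c \<oplus> y) = coboundaries A n +> y"
    using assms a_repr_independence additive_subgroup.a_subgroup[OF coboundaries_subgroup] by metis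
  then show "coboundaries A n +> (y \<oplus> c) = coboundaries A n +> y"
    using assms(1) grd_carrier[OF coboundaries_sub[OF assms(2)]] by (simp add: a_comm[of y c])
qed

lemma coset_closed:
  "y \<in> carrier A \<Longrightarrow> x \<in> coboundaries A n +> y \<Longrightarrow> \<exists>c\<in>coboundaries A n. x = c \<oplus> y"
  by (auto simp: a_r_coset_def r_coset_def)

lemma coset_self: "y \<in> carrier A \<Longrightarrow> y \<in> coboundaries A n +> y"
  using additive_subgroup.zero_closed[OF coboundaries_subgroup, of n]
  by (auto simp: a_r_coset_def r_coset_def intro!: bexI[of _ \<zero>])

end

context dg_ring_hom
begin

lemma f_coboundaries: "c \<in> coboundaries A n \<Longrightarrow> f c \<in> coboundaries B n"
  using f_grd by (auto simp: coboundaries_def f_dif A.grd_carrier)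

text \<open>\<open>coh_map\<close> is a union over all representatives of a class. They differ by
  coboundaries, which \<open>f\<close> preserves, so all cosets in the union coincide.\<close>

lemma coh_map_coset:
  assumes z: "z \<in> carrier A"
  shows "coh_map B f n (coboundaries A n +>\<^bsub>A\<^esub> z) = coboundaries B n +>\<^bsub>B\<^esub> f z"
proof -
  have "coboundaries B n +>\<^bsub>B\<^esub> f x = coboundaries B n +>\<^bsub>B\<^esub> f z"
    if x: "x \<in> coboundaries A n +>\<^bsub>A\<^esub> z" for x
  proof -
    obtain c where c: "c \<in> coboundaries A n" "x = c \<oplus>\<^bsub>A\<^esub> z" using A.coset_closed[OF z x] by blast
    then show ?thesis
      using z f_coboundaries[OF c(1)] A.coboundaries_sub[OF c(1), THEN A.grd_carrier]
      by (simp add: f_add B.coset_eq)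
  qed
  then show ?thesis using A.coset_self[OF z] unfolding coh_map_def by blast
qed

lemma coh_map_closed: "X \<in> coh_set A n \<Longrightarrow> coh_map B f n X \<in> coh_set B n"
  using f_grd f_dif[symmetric]
  by (auto simp: coh_set_def cocycles_def coh_map_coset A.grd_carrier intro!: imageI)

end

lemma coh_map_comp:
  assumes "dg_ring A" "dg_ring B" "dg_ring C" and f: "f \<in> dg_hom A B" and g: "g \<in> dg_hom B C"
    and X: "X \<in> coh_set A n"
  shows "coh_map C (g \<circ> f) n X = coh_map C g n (coh_map B f n X)"
proof -
  interpret f: dg_ring_hom A B f
    using assms by (simp add: dg_ring_hom_def dg_ring_hom_axioms_def comm_dg_ring_iff)
  interpret g: dg_ring_hom B C g
    using assms by (simp add: dg_ring_hom_def dg_ring_hom_axioms_def comm_dg_ring_iff)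
  interpret gf: dg_ring_hom A C "g \<circ> f"
    using dg_hom_comp[OF f g] by unfold_locales
  show ?thesis
    using X by (auto simp: coh_set_def cocycles_def f.coh_map_coset g.coh_map_coset gf.coh_map_coset f.A.grd_carrier)
qed

lemma id_dg_hom: "(\<lambda>x. x) \<in> dg_hom A A"
  by (auto simp: dg_hom_def ring_hom_def)

lemma coh_map_id:
  assumes "dg_ring A" and X: "X \<in> coh_set A n"
  shows "coh_map A (\<lambda>x. x) n X = X"
proof -
  interpret comm_dg_ring A using assms by (simp add: comm_dg_ring_iff)
  have "dg_ring_hom A A (\<lambda>x. x)" using id_dg_hom by unfold_locales
  then show ?thesis
    using X grd_carrier by (auto simp: coh_set_def cocycles_def dg_ring_hom.coh_map_coset)
qed

text \<open>On a cocycle z the term h(d z) is h(0) = 0, so the values of the two maps at z differ by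
  the coboundary d(h z).\<close>

lemma homotopy_coh_map:
  assumes "dg_ring C" "dg_ring L" and f: "f \<in> dg_hom C L" and g: "g \<in> dg_hom C L"
    and h: "dg_homotopy C L B f g h" and X: "X \<in> coh_set C n"
  shows "coh_map L f n X = coh_map L g n X"
proof -
  interpret f: dg_ring_hom C L f
    using assms by (simp add: dg_ring_hom_def dg_ring_hom_axioms_def comm_dg_ring_iff)
  interpret g: dg_ring_hom C L g
    using g by unfold_locales
  obtain z where z: "z \<in> grd C n" "dif C z = \<zero>\<^bsub>C\<^esub>" "X = coboundaries C n +>\<^bsub>C\<^esub> z"
    using X by (auto simp: coh_set_def cocycles_def)
  have zc: "z \<in> carrier C" using f.A.grd_carrier[OF z(1)] .
  have hc: "h x \<in> carrier L" if "x \<in> carrier C" for x using h that by (auto simp: dg_homotopy_def)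
  have "h (\<zero>\<^bsub>C\<^esub> \<oplus>\<^bsub>C\<^esub> \<zero>\<^bsub>C\<^esub>) = h \<zero>\<^bsub>C\<^esub> \<oplus>\<^bsub>L\<^esub> h \<zero>\<^bsub>C\<^esub>"
    using h f.A.zero_closed unfolding dg_homotopy_def by blast
  then have "h \<zero>\<^bsub>C\<^esub> = \<zero>\<^bsub>L\<^esub>"
    using f.B.add.r_cancel_one[of "h \<zero>\<^bsub>C\<^esub>" "h \<zero>\<^bsub>C\<^esub>"] hc by simp
  moreover have "f z = g z \<oplus>\<^bsub>L\<^esub> (dif L (h z) \<oplus>\<^bsub>L\<^esub> h (dif C z))" and hz: "h z \<in> grd L (n - 1)"
    using h zc z(1) unfolding dg_homotopy_def by blast+
  ultimately have "f z = g z \<oplus>\<^bsub>L\<^esub> dif L (h z)" using z hc zc by simp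
  moreover have "dif L (h z) \<in> coboundaries L n" using hz by (auto simp: coboundaries_def)
  ultimately show ?thesis
    using z zc by (simp add: f.coh_map_coset g.coh_map_coset f.B.coset_eq)
qed

text \<open>Needed to start the induction over the list of generators: the Koszul complex on the
  empty list is a copy of \<open>A\<close> made of functions on the one-element set
  \<open>{{}}\<close>, not \<open>A\<close> itself.\<close>

lemma dg_ring_transport:
  assumes C: "dg_ring C" and h: "h \<in> ring_iso C E" "h \<zero>\<^bsub>C\<^esub> = \<zero>\<^bsub>E\<^esub>"
    and dif: "\<And>x. x \<in> carrier C \<Longrightarrow> h (dif C x) = dif E (h x)"
    and grd: "\<And>n. grd E n = h ` grd C n"
  shows "dg_ring E"
proof -
  interpret C: comm_dg_ring C using C by (simp add: comm_dg_ring_iff)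
  \<comment> \<open>A \<open>ring_iso\<close> does not constrain the \<open>zero\<close> field, so
    the ring structure is first obtained for the image of zero and then identified with
    \<open>E\<close> by the separate hypothesis.\<close>
  have "ring (E \<lparr>zero := h \<zero>\<^bsub>C\<^esub>\<rparr>)" using h(1) by (rule C.ring_iso_imp_img_ring)
  then interpret E: ring E by (simp add: h(2))
  have car: "carrier E = h ` carrier C" and inj: "inj_on h (carrier C)"
    using h(1) by (auto simp: ring_iso_def bij_betw_def)
  have hc [simp]: "x \<in> carrier C \<Longrightarrow> h x \<in> carrier E" for x by (simp add: car)
  have add: "h (x \<oplus>\<^bsub>C\<^esub> y) = h x \<oplus>\<^bsub>E\<^esub> h y" and mult: "h (x \<otimes>\<^bsub>C\<^esub> y) = h x \<otimes>\<^bsub>E\<^esub> h y"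
    if "x \<in> carrier C" "y \<in> carrier C" for x y
    using h(1) that by (auto simp: ring_iso_def ring_hom_def)
  have sgn: "h (sgnpow C k x) = sgnpow E k (h x)" if "x \<in> carrier C" for k x
    using that add by (intro sgnpow_hom[OF C.is_abelian_group E.is_abelian_group]) auto
  have fsum: "h (finsum C c F) = (\<Oplus>\<^bsub>E\<^esub>n\<in>F. h (c n))" if "finite F" "\<And>n. c n \<in> carrier C" for c and F :: "int set"
    using that(1)
  proof induction
    case (insert n F)
    then show ?case using that(2) by (simp add: add)
  qed (simp add: h(2))
  have h0: "h x = \<zero>\<^bsub>E\<^esub> \<longleftrightarrow> x = \<zero>\<^bsub>C\<^esub>" if "x \<in> carrier C" for x
    using inj_onD[OF inj, of x "\<zero>\<^bsub>C\<^esub>"] that h(2) by auto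
  have dec: "decomposition E (h x) (\<lambda>n. h (c n)) \<longleftrightarrow> decomposition C x c"
    if "x \<in> carrier C" "\<And>n. c n \<in> grd C n" for x c
  proof -
    have cc: "c n \<in> carrier C" for n using C.grd_carrier[OF that(2)] .
    have "(\<Oplus>\<^bsub>E\<^esub>n\<in>{n. h (c n) \<noteq> \<zero>\<^bsub>E\<^esub>}. h (c n)) = h (\<Oplus>\<^bsub>C\<^esub>n\<in>{n. c n \<noteq> \<zero>\<^bsub>C\<^esub>}. c n)"
      if "finite {n. c n \<noteq> \<zero>\<^bsub>C\<^esub>}" using that cc by (simp add: fsum h0)
    moreover have "h x = h (\<Oplus>\<^bsub>C\<^esub>n\<in>{n. c n \<noteq> \<zero>\<^bsub>C\<^esub>}. c n) \<longleftrightarrow> x = (\<Oplus>\<^bsub>C\<^esub>n\<in>{n. c n \<noteq> \<zero>\<^bsub>C\<^esub>}. c n)"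
      using inj_on_eq_iff[OF inj] that(1) cc by simp
    ultimately show ?thesis using that(2) cc by (auto simp: decomposition_def grd h0)
  qed
  have grdc: "grd C n \<subseteq> carrier C" for n using C.grd_carrier by blast
  have asub: "additive_subgroup (grd E n) E" for n
  proof (rule additive_subgroup.intro, rule E.add.subgroupI)
    show "grd E n \<noteq> {}" using C.grd_zero by (auto simp: grd)
    fix x assume "x \<in> grd E n"
    then obtain u where u: "u \<in> grd C n" "x = h u" by (auto simp: grd)
    note uc = C.grd_carrier[OF u(1)]
    have "\<ominus>\<^bsub>E\<^esub> x = h (\<ominus>\<^bsub>C\<^esub> u)" using sgn[OF uc, of 1] u(2) by (simp add: sgnpow_def)
    then show "\<ominus>\<^bsub>E\<^esub> x \<in> grd E n" using C.grd_neg[OF u(1)] by (simp add: grd)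
    fix y assume "y \<in> grd E n"
    then obtain v where v: "v \<in> grd C n" "y = h v" by (auto simp: grd)
    have "x \<oplus>\<^bsub>E\<^esub> y = h (u \<oplus>\<^bsub>C\<^esub> v)" using add[OF uc C.grd_carrier[OF v(1)]] u v by simp
    then show "x \<oplus>\<^bsub>E\<^esub> y \<in> grd E n" using C.grd_add[OF u(1) v(1)] by (simp add: grd)
  qed (use grdc in \<open>auto simp: grd car\<close>)
  have "dg_group E"
    unfolding dg_group_def
  proof (intro conjI allI ballI asub E.is_abelian_group)
    show "dif E \<in> carrier E \<rightarrow> carrier E" by (auto simp: car dif[symmetric])
    fix x assume "x \<in> carrier E"
    then obtain u where u: "u \<in> carrier C" "x = h u" by (auto simp: car)
    show "\<exists>!c. decomposition E x c"
    proof (rule ex_ex1I)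
      have "decomposition C u (component C u)" using u by (simp add: C.decomposition_component)
      then have "decomposition E x (\<lambda>n. h (component C u n))"
        using u dec[of u "component C u"] by (simp add: decomposition_def)
      then show "\<exists>c. decomposition E x c" by blast
      have "c = (\<lambda>n. h (component C u n))" if c: "decomposition E x c" for c
      proof -
        have "\<forall>n. \<exists>v. v \<in> grd C n \<and> c n = h v" using c by (auto simp: decomposition_def grd)
        then obtain v where v: "\<And>n. v n \<in> grd C n" "c = (\<lambda>n. h (v n))" by metis
        then have "decomposition C u v" using c u dec[of u v] by simp
        then show ?thesis using v C.component_eqI by metis
      qed
      then show "c = d" if "decomposition E x c" "decomposition E x d" for c d
        using that by metis
    qed
    show "dif E (dif E x) = \<zero>\<^bsub>E\<^esub>" using u by (simp add: dif[symmetric] C.dif_dif h(2))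
    fix y assume "y \<in> carrier E"
    then obtain v where v: "v \<in> carrier C" "y = h v" by (auto simp: car)
    show "dif E (x \<oplus>\<^bsub>E\<^esub> y) = dif E x \<oplus>\<^bsub>E\<^esub> dif E y"
      using u v by (simp add: dif[symmetric] add[symmetric] C.dif_add)
  next
    fix n x assume "x \<in> grd E n"
    then show "dif E x \<in> grd E (n + 1)"
      using C.dif_grd C.grd_carrier by (auto simp: grd dif[symmetric])
  qed
  moreover have "h (x \<otimes>\<^bsub>C\<^esub> y) = h x \<otimes>\<^bsub>E\<^esub> h y" "dif E (h x) = h (dif C x)"
    if "x \<in> grd C i" "y \<in> grd C j" for i j x y
    using that[THEN C.grd_carrier] mult dif by auto
  moreover have "h \<one>\<^bsub>C\<^esub> = \<one>\<^bsub>E\<^esub>" using h(1) by (auto simp: ring_iso_def ring_hom_def)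
  ultimately show ?thesis
    unfolding dg_ring_def
  proof (intro conjI allI ballI impI E.ring_axioms)
    show "grd E n = {\<zero>\<^bsub>E\<^esub>}" if "n > 0" for n using that by (simp add: grd C.grd_pos h(2))
    show "\<one>\<^bsub>E\<^esub> \<in> grd E 0" using C.grd_one \<open>h \<one>\<^bsub>C\<^esub> = \<one>\<^bsub>E\<^esub>\<close> by (force simp: grd)
    show "x \<otimes>\<^bsub>E\<^esub> x = \<zero>\<^bsub>E\<^esub>" if "odd i" "x \<in> grd E i" for i x
      using that C.odd_square[OF that(1)] mult C.grd_carrier by (auto simp: grd mult[symmetric] h(2))
    fix i j x y assume "x \<in> grd E i" "y \<in> grd E j"
    then obtain u v where u: "u \<in> grd C i" "x = h u" and v: "v \<in> grd C j" "y = h v"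
      by (auto simp: grd)
    note uv = u(1)[THEN C.grd_carrier] v(1)[THEN C.grd_carrier]
    show "x \<otimes>\<^bsub>E\<^esub> y \<in> grd E (i + j)"
      using u v uv C.grd_mult[OF u(1) v(1)] by (simp add: grd mult[symmetric])
    show "dif E (x \<otimes>\<^bsub>E\<^esub> y) = dif E x \<otimes>\<^bsub>E\<^esub> y \<oplus>\<^bsub>E\<^esub> sgnpow E i (x \<otimes>\<^bsub>E\<^esub> dif E y)"
      using u v uv C.dif_mult[OF u(1) v(1)]
      by (simp add: mult[symmetric] dif[symmetric] add[symmetric] sgn[symmetric])
    show "y \<otimes>\<^bsub>E\<^esub> x = sgnpow E (i * j) (x \<otimes>\<^bsub>E\<^esub> y)"
      using u v uv C.graded_comm[OF u(1) v(1)] by (simp add: mult[symmetric] sgn[symmetric])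
  qed
qed

section \<open>The Koszul DG-ring\<close>

lemma dg_self_sel [simp]:
  "carrier (dg_self A) = carrier A" "\<zero>\<^bsub>dg_self A\<^esub> = \<zero>\<^bsub>A\<^esub>" "x \<oplus>\<^bsub>dg_self A\<^esub> y = x \<oplus>\<^bsub>A\<^esub> y"
  "grd (dg_self A) = grd A" "dif (dg_self A) = dif A" "act (dg_self A) = mult A"
  by (simp_all add: dg_self_def)

lemma sgnpow_dg_self [simp]: "sgnpow (dg_self A) = sgnpow A"
  by (intro ext) (simp add: sgnpow_def a_inv_def m_inv_def dg_self_def)

lemma finsum_dg_self [simp]: "finsum (dg_self A) = finsum A"
  by (intro ext) (simp add: finsum_def finprod_def dg_self_def)

lemma koszul_sel [simp]:
  "carrier (koszul A as) = Pow {..<length as} \<rightarrow>\<^sub>E carrier A"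
  "\<zero>\<^bsub>koszul A as\<^esub> = (\<lambda>S\<in>Pow {..<length as}. \<zero>\<^bsub>A\<^esub>)"
  "x \<oplus>\<^bsub>koszul A as\<^esub> y = (\<lambda>S\<in>Pow {..<length as}. x S \<oplus>\<^bsub>A\<^esub> y S)"
  "grd (koszul A as) k = Pi\<^sub>E (Pow {..<length as}) (\<lambda>S. grd A (k + int (card S)))"
  "\<one>\<^bsub>koszul A as\<^esub> = koszul_incl A as \<one>\<^bsub>A\<^esub>"
  by (simp_all add: koszul_def koszul_incl_def Let_def)

lemma koszul_dif:
  "S \<subseteq> {..<length as} \<Longrightarrow> dif (koszul A as) x S =
     sgnpow A (int (card S)) (dif A (x S)) \<oplus>\<^bsub>A\<^esub>
     (\<Oplus>\<^bsub>A\<^esub>i\<in>{..<length as} - S.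
        sgnpow A (int (card {j \<in> S. j < i})) (as ! i \<otimes>\<^bsub>A\<^esub> x (insert i S)))"
  using koszul_mod_dif[of S as A "dg_self A" x] by (simp add: koszul_def Let_def)

text \<open>For disjoint T and U, the number of transpositions needed to sort e_T e_U into
  increasing order, and hence the exponent of its sign.\<close>

definition inversions :: "nat set \<Rightarrow> nat set \<Rightarrow> nat" where
  "inversions T U = card {(t, u). t \<in> T \<and> u \<in> U \<and> u < t}"

lemma koszul_mult:
  "S \<subseteq> {..<length as} \<Longrightarrow> (x \<otimes>\<^bsub>koszul A as\<^esub> y) S =
     (\<Oplus>\<^bsub>A\<^esub>T\<in>Pow S. sgnpow A (int (inversions T (S - T)))
        (degsgn A (card (S - T)) (x T) \<otimes>\<^bsub>A\<^esub> y (S - T)))"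
  by (simp add: koszul_def Let_def inversions_def)

lemma koszul_extensional:
  "dif (koszul A as) x \<in> extensional (Pow {..<length as})"
  "x \<otimes>\<^bsub>koszul A as\<^esub> y \<in> extensional (Pow {..<length as})"
  by (simp_all add: koszul_def koszul_mod_def Let_def)

lemma inversions_empty: "inversions {} U = 0"
  by (simp add: inversions_def)

lemma inversions_Suc: "inversions (Suc ` T) (Suc ` U) = inversions T U"
proof -
  have "{(t, u). t \<in> Suc ` T \<and> u \<in> Suc ` U \<and> u < t} = map_prod Suc Suc ` {(t, u). t \<in> T \<and> u \<in> U \<and> u < t}"
    by (auto simp: image_iff)
  then show ?thesis unfolding inversions_def
    by (simp add: card_image inj_on_subset[OF prod.inj_map[OF inj_Suc inj_Suc]])
qed

text \<open>The index 0 exceeds no other index, so in the left factor it takes part in no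
  inversion.\<close>

lemma inversions_insert0: "inversions (insert 0 T) U = inversions T U"
  unfolding inversions_def by (rule arg_cong[of _ _ card]) auto

text \<open>Every shifted index on the left lies above 0, which adds \<open>card T\<close>
  inversions: the variable of index 0 has to pass all factors of e_T.\<close>

lemma inversions_insert0_right:
  assumes "finite T" "finite U"
  shows "inversions (Suc ` T) (insert 0 (Suc ` U)) = card T + inversions T U"
proof -
  have "{(t, u). t \<in> Suc ` T \<and> u \<in> insert 0 (Suc ` U) \<and> u < t} =
      (\<lambda>t. (Suc t, 0)) ` T \<union> {(t, u). t \<in> Suc ` T \<and> u \<in> Suc ` U \<and> u < t}"
    by auto
  moreover have "finite {(t, u). t \<in> Suc ` T \<and> u \<in> Suc ` U \<and> u < t}"
    by (rule finite_subset[of _ "Suc ` T \<times> Suc ` U"]) (use assms in auto)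
  moreover have "(\<lambda>t. (Suc t, 0::nat)) ` T \<inter> {(t, u). t \<in> Suc ` T \<and> u \<in> Suc ` U \<and> u < t} = {}"
    by auto
  ultimately have "inversions (Suc ` T) (insert 0 (Suc ` U)) = card ((\<lambda>t. (Suc t, 0::nat)) ` T) + inversions (Suc ` T) (Suc ` U)"
    using assms(1) unfolding inversions_def by (simp add: card_Un_disjoint)
  then show ?thesis by (simp add: inversions_Suc card_image inj_on_def)
qed

text \<open>Prepending an element to the list makes it index 0 and shifts the old indices by
  \<open>Suc\<close>. The two cases are the basis elements without and with the new
  variable.\<close>

lemma Pow_Suc_cases:
  assumes "S \<subseteq> {..<Suc n}"
  obtains T where "T \<subseteq> {..<n}" "S = Suc ` T" | T where "T \<subseteq> {..<n}" "S = insert 0 (Suc ` T)"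
proof -
  define T where "T = {k. Suc k \<in> S}"
  have T: "T \<subseteq> {..<n}" using assms by (auto simp: T_def)
  have "x \<in> S \<longleftrightarrow> x \<in> (if 0 \<in> S then insert 0 (Suc ` T) else Suc ` T)" for x
    by (cases x) (auto simp: T_def)
  then have "S = (if 0 \<in> S then insert 0 (Suc ` T) else Suc ` T)"
    by blast
  then show ?thesis using T that by metis
qed

lemma Suc_image_subset: "T \<subseteq> {..<n} \<Longrightarrow> Suc ` T \<subseteq> {..<Suc n}" "T \<subseteq> {..<n} \<Longrightarrow> insert 0 (Suc ` T) \<subseteq> {..<Suc n}"
  by auto

lemma card_Suc_image: "card (Suc ` T) = card T" "finite T \<Longrightarrow> card (insert 0 (Suc ` T)) = Suc (card T)"
  by (auto simp: card_image)

lemma finite_nat_subset: "T \<subseteq> {..<n::nat} \<Longrightarrow> finite T"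
  using finite_subset by blast

context comm_dg_ring
begin

lemma koszul_incl_grd: "b \<in> grd A n \<Longrightarrow> koszul_incl A as b \<in> grd (koszul A as) n"
  using grd_zero by (auto simp: koszul_incl_def)

lemma koszul_incl_closed: "b \<in> carrier A \<Longrightarrow> koszul_incl A as b \<in> carrier (koszul A as)"
  by (auto simp: koszul_incl_def)

text \<open>Only the summand with T = {} survives, and moving \<open>b\<close> past e_S gives the
  sign operator.\<close>

lemma koszul_incl_mult:
  assumes b: "b \<in> carrier A" and y: "y \<in> carrier (koszul A as)" and S: "S \<subseteq> {..<length as}"
  shows "(koszul_incl A as b \<otimes>\<^bsub>koszul A as\<^esub> y) S = degsgn A (card S) b \<otimes> y S"
proof -
  have yc: "y T \<in> carrier A" if "T \<subseteq> {..<length as}" for T using y that by auto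
  have fin: "finite S" using finite_nat_subset[OF S] .
  let ?f = "\<lambda>T. sgnpow A (int (inversions T (S - T))) (degsgn A (card (S - T)) (koszul_incl A as b T) \<otimes> y (S - T))"
  have f: "?f T = \<zero>" if "T \<in> Pow S - {{}}" for T
  proof -
    have "T \<noteq> {}" "T \<subseteq> {..<length as}" "y (S - T) \<in> carrier A" using that S by (auto intro!: yc)
    then show ?thesis by (simp add: koszul_incl_def sgnpow_def)
  qed
  have f0: "?f {} = degsgn A (card S) b \<otimes> y S"
    by (simp add: inversions_empty sgnpow_even koszul_incl_def)
  have "(koszul_incl A as b \<otimes>\<^bsub>koszul A as\<^esub> y) S = (\<Oplus>T\<in>Pow S. ?f T)"
    by (rule koszul_mult[OF S])
  also have "\<dots> = (\<Oplus>T\<in>{{}}. ?f T)"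
  proof (rule add.finprod_mono_neutral_cong_right)
    show "?f \<in> Pow S \<rightarrow> carrier A"
    proof
      fix T assume "T \<in> Pow S"
      then have "y (S - T) \<in> carrier A" "koszul_incl A as b T \<in> carrier A"
        using S b by (auto simp: koszul_incl_def intro!: yc)
      then show "?f T \<in> carrier A" by simp
    qed
  qed (use f fin in auto)
  finally show ?thesis using f0 b yc[OF S] by simp
qed

lemma koszul_dif_closed:
  assumes as: "set as \<subseteq> carrier A" and x: "x \<in> carrier (koszul A as)"
  shows "dif (koszul A as) x \<in> carrier (koszul A as)"
proof -
  have xc: "x T \<in> carrier A" if "T \<subseteq> {..<length as}" for T using x that by auto
  have "dif (koszul A as) x S \<in> carrier A" if S: "S \<subseteq> {..<length as}" for S
  proof -
    have "as ! i \<in> carrier A" "x (insert i S) \<in> carrier A" if "i \<in> {..<length as} - S" for i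
      using that S as by (auto intro!: xc)
    then show ?thesis
      using xc[OF S] by (subst koszul_dif[OF S]) (auto intro!: a_closed finsum_closed)
  qed
  then show ?thesis using koszul_extensional(1)[of A as x] by (auto simp: PiE_iff)
qed

lemma koszul_mult_closed:
  assumes x: "x \<in> carrier (koszul A as)" and y: "y \<in> carrier (koszul A as)"
  shows "x \<otimes>\<^bsub>koszul A as\<^esub> y \<in> carrier (koszul A as)"
proof -
  have xc: "x T \<in> carrier A" "y T \<in> carrier A" if "T \<subseteq> {..<length as}" for T using x y that by auto
  have "(x \<otimes>\<^bsub>koszul A as\<^esub> y) S \<in> carrier A" if S: "S \<subseteq> {..<length as}" for S
    unfolding koszul_mult[OF S] using S by (auto intro!: finsum_closed sgn_closed m_closed degsgn_closed xc)
  then show ?thesis using koszul_extensional(2)[of A as x y] by (auto simp: PiE_iff)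
qed

text \<open>With {} as the only index, all signs are trivial and the sums over T have a single
  summand, so \<open>koszul_incl\<close> is an isomorphism along which the structure of
  \<open>A\<close> is transported.\<close>

lemma koszul_Nil: "dg_ring (koszul A [])"
proof (rule dg_ring_transport[OF dg_ring])
  let ?h = "koszul_incl A []"
  have h: "?h x = (\<lambda>S\<in>{{}}. x)" for x by (auto simp: koszul_incl_def)
  have eq: "z = ?h (z {})" if "z \<in> extensional {{}}" for z
    using that by (intro extensionalityI[of _ "{{}}"]) (auto simp: h)
  have ev: "?h x {} = x" for x by (simp add: h)
  have im: "?h ` X = {{} :: nat set} \<rightarrow>\<^sub>E X" for X
  proof
    show "{{} :: nat set} \<rightarrow>\<^sub>E X \<subseteq> ?h ` X"
    proof
      fix z assume "z \<in> {{} :: nat set} \<rightarrow>\<^sub>E X"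
      then have "z {} \<in> X" "z = ?h (z {})" using eq by (auto simp: PiE_iff)
      then show "z \<in> ?h ` X" by blast
    qed
  qed (auto simp: h split: if_splits)
  have mult: "?h (x \<otimes> y) = ?h x \<otimes>\<^bsub>koszul A []\<^esub> ?h y" if "x \<in> carrier A" "y \<in> carrier A" for x y
  proof (rule extensionalityI[of _ "{{}}"])
    show "?h x \<otimes>\<^bsub>koszul A []\<^esub> ?h y \<in> extensional {{}}"
      using koszul_extensional(2)[of A "[]" "?h x" "?h y"] by simp
    show "?h (x \<otimes> y) S = (?h x \<otimes>\<^bsub>koszul A []\<^esub> ?h y) S" if "S \<in> {{}}" for S
    proof -
      have "(?h x \<otimes>\<^bsub>koszul A []\<^esub> ?h y) {} = degsgn A (card {}) x \<otimes> ?h y {}"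
        using koszul_incl_mult[OF \<open>x \<in> carrier A\<close> koszul_incl_closed[OF \<open>y \<in> carrier A\<close>], of "{}" "[]"] by simp
      also have "degsgn A (card {}) x = x"
        using \<open>x \<in> carrier A\<close>
        by (induction x rule: homogeneous_induct) (auto simp: degsgn_homogeneous sgnpow_even degsgn_add)
      finally show ?thesis using that by (simp add: ev)
    qed
  qed (simp add: h)
  have bij: "bij_betw ?h (carrier A) (carrier (koszul A []))"
    unfolding bij_betw_def
  proof
    show "inj_on ?h (carrier A)" by (rule inj_onI) (metis ev)
    show "?h ` carrier A = carrier (koszul A [])"
      by (simp add: im)
  qed
  then show "?h \<in> ring_iso A (koszul A [])"
    using mult unfolding ring_iso_def ring_hom_def bij_betw_def by (auto simp: h)
  show "?h \<zero> = \<zero>\<^bsub>koszul A []\<^esub>" by (auto simp: h)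
  show "?h (dif A x) = dif (koszul A []) (?h x)" if "x \<in> carrier A" for x
  proof (rule extensionalityI[of _ "{{}}"])
    show "dif (koszul A []) (?h x) \<in> extensional {{}}"
      using koszul_extensional(1)[of A "[]" "?h x"] by simp
    show "?h (dif A x) S = dif (koszul A []) (?h x) S" if "S \<in> {{}}" for S
      using that \<open>x \<in> carrier A\<close> by (simp add: koszul_dif ev sgnpow_even)
  qed (simp add: h)
  show "grd (koszul A []) n = ?h ` grd A n" for n
  proof -
    have "grd (koszul A []) n = (\<Pi>\<^sub>E S\<in>{{}}. grd A (n + int (card S)))" by simp
    also have "\<dots> = {{}} \<rightarrow>\<^sub>E grd A n" by (rule PiE_cong) simp
    finally show ?thesis by (simp only: im)
  qed
qed

end

section \<open>The Koszul DG-ring as an iterated exterior extension\<close>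

definition koszul_base :: "nat \<Rightarrow> (nat set \<Rightarrow> 'a) \<Rightarrow> nat set \<Rightarrow> 'a" where
  "koszul_base n y = (\<lambda>T\<in>Pow {..<n}. y (Suc ` T))"

text \<open>Together with \<open>koszul_base\<close> this supplies the coordinates \<open>q\<close>
  and \<open>p\<close> of \<open>exterior_ext\<close>. The new variable has the smallest index, so
  e_0 stands in front of every basis element containing it, and no sign enters the
  coordinates.\<close>

definition koszul_coeff :: "nat \<Rightarrow> (nat set \<Rightarrow> 'a) \<Rightarrow> nat set \<Rightarrow> 'a" where
  "koszul_coeff n y = (\<lambda>T\<in>Pow {..<n}. y (insert 0 (Suc ` T)))"

lemma Pi_imageI: "(\<And>i. i \<in> I \<Longrightarrow> f (h i) = g i) \<Longrightarrow> (\<And>i. i \<in> I \<Longrightarrow> g i \<in> B) \<Longrightarrow> f \<in> h ` I \<rightarrow> B"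
  by auto

lemma (in abelian_monoid) finsum_reindex_cong:
  assumes "inj_on h I" "\<And>i. i \<in> I \<Longrightarrow> f (h i) = g i" "g \<in> I \<rightarrow> carrier G"
  shows "finsum G f (h ` I) = finsum G g I"
proof -
  have "f \<in> h ` I \<rightarrow> carrier G" using assms by (auto simp: Pi_iff)
  then have "finsum G f (h ` I) = (\<Oplus>i\<in>I. f (h i))" using assms(1) by (rule add.finprod_reindex)
  also have "\<dots> = finsum G g I" using assms by (intro finsum_cong') auto
  finally show ?thesis .
qed

text \<open>Here the sign formulas meet the abstract description. In the differential, index 0
  contributes a (q x), while for basis elements containing e_0 all other indices gain one sign,
  which is the minus in \<open>q_dif\<close>. In the product, e_0 lies in the left factor without a
  sign or in the right factor, where it has to pass the left one.\<close>

lemma (in comm_dg_ring) koszul_Cons: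
  assumes K: "dg_ring (koszul A as)" and as: "set as \<subseteq> grd A 0" and a: "a \<in> grd A 0"
  shows "exterior_ext (koszul A as) (koszul A (a # as)) (koszul_incl A as a)
           (koszul_base (length as)) (koszul_coeff (length as))"
proof -
  interpret K: comm_dg_ring "koszul A as" using K by (simp add: comm_dg_ring_iff)
  define n where "n = length as"
  define C where "C = koszul A as"
  define E where "E = koszul A (a # as)"
  let ?p = "koszul_base n" and ?q = "koszul_coeff n"
  have Cc: "carrier C = Pow {..<n} \<rightarrow>\<^sub>E carrier A" and Ec: "carrier E = Pow {..<Suc n} \<rightarrow>\<^sub>E carrier A"
    by (simp_all add: C_def E_def n_def)
  have ac [simp]: "a \<in> carrier A" using grd_carrier[OF a] .
  have asc: "as ! i \<in> carrier A" if "i < n" for i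
    using as that nth_mem[of i as] unfolding n_def by (meson grd_carrier subsetD)
  have asE: "set (a # as) \<subseteq> carrier A" using as a grd_carrier by auto
  have xE: "x (Suc ` T) \<in> carrier A" "x (insert 0 (Suc ` T)) \<in> carrier A"
    if "x \<in> carrier E" "T \<subseteq> {..<n}" for x T
  proof -
    have "x S \<in> carrier A" if "S \<subseteq> {..<Suc n}" for S
      using PiE_mem[OF \<open>x \<in> carrier E\<close>[unfolded Ec], of S] that by simp
    then show "x (Suc ` T) \<in> carrier A" "x (insert 0 (Suc ` T)) \<in> carrier A"
      using Suc_image_subset[OF that(2)] by blast+
  qed
  have pc: "?p x \<in> carrier C" and qc: "?q x \<in> carrier C" if "x \<in> carrier E" for x
    using xE[OF that] by (auto simp: koszul_base_def koszul_coeff_def Cc)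
  have pT: "?p x T = x (Suc ` T)" and qT: "?q x T = x (insert 0 (Suc ` T))" if "T \<subseteq> {..<n}" for x T
    using that by (auto simp: koszul_base_def koszul_coeff_def)
  have pqext: "?p x \<in> extensional (Pow {..<n})" "?q x \<in> extensional (Pow {..<n})" for x
    by (auto simp: koszul_base_def koszul_coeff_def)
  have Cext: "u \<in> carrier C \<Longrightarrow> u \<in> extensional (Pow {..<n})" for u by (auto simp: Cc PiE_iff)
  have CextI: "u = v" if "u \<in> extensional (Pow {..<n})" "v \<in> extensional (Pow {..<n})"
    "\<And>T. T \<subseteq> {..<n} \<Longrightarrow> u T = v T" for u v :: "nat set \<Rightarrow> 'a"
    using that by (auto intro: extensionalityI[of _ "Pow {..<n}"])
  have Cadd: "(u \<oplus>\<^bsub>C\<^esub> v) T = u T \<oplus> v T" if "T \<subseteq> {..<n}" for u v T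
    using that by (simp add: C_def n_def[symmetric])
  \<comment> \<open>At T, an element of degree k has a coefficient of degree k +
    \<open>card T\<close>. The sign operators of \<open>koszul A as\<close> and of \<open>A\<close>
    therefore differ by (-1)^(card T).\<close>
  have degK: "degsgn C 1 x T = sgnpow A (int (card T)) (degsgn A 1 (x T))"
    if x: "x \<in> carrier C" and T: "T \<subseteq> {..<n}" for x T
    using x[unfolded C_def]
  proof (induction x rule: K.homogeneous_induct)
    case zero
    have 0: "\<zero>\<^bsub>koszul A as\<^esub> T = \<zero>" using T by (simp add: n_def)
    have "degsgn C 1 \<zero>\<^bsub>koszul A as\<^esub> = \<zero>\<^bsub>koszul A as\<^esub>"
      unfolding C_def by (rule K.degsgn_zero)
    moreover have "sgnpow A (int (card T)) (degsgn A 1 \<zero>) = \<zero>" by (simp add: sgnpow_def)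
    ultimately show ?case by (simp only: 0)
  next
    case (homogeneous k x)
    have "degsgn C 1 x T = sgnpow C (int 1 * k) x T"
      unfolding C_def K.degsgn_homogeneous[OF homogeneous] ..
    also have "\<dots> = sgnpow A k (x T)"
      unfolding C_def
      by (subst sgnpow_hom[OF K.is_abelian_group is_abelian_group, where f = "\<lambda>x. x T"])
         (use T K.grd_carrier[OF homogeneous] in \<open>auto simp: n_def\<close>)
    also have xT: "x T \<in> grd A (k + int (card T))" using homogeneous T by (auto simp: n_def)
    then have "sgnpow A k (x T) = sgnpow A (int (card T)) (degsgn A 1 (x T))"
      by (simp add: degsgn_homogeneous grd_carrier sgnpow_sgnpow[OF is_abelian_group]) (simp add: sgnpow_def)
    finally show ?case .
  next
    case (add x y)
    have 1: "degsgn C 1 (x \<oplus>\<^bsub>koszul A as\<^esub> y) T = degsgn C 1 x T \<oplus> degsgn C 1 y T"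
      using K.degsgn_add[OF add(1,2), of 1] Cadd[OF T] by (simp only: C_def)
    have 2: "(x \<oplus>\<^bsub>koszul A as\<^esub> y) T = x T \<oplus> y T" using Cadd[OF T] by (simp only: C_def)
    have "x T \<in> carrier A" "y T \<in> carrier A" using add T by (auto simp: n_def)
    then show ?case
      unfolding 1 2 add(3,4) by (simp add: degsgn_add sgnpow_add[OF is_abelian_group])
  qed
  have aC: "koszul_incl A as a \<in> grd C 0" unfolding C_def by (rule koszul_incl_grd[OF a])
  have multa: "(koszul_incl A as a \<otimes>\<^bsub>C\<^esub> y) T = a \<otimes> y T" if "y \<in> carrier C" "T \<subseteq> {..<n}" for y T
    using that koszul_incl_mult[OF ac, of y as T] unfolding C_def n_def
    by (simp only: degsgn_deg0[OF dg_group a])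
  have surj: "\<exists>x\<in>carrier E. ?p x = u \<and> ?q x = v" if u: "u \<in> carrier C" and v: "v \<in> carrier C" for u v
  proof -
    define x where "x = (\<lambda>S\<in>Pow {..<Suc n}. if 0 \<in> S then v {k. Suc k \<in> S} else u {k. Suc k \<in> S})"
    have "x \<in> carrier E"
      unfolding Ec x_def
    proof (rule restrict_PiE_iff[THEN iffD2], rule ballI)
      fix S assume "S \<in> Pow {..<Suc n}"
      then have "{k. Suc k \<in> S} \<in> Pow {..<n}" by auto
      then show "(if 0 \<in> S then v {k. Suc k \<in> S} else u {k. Suc k \<in> S}) \<in> carrier A"
        using PiE_mem[OF u[unfolded Cc]] PiE_mem[OF v[unfolded Cc]] by simp
    qed
    moreover have SucT: "{k. Suc k \<in> Suc ` T} = T" for T by auto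
    have "?p x = u"
      by (rule CextI[OF pqext(1) Cext[OF u]]) (auto simp: pT x_def SucT)
    moreover have "?q x = v"
      by (rule CextI[OF pqext(2) Cext[OF v]]) (auto simp: qT x_def SucT)
    ultimately show ?thesis by blast
  qed
  have eqI: "x = y" if x: "x \<in> carrier E" and y: "y \<in> carrier E" and p: "?p x = ?p y" and q: "?q x = ?q y" for x y
  proof (rule extensionalityI[of _ "Pow {..<Suc n}"])
    show "x \<in> extensional (Pow {..<Suc n})" "y \<in> extensional (Pow {..<Suc n})"
      using x y by (auto simp: Ec PiE_iff)
    fix S assume "S \<in> Pow {..<Suc n}"
    then have "S \<subseteq> {..<Suc n}" by simp
    then show "x S = y S"
      by (cases rule: Pow_Suc_cases) (metis p pT, metis q qT)
  qed
  have fin: "finite T" if "T \<subseteq> {..<n}" for T using finite_nat_subset[OF that] .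
  have rest: "{..<Suc n} - Suc ` T = insert 0 (Suc ` ({..<n} - T))"
    "{..<Suc n} - insert 0 (Suc ` T) = Suc ` ({..<n} - T)" if "T \<subseteq> {..<n}" for T
    by (auto simp: lessThan_Suc_eq_insert_0)
  have difp: "?p (dif E x) T = (dif C (?p x) \<oplus>\<^bsub>C\<^esub> koszul_incl A as a \<otimes>\<^bsub>C\<^esub> ?q x) T"
    if x: "x \<in> carrier E" and T: "T \<subseteq> {..<n}" for x T
  proof -
    let ?f = "\<lambda>i. sgnpow A (int (card {j \<in> Suc ` T. j < i})) ((a # as) ! i \<otimes> x (insert i (Suc ` T)))"
    let ?g = "\<lambda>i. sgnpow A (int (card {j \<in> T. j < i})) (as ! i \<otimes> x (Suc ` insert i T))"
    have gc: "?g i \<in> carrier A" if "i \<in> {..<n} - T" for i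
    proof -
      have "x (Suc ` insert i T) \<in> carrier A" using xE(1)[OF x, of "insert i T"] that T by blast
      then show ?thesis using asc[of i] that by simp
    qed
    have fg: "?f (Suc i) = ?g i" for i
    proof -
      have "{j \<in> Suc ` T. j < Suc i} = Suc ` {j \<in> T. j < i}" by auto
      then show ?thesis by (simp add: card_image)
    qed
    \<comment> \<open>No index lies below 0, so the summand of the new variable carries no
      sign.\<close>
    have f0: "?f 0 = a \<otimes> x (insert 0 (Suc ` T))" by (simp add: sgnpow_even)
    have "?p (dif E x) T = sgnpow A (int (card T)) (dif A (x (Suc ` T))) \<oplus> (\<Oplus>i\<in>{..<Suc n} - Suc ` T. ?f i)"
      unfolding pT[OF T] E_def
      using koszul_dif[of "Suc ` T" "a # as" A x] Suc_image_subset(1)[OF T] by (simp add: card_image n_def)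
    also have "(\<Oplus>i\<in>{..<Suc n} - Suc ` T. ?f i) = ?f 0 \<oplus> (\<Oplus>i\<in>Suc ` ({..<n} - T). ?f i)"
      unfolding rest(1)[OF T]
    proof (rule finsum_insert)
      show "?f \<in> Suc ` ({..<n} - T) \<rightarrow> carrier A" by (rule Pi_imageI) (rule fg, erule gc)
      show "?f 0 \<in> carrier A" unfolding f0 using xE(2)[OF x T] by simp
    qed auto
    also have "(\<Oplus>i\<in>Suc ` ({..<n} - T). ?f i) = (\<Oplus>i\<in>{..<n} - T. ?g i)"
      by (rule finsum_reindex_cong) (use gc fg in \<open>simp_all only: inj_Suc Pi_I\<close>)
    finally have lhs: "?p (dif E x) T = sgnpow A (int (card T)) (dif A (x (Suc ` T))) \<oplus>
        (a \<otimes> x (insert 0 (Suc ` T)) \<oplus> (\<Oplus>i\<in>{..<n} - T. ?g i))" by (simp only: f0)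
    have "dif C (?p x) T = sgnpow A (int (card T)) (dif A (x (Suc ` T))) \<oplus> (\<Oplus>i\<in>{..<n} - T. ?g i)"
    proof -
      have "(\<Oplus>i\<in>{..<n} - T. sgnpow A (int (card {j \<in> T. j < i})) (as ! i \<otimes> ?p x (insert i T))) = (\<Oplus>i\<in>{..<n} - T. ?g i)"
        using gc T by (intro add.finprod_cong') (auto simp: pT)
      then show ?thesis
        unfolding C_def using koszul_dif[of T as A "?p x"] T by (simp add: n_def[symmetric] pT)
    qed
    moreover have "(koszul_incl A as a \<otimes>\<^bsub>C\<^esub> ?q x) T = a \<otimes> x (insert 0 (Suc ` T))"
      using multa[OF qc[OF x] T] by (simp add: qT[OF T])
    moreover have "(\<Oplus>i\<in>{..<n} - T. ?g i) \<in> carrier A" using gc by (intro finsum_closed) blast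
    ultimately show ?thesis
      using T xE[OF x T] unfolding lhs by (simp add: C_def n_def[symmetric] a_ac)
  qed
  have difq: "?q (dif E x) T = (\<ominus>\<^bsub>C\<^esub> dif C (?q x)) T"
    if x: "x \<in> carrier E" and T: "T \<subseteq> {..<n}" for x T
  proof -
    let ?f = "\<lambda>i. sgnpow A (int (card {j \<in> insert 0 (Suc ` T). j < i})) ((a # as) ! i \<otimes> x (insert i (insert 0 (Suc ` T))))"
    let ?g = "\<lambda>i. sgnpow A (int (card {j \<in> T. j < i})) (as ! i \<otimes> x (insert 0 (Suc ` insert i T)))"
    have gc: "?g i \<in> carrier A" if "i \<in> {..<n} - T" for i
    proof -
      have "x (insert 0 (Suc ` insert i T)) \<in> carrier A" using xE(2)[OF x, of "insert i T"] that T by blast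
      then show ?thesis using asc[of i] that by simp
    qed
    \<comment> \<open>The index 0, now in the set, lies below every \<open>Suc i\<close> and
      contributes one additional sign.\<close>
    have fg: "?f (Suc i) = sgnpow A 1 (?g i)" if "i \<in> {..<n} - T" for i
    proof -
      have "{j \<in> insert 0 (Suc ` T). j < Suc i} = insert 0 (Suc ` {j \<in> T. j < i})" by auto
      then have "card {j \<in> insert 0 (Suc ` T). j < Suc i} = Suc (card {j \<in> T. j < i})"
        using fin[OF T] by (simp add: card_image)
      moreover have "insert (Suc i) (insert 0 (Suc ` T)) = insert 0 (Suc ` insert i T)" by auto
      moreover have "x (insert 0 (Suc ` insert i T)) \<in> carrier A" using xE(2)[OF x, of "insert i T"] that T by blast
      ultimately show ?thesis
        using that asc by (simp add: sgnpow_sgnpow[OF is_abelian_group])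
    qed
    have xc: "x (insert 0 (Suc ` T)) \<in> carrier A" using xE(2)[OF x T] .
    have "?q (dif E x) T = sgnpow A (1 + int (card T)) (dif A (x (insert 0 (Suc ` T)))) \<oplus> (\<Oplus>i\<in>Suc ` ({..<n} - T). ?f i)"
      unfolding qT[OF T] E_def
      using koszul_dif[of "insert 0 (Suc ` T)" "a # as" A x] Suc_image_subset(2)[OF T] fin[OF T]
      by (simp add: card_image n_def[symmetric] rest(2)[OF T])
    also have "(\<Oplus>i\<in>Suc ` ({..<n} - T). ?f i) = (\<Oplus>i\<in>{..<n} - T. sgnpow A 1 (?g i))"
      by (rule finsum_reindex_cong) (use gc fg in \<open>simp_all only: inj_Suc Pi_I sgn_closed\<close>)
    also have "\<dots> = sgnpow A 1 (\<Oplus>i\<in>{..<n} - T. ?g i)"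
      using gc by (intro sgnpow_finsum[OF is_abelian_group, symmetric]) auto
    finally have lhs: "?q (dif E x) T = sgnpow A 1 (sgnpow A (int (card T)) (dif A (x (insert 0 (Suc ` T)))) \<oplus> (\<Oplus>i\<in>{..<n} - T. ?g i))"
    proof -
      assume *: "?q (dif E x) T = sgnpow A (1 + int (card T)) (dif A (x (insert 0 (Suc ` T)))) \<oplus> sgnpow A 1 (\<Oplus>i\<in>{..<n} - T. ?g i)"
      have "(\<Oplus>i\<in>{..<n} - T. ?g i) \<in> carrier A" using gc by (intro finsum_closed) blast
      then show ?thesis
        unfolding * using xc by (simp add: sgnpow_add[OF is_abelian_group] sgnpow_sgnpow[OF is_abelian_group])
    qed
    have dC: "dif C (?q x) T = sgnpow A (int (card T)) (dif A (x (insert 0 (Suc ` T)))) \<oplus> (\<Oplus>i\<in>{..<n} - T. ?g i)"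
    proof -
      have "(\<Oplus>i\<in>{..<n} - T. sgnpow A (int (card {j \<in> T. j < i})) (as ! i \<otimes> ?q x (insert i T))) = (\<Oplus>i\<in>{..<n} - T. ?g i)"
        using gc T by (intro add.finprod_cong') (auto simp: qT)
      then show ?thesis
        unfolding C_def using koszul_dif[of T as A "?q x"] T by (simp add: n_def[symmetric] qT)
    qed
    have "dif C (?q x) \<in> carrier C" unfolding C_def using qc[OF x] K.dif_closed by (simp add: C_def)
    then have "sgnpow C 1 (dif C (?q x)) T = sgnpow A 1 (dif C (?q x) T)"
      unfolding C_def
      by (subst sgnpow_hom[OF K.is_abelian_group is_abelian_group, where f = "\<lambda>x. x T"])
         (use T in \<open>auto simp: n_def\<close>)
    then show ?thesis unfolding lhs dC by (simp add: sgnpow_def)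
  qed
  have Cmul: "(u \<otimes>\<^bsub>C\<^esub> v) T = (\<Oplus>V\<in>Pow T. sgnpow A (int (inversions V (T - V))) (degsgn A (card (T - V)) (u V) \<otimes> v (T - V)))"
    if "T \<subseteq> {..<n}" for u v T
    using koszul_mult[of T as] that by (simp add: C_def n_def)
  have Emul: "(x \<otimes>\<^bsub>E\<^esub> y) S = (\<Oplus>V\<in>Pow S. sgnpow A (int (inversions V (S - V))) (degsgn A (card (S - V)) (x V) \<otimes> y (S - V)))"
    if "S \<subseteq> {..<Suc n}" for x y S
    using koszul_mult[of S "a # as"] that by (simp add: E_def n_def)
  have PowS: "Pow (Suc ` T) = (`) Suc ` Pow T" for T by (simp add: image_Pow_surj)
  have injS: "inj_on ((`) Suc) X" "inj_on (\<lambda>V. insert 0 (Suc ` V)) X" for X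
    by (auto simp: inj_on_def inj_image_eq_iff dest: insert_ident[THEN iffD1, rotated 2])
  have diffS: "Suc ` T - Suc ` V = Suc ` (T - V)" for T V by auto
  have mulp: "?p (x \<otimes>\<^bsub>E\<^esub> y) T = (?p x \<otimes>\<^bsub>C\<^esub> ?p y) T"
    if x: "x \<in> carrier E" and y: "y \<in> carrier E" and T: "T \<subseteq> {..<n}" for x y T
  proof -
    let ?f = "\<lambda>S V. sgnpow A (int (inversions V (S - V))) (degsgn A (card (S - V)) (x V) \<otimes> y (S - V))"
    have fS: "?f (Suc ` T) (Suc ` V) = sgnpow A (int (inversions V (T - V))) (degsgn A (card (T - V)) (x (Suc ` V)) \<otimes> y (Suc ` (T - V)))" for V
      by (simp add: diffS inversions_Suc card_image)
    have c: "x (Suc ` V) \<in> carrier A" "y (Suc ` (T - V)) \<in> carrier A" if "V \<in> Pow T" for V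
      using that T xE(1)[OF x, of V] xE(1)[OF y, of "T - V"] by auto
    have "?p (x \<otimes>\<^bsub>E\<^esub> y) T = (\<Oplus>V\<in>(`) Suc ` Pow T. ?f (Suc ` T) V)"
      unfolding pT[OF T] Emul[OF Suc_image_subset(1)[OF T]] PowS ..
    also have "\<dots> = (?p x \<otimes>\<^bsub>C\<^esub> ?p y) T"
      unfolding Cmul[OF T]
    proof (rule finsum_reindex_cong[OF injS(1)])
      fix V assume V: "V \<in> Pow T"
      then have "V \<subseteq> {..<n}" "T - V \<subseteq> {..<n}" using T by auto
      then show "?f (Suc ` T) (Suc ` V) = sgnpow A (int (inversions V (T - V))) (degsgn A (card (T - V)) (?p x V) \<otimes> ?p y (T - V))"
        unfolding fS by (simp add: pT)
    next
      show "(\<lambda>V. sgnpow A (int (inversions V (T - V))) (degsgn A (card (T - V)) (?p x V) \<otimes> ?p y (T - V))) \<in> Pow T \<rightarrow> carrier A"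
      proof
        fix V assume V: "V \<in> Pow T"
        then have "V \<subseteq> {..<n}" "T - V \<subseteq> {..<n}" using T by auto
        then show "sgnpow A (int (inversions V (T - V))) (degsgn A (card (T - V)) (?p x V) \<otimes> ?p y (T - V)) \<in> carrier A"
          using c[OF V] by (simp add: pT)
      qed
    qed
    finally show ?thesis .
  qed
  have mulq: "?q (x \<otimes>\<^bsub>E\<^esub> y) T = (?q x \<otimes>\<^bsub>C\<^esub> ?p y \<oplus>\<^bsub>C\<^esub> degsgn C 1 (?p x) \<otimes>\<^bsub>C\<^esub> ?q y) T"
    if x: "x \<in> carrier E" and y: "y \<in> carrier E" and T: "T \<subseteq> {..<n}" for x y T
  proof -
    let ?S = "insert 0 (Suc ` T)"
    let ?f = "\<lambda>V. sgnpow A (int (inversions V (?S - V))) (degsgn A (card (?S - V)) (x V) \<otimes> y (?S - V))"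
    have sub: "V \<subseteq> {..<n}" "T - V \<subseteq> {..<n}" if "V \<in> Pow T" for V using that T by auto
    have c: "x (Suc ` V) \<in> carrier A" "x (insert 0 (Suc ` V)) \<in> carrier A"
      "y (Suc ` (T - V)) \<in> carrier A" "y (insert 0 (Suc ` (T - V))) \<in> carrier A" if "V \<in> Pow T" for V
      using that xE[OF x sub(1)[OF that]] xE[OF y sub(2)[OF that]] by auto
    let ?g1 = "\<lambda>V. sgnpow A (int (inversions V (T - V))) (degsgn A (card (T - V)) (degsgn C 1 (?p x) V) \<otimes> ?q y (T - V))"
    let ?g2 = "\<lambda>V. sgnpow A (int (inversions V (T - V))) (degsgn A (card (T - V)) (?q x V) \<otimes> ?p y (T - V))"
    \<comment> \<open>Here e_0 belongs to the right factor. It passes the variables in V, giving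
      (-1)^(card V), and the coefficient of x passes one more variable, giving
      \<open>degsgn A 1\<close>. By \<open>degK\<close> the two signs together are
      \<open>degsgn C 1\<close>.\<close>
    have f1: "?f (Suc ` V) = ?g1 V" if V: "V \<in> Pow T" for V
    proof -
      have d: "?S - Suc ` V = insert 0 (Suc ` (T - V))" by auto
      have fV: "finite V" "finite (T - V)" using fin[OF sub(1)[OF V]] fin[OF sub(2)[OF V]] .
      have dd: "degsgn A (Suc (card (T - V))) (x (Suc ` V)) = degsgn A (card (T - V)) (degsgn A 1 (x (Suc ` V)))"
        using c[OF V] by (simp add: degsgn_degsgn)
      have "?f (Suc ` V) = sgnpow A (int (inversions V (T - V)) + int (card V)) (degsgn A (card (T - V)) (degsgn A 1 (x (Suc ` V))) \<otimes> y (insert 0 (Suc ` (T - V))))"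
        unfolding d inversions_insert0_right[OF fV] card_Suc_image(2)[OF fV(2)] dd by (simp add: add.commute)
      also have "\<dots> = ?g1 V"
        unfolding degK[OF pc[OF x] sub(1)[OF V]] pT[OF sub(1)[OF V]] qT[OF sub(2)[OF V]]
        using c[OF V] by (simp add: degsgn_sgn sgn_mult sgnpow_sgnpow[OF is_abelian_group])
      finally show ?thesis .
    qed
    \<comment> \<open>Here e_0 belongs to the left factor and is already in front.\<close>
    have f2: "?f (insert 0 (Suc ` V)) = ?g2 V" if V: "V \<in> Pow T" for V
    proof -
      have "?S - insert 0 (Suc ` V) = Suc ` (T - V)" by auto
      then show ?thesis
        using sub[OF V] by (simp add: inversions_insert0 inversions_Suc card_image pT qT)
    qed
    have gc: "?g1 V \<in> carrier A" "?g2 V \<in> carrier A" if V: "V \<in> Pow T" for V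
      using c[OF V] sub[OF V] degK[OF pc[OF x] sub(1)[OF V]] by (simp_all add: pT qT)
    have "?q (x \<otimes>\<^bsub>E\<^esub> y) T = (\<Oplus>V\<in>(`) Suc ` Pow T \<union> (\<lambda>V. insert 0 (Suc ` V)) ` Pow T. ?f V)"
      unfolding qT[OF T] Emul[OF Suc_image_subset(2)[OF T]] Pow_insert PowS by (simp only: image_image)
    also have "\<dots> = (\<Oplus>V\<in>(`) Suc ` Pow T. ?f V) \<oplus> (\<Oplus>V\<in>(\<lambda>V. insert 0 (Suc ` V)) ` Pow T. ?f V)"
    proof (rule finsum_Un_disjoint)
      show "?f \<in> (`) Suc ` Pow T \<rightarrow> carrier A"
        by (rule Pi_imageI) (erule f1, erule gc(1))
      show "?f \<in> (\<lambda>V. insert 0 (Suc ` V)) ` Pow T \<rightarrow> carrier A"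
        by (rule Pi_imageI) (erule f2, erule gc(2))
    qed (use fin[OF T] in auto)
    also have "(\<Oplus>V\<in>(`) Suc ` Pow T. ?f V) = (\<Oplus>V\<in>Pow T. ?g1 V)"
      using f1 gc(1) by (intro finsum_reindex_cong injS) auto
    also have "(\<Oplus>V\<in>(\<lambda>V. insert 0 (Suc ` V)) ` Pow T. ?f V) = (\<Oplus>V\<in>Pow T. ?g2 V)"
      using f2 gc(2) by (intro finsum_reindex_cong injS) auto
    finally have "?q (x \<otimes>\<^bsub>E\<^esub> y) T = (\<Oplus>V\<in>Pow T. ?g1 V) \<oplus> (\<Oplus>V\<in>Pow T. ?g2 V)" .
    also have "\<dots> = (\<Oplus>V\<in>Pow T. ?g2 V) \<oplus> (\<Oplus>V\<in>Pow T. ?g1 V)"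
      using gc by (intro a_comm finsum_closed) auto
    finally show ?thesis
      using T by (simp add: C_def Cmul[unfolded C_def] n_def[symmetric])
  qed
  have Eclosed: "x \<oplus>\<^bsub>E\<^esub> y \<in> carrier E" "x \<otimes>\<^bsub>E\<^esub> y \<in> carrier E"
    if "x \<in> carrier E" "y \<in> carrier E" for x y
  proof -
    show "x \<oplus>\<^bsub>E\<^esub> y \<in> carrier E" using that by (auto simp: E_def)
    show "x \<otimes>\<^bsub>E\<^esub> y \<in> carrier E" using that koszul_mult_closed[of x "a # as" y] by (simp only: E_def)
  qed
  have Edif: "dif E x \<in> carrier E" if "x \<in> carrier E" for x
    using that koszul_dif_closed[OF asE, of x] by (simp only: E_def)
  have Cclosed: "u \<oplus>\<^bsub>C\<^esub> v \<in> carrier C" "u \<otimes>\<^bsub>C\<^esub> v \<in> carrier C"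
    if "u \<in> carrier C" "v \<in> carrier C" for u v
    using that unfolding C_def by (simp_all del: koszul_sel)
  have Cclosed1: "dif C u \<in> carrier C" "\<ominus>\<^bsub>C\<^esub> u \<in> carrier C" "degsgn C 1 u \<in> carrier C"
    if "u \<in> carrier C" for u
    using that unfolding C_def by (simp_all del: koszul_sel)
  have Eadd: "(x \<oplus>\<^bsub>E\<^esub> y) S = x S \<oplus> y S" if "S \<subseteq> {..<Suc n}" for x y S
    using that by (simp add: E_def n_def)
  have zero_one: "\<zero>\<^bsub>E\<^esub> \<in> carrier E" "\<one>\<^bsub>E\<^esub> \<in> carrier E" "\<zero>\<^bsub>C\<^esub> \<in> carrier C" "\<one>\<^bsub>C\<^esub> \<in> carrier C"
    "S \<subseteq> {..<Suc n} \<Longrightarrow> \<zero>\<^bsub>E\<^esub> S = \<zero>" "S \<subseteq> {..<Suc n} \<Longrightarrow> \<one>\<^bsub>E\<^esub> S = (if S = {} then \<one> else \<zero>)"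
    "T \<subseteq> {..<n} \<Longrightarrow> \<zero>\<^bsub>C\<^esub> T = \<zero>" "T \<subseteq> {..<n} \<Longrightarrow> \<one>\<^bsub>C\<^esub> T = (if T = {} then \<one> else \<zero>)" for S T
    by (auto simp: E_def C_def n_def koszul_incl_def)
  have aCc: "koszul_incl A as a \<in> carrier C" unfolding C_def by (rule koszul_incl_closed) simp
  have CI: "u = v" if "u \<in> carrier C" "v \<in> carrier C" "\<And>T. T \<subseteq> {..<n} \<Longrightarrow> u T = v T" for u v
    using that Cext CextI by blast
  have grd: "x \<in> grd E k \<longleftrightarrow> x \<in> carrier E \<and> ?p x \<in> grd C k \<and> ?q x \<in> grd C (k + 1)" for x k
  proof
    assume x: "x \<in> grd E k"
    have xS: "x S \<in> grd A (k + int (card S))" if "S \<subseteq> {..<Suc n}" for S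
      using x that by (auto simp: E_def n_def)
    have "x \<in> carrier E" using x grd_carrier by (auto simp: E_def PiE_iff)
    moreover have "?p x \<in> grd C k" "?q x \<in> grd C (k + 1)"
      using xS[OF Suc_image_subset(1)] xS[OF Suc_image_subset(2)] fin
      by (auto simp: C_def n_def[symmetric] koszul_base_def koszul_coeff_def card_image algebra_simps)
    ultimately show "x \<in> carrier E \<and> ?p x \<in> grd C k \<and> ?q x \<in> grd C (k + 1)" by blast
  next
    assume x: "x \<in> carrier E \<and> ?p x \<in> grd C k \<and> ?q x \<in> grd C (k + 1)"
    have "x S \<in> grd A (k + int (card S))" if "S \<subseteq> {..<Suc n}" for S
      using that
    proof (cases rule: Pow_Suc_cases)
      case (1 T)
      then have "?p x T \<in> grd A (k + int (card T))" using x by (auto simp: C_def n_def)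
      then show ?thesis using 1 by (simp add: pT card_image)
    next
      case (2 T)
      then have "?q x T \<in> grd A (k + 1 + int (card T))" using x by (auto simp: C_def n_def)
      then show ?thesis using 2 fin by (simp add: qT card_image algebra_simps)
    qed
    then show "x \<in> grd E k" using x by (auto simp: E_def n_def PiE_iff)
  qed
  have "exterior_ext C E (koszul_incl A as a) ?p ?q"
  proof (intro exterior_ext.intro exterior_ext_axioms.intro)
    show "comm_dg_ring C" unfolding C_def by (rule K.comm_dg_ring_axioms)
    fix x y assume x: "x \<in> carrier E" and y: "y \<in> carrier E"
    show "?p (x \<otimes>\<^bsub>E\<^esub> y) = ?p x \<otimes>\<^bsub>C\<^esub> ?p y"
      using mulp[OF x y] x y by (intro CI pc Eclosed Edif Cclosed Cclosed1)
    show "?q (x \<otimes>\<^bsub>E\<^esub> y) = ?q x \<otimes>\<^bsub>C\<^esub> ?p y \<oplus>\<^bsub>C\<^esub> degsgn C 1 (?p x) \<otimes>\<^bsub>C\<^esub> ?q y"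
      using mulq[OF x y] x y by (intro CI pc qc Eclosed Edif Cclosed Cclosed1)
    show "?p (x \<oplus>\<^bsub>E\<^esub> y) = ?p x \<oplus>\<^bsub>C\<^esub> ?p y" "?q (x \<oplus>\<^bsub>E\<^esub> y) = ?q x \<oplus>\<^bsub>C\<^esub> ?q y"
      using x y by (auto intro!: CI pc qc Eclosed Cclosed simp: pT qT Eadd Cadd Suc_image_subset)
  next
    fix x assume x: "x \<in> carrier E"
    show "?p (dif E x) = dif C (?p x) \<oplus>\<^bsub>C\<^esub> koszul_incl A as a \<otimes>\<^bsub>C\<^esub> ?q x"
      using difp[OF x] x aCc by (intro CI pc qc Eclosed Edif Cclosed Cclosed1)
    show "?q (dif E x) = \<ominus>\<^bsub>C\<^esub> dif C (?q x)"
      using difq[OF x] x by (intro CI pc qc Eclosed Edif Cclosed Cclosed1)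
  next
    show "?p \<zero>\<^bsub>E\<^esub> = \<zero>\<^bsub>C\<^esub>" "?q \<zero>\<^bsub>E\<^esub> = \<zero>\<^bsub>C\<^esub>" "?p \<one>\<^bsub>E\<^esub> = \<one>\<^bsub>C\<^esub>" "?q \<one>\<^bsub>E\<^esub> = \<zero>\<^bsub>C\<^esub>"
      by (rule CI; simp add: pc qc zero_one pT qT Suc_image_subset)+
  qed (fact aC pc qc eqI surj Eclosed Edif grd zero_one)+
  then show ?thesis by (simp add: C_def E_def n_def)
qed

section \<open>Variables, lifts and homotopies of the Koszul DG-ring\<close>

definition koszul_gen :: "('a, 'z) dg_scheme \<Rightarrow> 'a list \<Rightarrow> nat \<Rightarrow> nat set \<Rightarrow> 'a" where
  "koszul_gen A as i = (\<lambda>S\<in>Pow {..<length as}. if S = {i} then \<one>\<^bsub>A\<^esub> else \<zero>\<^bsub>A\<^esub>)"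

context comm_dg_ring
begin

lemma dg_ring_koszul: "set as \<subseteq> grd A 0 \<Longrightarrow> dg_ring (koszul A as)"
proof (induction as)
  case (Cons a as)
  then show ?case using koszul_Cons exterior_ext.E_dg_ring by (metis insert_subset list.simps(15))
qed (rule koszul_Nil)

lemma degsgn_0: "x \<in> carrier A \<Longrightarrow> degsgn A 0 x = x"
  by (induction x rule: homogeneous_induct) (auto simp: degsgn_homogeneous sgnpow_even degsgn_add)

lemma koszul_eqI:
  assumes "x \<in> extensional (Pow {..<length as})" "y \<in> extensional (Pow {..<length as})"
    "\<And>S. S \<subseteq> {..<length as} \<Longrightarrow> x S = y S"
  shows "x = y"
  using assms by (auto intro: extensionalityI[of _ "Pow {..<length as}"])

lemma koszul_incl_apply:
  "S \<subseteq> {..<length as} \<Longrightarrow> koszul_incl A as b S = (if S = {} then b else \<zero>)"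
  by (simp add: koszul_incl_def)

lemma koszul_incl_extensional: "koszul_incl A as b \<in> extensional (Pow {..<length as})"
  by (simp add: koszul_incl_def)

lemma koszul_incl_hom:
  assumes as: "set as \<subseteq> grd A 0"
  shows "koszul_incl A as \<in> dg_hom A (koszul A as)"
proof -
  have asc: "as ! i \<in> carrier A" if "i < length as" for i
    using as that nth_mem grd_carrier by blast
  have mult: "koszul_incl A as (x \<otimes> y) = koszul_incl A as x \<otimes>\<^bsub>koszul A as\<^esub> koszul_incl A as y"
    if "x \<in> carrier A" "y \<in> carrier A" for x y
  proof (rule koszul_eqI)
    fix S assume S: "S \<subseteq> {..<length as}"
    show "koszul_incl A as (x \<otimes> y) S = (koszul_incl A as x \<otimes>\<^bsub>koszul A as\<^esub> koszul_incl A as y) S"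
      unfolding koszul_incl_mult[OF that(1) koszul_incl_closed[OF that(2)] S]
      using that S by (auto simp: koszul_incl_apply degsgn_0)
  qed (rule koszul_incl_extensional koszul_extensional)+
  have dif: "koszul_incl A as (dif A x) = dif (koszul A as) (koszul_incl A as x)" if "x \<in> carrier A" for x
  proof (rule koszul_eqI)
    fix S assume S: "S \<subseteq> {..<length as}"
    have "(\<Oplus>i\<in>{..<length as} - S. sgnpow A (int (card {j \<in> S. j < i})) (as ! i \<otimes> koszul_incl A as x (insert i S))) = (\<Oplus>i\<in>{..<length as} - S. \<zero>)"
      using S asc by (intro finsum_cong') (auto simp: koszul_incl_apply sgnpow_def)
    then show "koszul_incl A as (dif A x) S = dif (koszul A as) (koszul_incl A as x) S"
      unfolding koszul_dif[OF S] using S that by (auto simp: koszul_incl_apply sgnpow_def)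
  qed (rule koszul_incl_extensional koszul_extensional)+
  have add: "koszul_incl A as (x \<oplus> y) = koszul_incl A as x \<oplus>\<^bsub>koszul A as\<^esub> koszul_incl A as y"
    if "x \<in> carrier A" "y \<in> carrier A" for x y
    using that by (auto simp: koszul_incl_def)
  show ?thesis
    unfolding dg_hom_def ring_hom_def
    using koszul_incl_closed koszul_incl_grd mult dif add by (auto simp del: koszul_sel(1-4))
qed

lemma koszul_gen_apply:
  "S \<subseteq> {..<length as} \<Longrightarrow> koszul_gen A as i S = (if S = {i} then \<one> else \<zero>)"
  by (simp add: koszul_gen_def)

lemma koszul_gen_extensional: "koszul_gen A as i \<in> extensional (Pow {..<length as})"
  by (simp add: koszul_gen_def)

lemma koszul_gen_grd: "koszul_gen A as i \<in> grd (koszul A as) (-1)"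
  using grd_one grd_zero by (auto simp: koszul_gen_def)

text \<open>The summand of j at S involves the coefficient of e_i at \<open>insert j S\<close> with
  j outside S. It can be nonzero only for S = {} and j = i.\<close>

lemma koszul_gen_dif:
  assumes as: "set as \<subseteq> grd A 0" and i: "i < length as"
  shows "dif (koszul A as) (koszul_gen A as i) = koszul_incl A as (as ! i)"
proof (rule koszul_eqI)
  have asc: "as ! i \<in> carrier A" if "i < length as" for i
    using as that nth_mem grd_carrier by blast
  fix S assume S: "S \<subseteq> {..<length as}"
  let ?f = "\<lambda>j. sgnpow A (int (card {k \<in> S. k < j})) (as ! j \<otimes> koszul_gen A as i (insert j S))"
  have "dif A (koszul_gen A as i S) = \<zero>"
    using S by (simp add: koszul_gen_apply dif_one)
  moreover have "(\<Oplus>j\<in>{..<length as} - S. ?f j) = (if S = {} then as ! i else \<zero>)"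
  proof (cases "S = {}")
    case True
    have "(\<Oplus>j\<in>{..<length as} - S. ?f j) = (\<Oplus>j\<in>{..<length as}. if i = j then as ! j else \<zero>)"
      using True asc by (intro finsum_cong') (auto simp: koszul_gen_apply sgnpow_def)
    also have "\<dots> = as ! i" using asc i by (intro add.finprod_singleton) auto
    finally show ?thesis using True by simp
  next
    case False
    have "insert j S \<noteq> {i}" if "j \<notin> S" for j using that False by blast
    then have "(\<Oplus>j\<in>{..<length as} - S. ?f j) = (\<Oplus>j\<in>{..<length as} - S. \<zero>)"
      using S asc by (intro finsum_cong') (auto simp: koszul_gen_apply sgnpow_def)
    then show ?thesis using False by simp
  qed
  ultimately show "dif (koszul A as) (koszul_gen A as i) S = koszul_incl A as (as ! i) S"
    unfolding koszul_dif[OF S] using S asc[OF i] by (simp add: koszul_incl_apply) (simp add: sgnpow_def asc[OF i])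
qed (rule koszul_incl_extensional koszul_extensional)+

lemma koszul_Nil_eq: "y \<in> carrier (koszul A []) \<Longrightarrow> y = koszul_incl A [] (y {})"
  by (rule koszul_eqI[of _ "[]"]) (auto simp: koszul_incl_def PiE_iff)

lemma koszul_Nil_eval: "(\<lambda>y. y {}) \<in> dg_hom (koszul A []) A"
proof -
  have "(x \<otimes>\<^bsub>koszul A []\<^esub> y) {} = x {} \<otimes> y {}" if x: "x \<in> carrier (koszul A [])" and y: "y \<in> carrier (koszul A [])" for x y
  proof -
    have "x {} \<in> carrier A" using x by auto
    then show ?thesis
      using koszul_incl_mult[of "x {}" y "[]" "{}"] y koszul_Nil_eq[OF x] by (simp add: degsgn_0)
  qed
  moreover have "dif (koszul A []) x {} = dif A (x {})" if "x \<in> carrier (koszul A [])" for x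
  proof -
    have "x {} \<in> carrier A" using that by auto
    then show ?thesis by (simp add: koszul_dif sgnpow_even)
  qed
  moreover have "x {} \<in> grd A n" if "x \<in> grd (koszul A []) n" for x n
    using PiE_mem[OF that[unfolded koszul_sel], of "{}"] by simp
  ultimately show ?thesis
    unfolding dg_hom_def ring_hom_def by (auto simp: koszul_incl_def simp del: koszul_sel(4))
qed

text \<open>The dictionary between the abstract embedding and variable of
  \<open>exterior_ext\<close> and the concrete generators: the new variable is number 0 and the old
  ones move up by one. It lets the inductions over the list use the results of the locale.\<close>

lemma koszul_Cons_gens:
  assumes as: "set as \<subseteq> grd A 0" and a: "a \<in> grd A 0"
  defines "X \<equiv> exterior_ext.incl (koszul A as) (koszul A (a # as)) (koszul_base (length as)) (koszul_coeff (length as))"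
  shows "exterior_ext.var (koszul A as) (koszul A (a # as)) (koszul_base (length as)) (koszul_coeff (length as)) = koszul_gen A (a # as) 0"
    and "i < length as \<Longrightarrow> X (koszul_gen A as i) = koszul_gen A (a # as) (Suc i)"
    and "b \<in> carrier A \<Longrightarrow> X (koszul_incl A as b) = koszul_incl A (a # as) b"
    and "koszul_base (length as) (koszul_gen A (a # as) 0) = \<zero>\<^bsub>koszul A as\<^esub>"
    and "koszul_coeff (length as) (koszul_gen A (a # as) 0) = \<one>\<^bsub>koszul A as\<^esub>"
    and "koszul_base (length as) (koszul_gen A (a # as) (Suc i)) = koszul_gen A as i"
    and "koszul_coeff (length as) (koszul_gen A (a # as) (Suc i)) = \<zero>\<^bsub>koszul A as\<^esub>"
    and "koszul_base (length as) (koszul_incl A (a # as) b) = koszul_incl A as b"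
    and "koszul_coeff (length as) (koszul_incl A (a # as) b) = \<zero>\<^bsub>koszul A as\<^esub>"
proof -
  interpret X: exterior_ext "koszul A as" "koszul A (a # as)" "koszul_incl A as a"
    "koszul_base (length as)" "koszul_coeff (length as)"
    by (rule koszul_Cons[OF dg_ring_koszul[OF as] as a])
  let ?n = "length as"
  have base: "koszul_base ?n y T = y (Suc ` T)" and coeff: "koszul_coeff ?n y T = y (insert 0 (Suc ` T))"
    if "T \<subseteq> {..<?n}" for y :: "nat set \<Rightarrow> 'a" and T
    using that by (auto simp: koszul_base_def koszul_coeff_def)
  have ext: "koszul_base ?n y \<in> extensional (Pow {..<?n})" "koszul_coeff ?n y \<in> extensional (Pow {..<?n})"
    "\<zero>\<^bsub>koszul A as\<^esub> \<in> extensional (Pow {..<?n})" "\<one>\<^bsub>koszul A as\<^esub> \<in> extensional (Pow {..<?n})" for y :: "nat set \<Rightarrow> 'a"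
    by (auto simp: koszul_base_def koszul_coeff_def koszul_incl_def)
  have sing: "Suc ` T = {Suc i} \<longleftrightarrow> T = {i}" "insert 0 (Suc ` T) = {0} \<longleftrightarrow> T = {}" "Suc ` T \<noteq> {0}"
    "insert 0 (Suc ` T) \<noteq> {Suc i}" for T i by auto
  note S = Suc_image_subset
  have zero_one: "\<zero>\<^bsub>koszul A as\<^esub> T = \<zero>" "\<one>\<^bsub>koszul A as\<^esub> T = (if T = {} then \<one> else \<zero>)" if "T \<subseteq> {..<?n}" for T
    using that by (auto simp: koszul_incl_def)
  note ap = koszul_gen_apply koszul_incl_apply base coeff S sing zero_one
  show 1: "koszul_base ?n (koszul_gen A (a # as) 0) = \<zero>\<^bsub>koszul A as\<^esub>"
    by (rule koszul_eqI[OF ext(1,3)]) (simp only: ap length_Cons if_False)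
  show 2: "koszul_coeff ?n (koszul_gen A (a # as) 0) = \<one>\<^bsub>koszul A as\<^esub>"
    by (rule koszul_eqI[OF ext(2,4)]) (simp only: ap length_Cons)
  show 3: "koszul_base ?n (koszul_gen A (a # as) (Suc i)) = koszul_gen A as i" for i
    by (rule koszul_eqI[OF ext(1) koszul_gen_extensional]) (simp add: ap del: koszul_sel)
  show 4: "koszul_coeff ?n (koszul_gen A (a # as) (Suc i)) = \<zero>\<^bsub>koszul A as\<^esub>" for i
    by (rule koszul_eqI[OF ext(2,3)]) (simp add: ap del: koszul_sel)
  show 5: "koszul_base ?n (koszul_incl A (a # as) b) = koszul_incl A as b" for b
    by (rule koszul_eqI[OF ext(1) koszul_incl_extensional]) (simp add: ap del: koszul_sel)
  show 6: "koszul_coeff ?n (koszul_incl A (a # as) b) = \<zero>\<^bsub>koszul A as\<^esub>" for b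
    by (rule koszul_eqI[OF ext(2,3)]) (simp add: ap del: koszul_sel)
  have g: "koszul_gen A (a # as) i \<in> carrier (koszul A (a # as))" for i
    using X.E.grd_carrier[OF koszul_gen_grd] .
  show "X.var = koszul_gen A (a # as) 0"
    using g 1 2 by (rule X.var_eqI)
  show "X (koszul_gen A as i) = koszul_gen A (a # as) (Suc i)" if "i < length as"
    unfolding X_def using g 3 4 by (rule X.incl_eqI)
  show "X (koszul_incl A as b) = koszul_incl A (a # as) b" if "b \<in> carrier A"
    unfolding X_def using koszul_incl_closed[OF that] 5 6 by (rule X.incl_eqI)
qed

text \<open>One application of \<open>hom_extend\<close> per generator. As the list grows at its
  front, the induction hypothesis is used for the shifted family and \<open>\<xi> 0\<close> is the
  value on the last variable adjoined.\<close>

lemma koszul_lift: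
  fixes L :: "('l, 'x) dg_scheme"
  assumes L: "dg_ring L" and f: "f \<in> dg_hom A L" and as: "set as \<subseteq> grd A 0"
    and \<xi>: "\<And>i. i < length as \<Longrightarrow> \<xi> i \<in> grd L (-1)" "\<And>i. i < length as \<Longrightarrow> dif L (\<xi> i) = f (as ! i)"
  shows "\<exists>g\<in>dg_hom (koszul A as) L. (\<forall>x\<in>carrier A. g (koszul_incl A as x) = f x) \<and>
           (\<forall>i<length as. g (koszul_gen A as i) = \<xi> i)"
  using as \<xi>
proof (induction as arbitrary: \<xi>)
  case Nil
  have "f \<circ> (\<lambda>y. y {}) \<in> dg_hom (koszul A []) L"
    using koszul_Nil_eval f by (rule dg_hom_comp)
  then show ?case by (intro bexI[of _ "f \<circ> (\<lambda>y. y {})"]) (auto simp: koszul_incl_def)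
next
  case (Cons a as)
  have a: "a \<in> grd A 0" and as: "set as \<subseteq> grd A 0" using Cons.prems(1) by auto
  interpret X: exterior_ext "koszul A as" "koszul A (a # as)" "koszul_incl A as a"
    "koszul_base (length as)" "koszul_coeff (length as)"
    by (rule koszul_Cons[OF dg_ring_koszul[OF as] as a])
  interpret L: comm_dg_ring L using L by (simp add: comm_dg_ring_iff)
  obtain g where g: "g \<in> dg_hom (koszul A as) L" "\<And>x. x \<in> carrier A \<Longrightarrow> g (koszul_incl A as x) = f x"
    "\<And>i. i < length as \<Longrightarrow> g (koszul_gen A as i) = \<xi> (Suc i)"
    using Cons.IH[of "\<lambda>i. \<xi> (Suc i)"] as Cons.prems(2)[of "Suc _"] Cons.prems(3)[of "Suc _"] by auto
  interpret g: dg_ring_hom "koszul A as" L g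
    using g(1) by unfold_locales
  have \<xi>0: "\<xi> 0 \<in> grd L (-1)" "dif L (\<xi> 0) = f a" using Cons.prems(2,3)[of 0] by auto
  have d0: "dif L (\<xi> 0) = g (koszul_incl A as a)" using \<xi>0 g(2)[OF grd_carrier[OF a]] by simp
  let ?g = "\<lambda>x. g (koszul_base (length as) x) \<oplus>\<^bsub>L\<^esub> \<xi> 0 \<otimes>\<^bsub>L\<^esub> g (koszul_coeff (length as) x)"
  have hom: "?g \<in> dg_hom (koszul A (a # as)) L"
    using g(1) L \<xi>0(1) d0 by (rule X.hom_extend)
  have \<xi>c: "\<xi> 0 \<in> carrier L" using L.grd_carrier[OF \<xi>0(1)] .
  note gens = koszul_Cons_gens[OF as a]
  have ic: "koszul_incl A as x \<in> carrier (koszul A as)" if "x \<in> carrier A" for x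
    by (rule koszul_incl_closed[OF that])
  have gc: "koszul_gen A as i \<in> carrier (koszul A as)" for i
    using X.C.grd_carrier[OF koszul_gen_grd] .
  have "?g (koszul_incl A (a # as) x) = f x" if "x \<in> carrier A" for x
    using that \<xi>c g.f_closed[OF ic[OF that]] unfolding gens(8,9) g.f_zero by (simp add: g(2)[symmetric])
  note gi = this
  have gg: "?g (koszul_gen A (a # as) i) = \<xi> i" if "i < length (a # as)" for i
  proof (cases i)
    case 0
    show ?thesis using \<xi>c unfolding 0 gens(4,5) g.f_zero g.f_one by simp
  next
    case (Suc j)
    then show ?thesis
      using that \<xi>c g.f_closed[OF gc] g(3)[of j] unfolding Suc gens(6,7) g.f_zero
      by (metis L.r_null L.r_zero Suc_less_eq length_Cons)
  qed
  show ?case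
    by (intro bexI[OF _ hom] conjI ballI allI impI gi gg)
qed

text \<open>One application of \<open>homotopy_extend\<close> per generator, starting from the zero
  homotopy. Linearity over all of \<open>grd A 0\<close> is carried along, because the elements
  still to be adjoined will take the part of \<open>a\<close> there.\<close>

lemma koszul_homotopy:
  fixes L :: "('l, 'x) dg_scheme"
  assumes L: "dg_ring L" and as: "set as \<subseteq> grd A 0"
    and F: "F \<in> dg_hom (koszul A as) L" and G: "G \<in> dg_hom (koszul A as) L"
    and incl: "\<And>x. x \<in> carrier A \<Longrightarrow> F (koszul_incl A as x) = G (koszul_incl A as x)"
    and gen: "\<And>i. i < length as \<Longrightarrow>
      \<exists>\<zeta>\<in>grd L (-2). F (koszul_gen A as i) = G (koszul_gen A as i) \<oplus>\<^bsub>L\<^esub> dif L \<zeta>"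
  shows "\<exists>h. dg_homotopy (koszul A as) L (koszul_incl A as ` grd A 0) F G h"
  using as F G incl gen
proof (induction as arbitrary: F G)
  case Nil
  interpret L: comm_dg_ring L using L by (simp add: comm_dg_ring_iff)
  interpret K: comm_dg_ring "koszul A []" using koszul_Nil by (simp add: comm_dg_ring_iff)
  interpret F: dg_ring_hom "koszul A []" L F using Nil(2) by unfold_locales
  interpret G: dg_ring_hom "koszul A []" L G using Nil(3) by unfold_locales
  have FG: "F y = G y" if "y \<in> carrier (koszul A [])" for y
  proof -
    have "y {} \<in> carrier A" using that by auto
    then show ?thesis using Nil(4) koszul_Nil_eq[OF that] by metis
  qed
  have bc: "b \<in> carrier (koszul A [])" if "b \<in> koszul_incl A [] ` grd A 0" for b
    using that koszul_incl_grd K.grd_carrier by blast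
  have "dg_homotopy (koszul A []) L (koszul_incl A [] ` grd A 0) F G (\<lambda>_. \<zero>\<^bsub>L\<^esub>)"
    unfolding dg_homotopy_def
  proof (intro conjI ballI allI)
    show "F b = G b" if "b \<in> koszul_incl A [] ` grd A 0" for b by (rule FG[OF bc[OF that]])
    show "\<zero>\<^bsub>L\<^esub> = F b \<otimes>\<^bsub>L\<^esub> \<zero>\<^bsub>L\<^esub>" if "b \<in> koszul_incl A [] ` grd A 0" for b
      using F.f_closed[OF bc[OF that]] by simp
    show "F x = G x \<oplus>\<^bsub>L\<^esub> (dif L \<zero>\<^bsub>L\<^esub> \<oplus>\<^bsub>L\<^esub> \<zero>\<^bsub>L\<^esub>)" if "x \<in> carrier (koszul A [])" for x
      using FG[OF that] G.f_closed[OF that] by simp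
  qed (auto simp: L.grd_zero)
  then show ?case by blast
next
  case (Cons a as)
  have a: "a \<in> grd A 0" and as: "set as \<subseteq> grd A 0" using Cons.prems(1) by auto
  interpret X: exterior_ext "koszul A as" "koszul A (a # as)" "koszul_incl A as a"
    "koszul_base (length as)" "koszul_coeff (length as)"
    by (rule koszul_Cons[OF dg_ring_koszul[OF as] as a])
  note gens = koszul_Cons_gens[OF as a]
  have "\<exists>h. dg_homotopy (koszul A as) L (koszul_incl A as ` grd A 0) (F \<circ> X.incl) (G \<circ> X.incl) h"
  proof (rule Cons.IH[OF as])
    show "F \<circ> X.incl \<in> dg_hom (koszul A as) L" "G \<circ> X.incl \<in> dg_hom (koszul A as) L"
      using X.incl_hom Cons.prems(2,3) by (auto intro: dg_hom_comp)
    show "(F \<circ> X.incl) (koszul_incl A as x) = (G \<circ> X.incl) (koszul_incl A as x)" if "x \<in> carrier A" for x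
      using Cons.prems(4)[OF that] by (simp add: gens(3)[OF that])
    show "\<exists>\<zeta>\<in>grd L (-2). (F \<circ> X.incl) (koszul_gen A as i) = (G \<circ> X.incl) (koszul_gen A as i) \<oplus>\<^bsub>L\<^esub> dif L \<zeta>"
      if "i < length as" for i
      using Cons.prems(5)[of "Suc i"] that by (simp add: gens(2)[OF that])
  qed
  then obtain h where h: "dg_homotopy (koszul A as) L (koszul_incl A as ` grd A 0) (F \<circ> X.incl) (G \<circ> X.incl) h"
    by blast
  obtain \<zeta> where \<zeta>: "\<zeta> \<in> grd L (-2)" "F X.var = G X.var \<oplus>\<^bsub>L\<^esub> dif L \<zeta>"
    using Cons.prems(5)[of 0] unfolding gens(1) by auto
  have "X.incl ` koszul_incl A as ` grd A 0 = koszul_incl A (a # as) ` grd A 0"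
    unfolding image_image using gens(3) grd_carrier by (intro image_cong) auto
  moreover have "\<exists>h. dg_homotopy (koszul A (a # as)) L (X.incl ` koszul_incl A as ` grd A 0) F G h"
    using X.homotopy_extend[OF Cons.prems(2,3) L h _ _ \<zeta>] koszul_incl_grd a by blast
  ultimately show ?case by simp
qed

text \<open>The coefficient at a nonempty S has the positive degree \<open>card S\<close> and
  therefore vanishes.\<close>

lemma koszul_grd0:
  assumes "x \<in> grd (koszul A as) 0"
  shows "x {} \<in> grd A 0" "x = koszul_incl A as (x {})"
proof -
  have x: "x S \<in> grd A (int (card S))" if "S \<subseteq> {..<length as}" for S using assms that by auto
  show "x {} \<in> grd A 0" using x[of "{}"] by simp
  show "x = koszul_incl A as (x {})"
  proof (rule koszul_eqI[OF _ koszul_incl_extensional])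
    show "x \<in> extensional (Pow {..<length as})" using assms by (auto simp: PiE_iff)
    fix S assume S: "S \<subseteq> {..<length as}"
    then have "S \<noteq> {} \<Longrightarrow> int (card S) > 0" using finite_nat_subset[OF S] by (simp add: card_gt_0_iff)
    then show "x S = koszul_incl A as (x {}) S"
      using x[OF S] grd_pos[of "int (card S)"] S by (auto simp: koszul_incl_apply)
  qed
qed

text \<open>The coefficient at S has degree \<open>card S\<close> - 1, so it vanishes as soon as S
  has two elements. Singletons are excluded by assumption, and only the part from \<open>A\<close>
  remains.\<close>

lemma koszul_grd_neg1:
  assumes x: "x \<in> grd (koszul A as) (-1)" and 0: "\<And>i. i < length as \<Longrightarrow> x {i} = \<zero>"
  shows "x = koszul_incl A as (x {})"
proof (rule koszul_eqI[OF _ koszul_incl_extensional])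
  show "x \<in> extensional (Pow {..<length as})" using x by (auto simp: PiE_iff)
  fix S assume S: "S \<subseteq> {..<length as}"
  have xS: "x S \<in> grd A (int (card S) - 1)" using x S by auto
  consider "S = {}" | i where "S = {i}" | "card S > 1"
    using finite_nat_subset[OF S] by (metis card_1_singletonE card_0_eq less_one linorder_neqE_nat)
  then show "x S = koszul_incl A as (x {}) S"
  proof cases
    case 3
    then show ?thesis
      using S xS grd_pos[of "int (card S) - 1"] by (auto simp: koszul_incl_apply)
  qed (use S 0 in \<open>auto simp: koszul_incl_apply\<close>)
qed

lemma koszul_finsum_apply:
  fixes I :: "nat set"
  assumes "finite I" "f \<in> I \<rightarrow> carrier (koszul A as)" "S \<subseteq> {..<length as}"
  shows "finsum (koszul A as) f I S = (\<Oplus>i\<in>I. f i S)"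
proof -
  have "finsum (koszul A as) f I = finsum (koszul_mod A as (dg_self A)) f I"
    by (simp add: finsum_def finprod_def koszul_def Let_def)
  moreover have "abelian_group (dg_self A)"
  proof (rule abelian_groupI)
    fix x assume "x \<in> carrier (dg_self A)"
    then show "\<exists>y\<in>carrier (dg_self A). y \<oplus>\<^bsub>dg_self A\<^esub> x = \<zero>\<^bsub>dg_self A\<^esub>"
      using l_neg a_inv_closed by auto
  qed (auto simp: a_ac)
  then have "finsum (koszul_mod A as (dg_self A)) f I S = finsum (dg_self A) (\<lambda>i. f i S) I"
    using assms by (intro finsum_koszul_mod) auto
  ultimately show ?thesis by simp
qed

lemma koszul_minus_apply:
  assumes as: "set as \<subseteq> grd A 0" and x: "x \<in> carrier (koszul A as)" and y: "y \<in> carrier (koszul A as)"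
    and S: "S \<subseteq> {..<length as}"
  shows "(x \<ominus>\<^bsub>koszul A as\<^esub> y) S = x S \<ominus> y S"
proof -
  interpret K: comm_dg_ring "koszul A as" using dg_ring_koszul[OF as] by (simp add: comm_dg_ring_iff)
  have "sgnpow (koszul A as) 1 y S = sgnpow A 1 (y S)"
    by (rule sgnpow_hom[OF K.is_abelian_group is_abelian_group _ _ y, where f = "\<lambda>y. y S"]) (use S in auto)
  then have "(\<ominus>\<^bsub>koszul A as\<^esub> y) S = \<ominus> (y S)" by (simp add: sgnpow_def)
  then show ?thesis using S by (simp add: a_minus_def)
qed

end

section \<open>Minimal generators over a local ring\<close>

lemma (in abelian_monoid) finsum_swap:
  assumes "finite I" "finite J" "\<And>i j. i \<in> I \<Longrightarrow> j \<in> J \<Longrightarrow> f i j \<in> carrier G"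
  shows "(\<Oplus>i\<in>I. \<Oplus>j\<in>J. f i j) = (\<Oplus>j\<in>J. \<Oplus>i\<in>I. f i j)"
  using assms(1,3)
proof (induction I)
  case (insert i I)
  have "(\<Oplus>j\<in>J. \<Oplus>i\<in>insert i I. f i j) = (\<Oplus>j\<in>J. f i j \<oplus> (\<Oplus>i\<in>I. f i j))"
    using insert.prems insert.hyps by (intro finsum_cong') (auto intro!: finsum_closed)
  also have "\<dots> = (\<Oplus>j\<in>J. f i j) \<oplus> (\<Oplus>j\<in>J. \<Oplus>i\<in>I. f i j)"
    using insert.prems by (intro finsum_addf) (auto intro!: finsum_closed)
  also have "(\<Oplus>j\<in>J. \<Oplus>i\<in>I. f i j) = (\<Oplus>i\<in>I. \<Oplus>j\<in>J. f i j)"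
    using insert by simp
  finally show ?case
    using insert.prems insert.hyps by (subst finsum_insert) (auto intro!: finsum_closed)
qed simp

text \<open>Zorn's lemma for the ideals that contain I and avoid one. The union of a nonempty chain
  of them again avoids one, and an ideal avoiding one is a proper ideal.\<close>

lemma (in cring) exists_maximalideal:
  assumes I: "ideal I R" and one: "\<one> \<notin> I"
  shows "\<exists>M. maximalideal M R \<and> I \<subseteq> M"
proof -
  define \<A> where "\<A> = {J. ideal J R \<and> I \<subseteq> J \<and> \<one> \<notin> J}"
  have "\<exists>M\<in>\<A>. \<forall>X\<in>\<A>. M \<subseteq> X \<longrightarrow> X = M"
  proof (rule subset_Zorn_nonempty)
    show "\<A> \<noteq> {}" using assms by (auto simp: \<A>_def)
    fix C assume C: "C \<noteq> {}" "subset.chain \<A> C"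
    have sub: "C \<subseteq> \<A>" using C(2) by (simp add: subset.chain_def)
    have "subset.chain {J. ideal J R} C" using C(2) by (auto simp: subset.chain_def \<A>_def)
    then have "ideal (\<Union>C) R" using chain_Union_is_ideal[of C] by (simp only: C(1) if_False)
    moreover obtain J where "J \<in> C" using C(1) by blast
    then have "I \<subseteq> \<Union>C" using sub by (auto simp: \<A>_def)
    moreover have "\<one> \<notin> \<Union>C" using sub by (auto simp: \<A>_def)
    ultimately show "\<Union>C \<in> \<A>" by (simp add: \<A>_def)
  qed
  then obtain M where M: "ideal M R" "I \<subseteq> M" "\<one> \<notin> M"
    and max: "\<And>X. ideal X R \<Longrightarrow> I \<subseteq> X \<Longrightarrow> \<one> \<notin> X \<Longrightarrow> M \<subseteq> X \<Longrightarrow> X = M"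
    unfolding \<A>_def by auto
  have "maximalideal M R"
  proof (rule maximalidealI[OF M(1)])
    show "carrier R \<noteq> M" using M(3) by auto
    fix J assume J: "ideal J R" "M \<subseteq> J" "J \<subseteq> carrier R"
    show "J = M \<or> J = carrier R"
    proof (cases "\<one> \<in> J")
      case True
      then show ?thesis using ideal.one_imp_carrier[OF J(1)] by simp
    next
      case False
      then show ?thesis using max[OF J(1)] J M by auto
    qed
  qed
  then show ?thesis using M(2) by blast
qed

text \<open>The principal ideal of a non-unit is proper, hence contained in some maximal ideal, and
  m is the only one.\<close>

lemma (in cring) local_ring_unit:
  assumes R: "local_ring R m" and x: "x \<in> carrier R" "x \<notin> m"
  shows "x \<in> Units R"
proof (rule ccontr)
  assume nu: "x \<notin> Units R"
  have id: "ideal (PIdl x) R" by (rule cgenideal_ideal[OF x(1)])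
  have "\<one> \<notin> PIdl x"
  proof
    assume "\<one> \<in> PIdl x"
    then obtain y where "y \<in> carrier R" "\<one> = y \<otimes> x" by (auto simp: cgenideal_def)
    then show False using nu x m_comm unfolding Units_def by fastforce
  qed
  then obtain M where "maximalideal M R" "PIdl x \<subseteq> M" using exists_maximalideal[OF id] by blast
  then have "PIdl x \<subseteq> m" using R by (auto simp: local_ring_def)
  then show False using cgenideal_self[OF x(1)] x(2) by blast
qed

lemma (in cring) local_ring_one_minus:
  assumes R: "local_ring R m" and x: "x \<in> m"
  shows "\<one>\<^bsub>R\<^esub> \<ominus>\<^bsub>R\<^esub> x \<in> Units R"
proof (rule local_ring_unit[OF R])
  interpret maximalideal m R using R by (simp add: local_ring_def)
  have xc: "x \<in> carrier R" using Icarr[OF x] .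
  show "\<one> \<ominus> x \<in> carrier R" using xc by simp
  show "\<one> \<ominus> x \<notin> m"
  proof
    assume "\<one> \<ominus> x \<in> m"
    then have "(\<one> \<ominus> x) \<oplus> x \<in> m" using x by (rule a_closed)
    moreover have "(\<one> \<ominus> x) \<oplus> x = \<one>" using xc by (simp add: minus_eq a_assoc l_neg)
    ultimately show False using one_imp_carrier I_notcarr by auto
  qed
qed

context cring
begin

text \<open>Coefficients are attached to positions and not to elements, which makes repeated entries
  harmless and fits matrices.\<close>

lemma Idl_list:
  assumes xs: "set xs \<subseteq> carrier R"
  shows "Idl (set xs) = {\<Oplus>i\<in>{..<length xs}. r i \<otimes> xs ! i | r. r \<in> {..<length xs} \<rightarrow> carrier R}" (is "_ = ?J")
proof
  have xc: "xs ! i \<in> carrier R" if "i < length xs" for i using xs that nth_mem by blast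
  let ?s = "\<lambda>r. \<Oplus>i\<in>{..<length xs}. r i \<otimes> xs ! i"
  have "ideal ?J R"
  proof (rule idealI[OF ring_axioms])
    show "subgroup ?J (add_monoid R)"
    proof (rule add.subgroupI)
      show "?J \<subseteq> carrier R" using xc by (auto intro!: finsum_closed)
      show "?J \<noteq> {}" by (auto intro: exI[of _ "\<lambda>_. \<zero>"])
    next
      fix a assume "a \<in> ?J"
      then obtain r where r: "r \<in> {..<length xs} \<rightarrow> carrier R" "a = ?s r" by blast
      have rc: "r i \<in> carrier R" if "i < length xs" for i using r that by auto
      have ac: "a \<in> carrier R" unfolding r(2) using xc rc by (intro finsum_closed) auto
      have "?s (\<lambda>i. \<ominus> r i) \<oplus> a = (\<Oplus>i\<in>{..<length xs}. (\<ominus> r i) \<otimes> xs ! i \<oplus> r i \<otimes> xs ! i)"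
        unfolding r(2) using xc rc by (intro finsum_addf[symmetric]) auto
      also have "\<dots> = (\<Oplus>i\<in>{..<length xs}. \<zero>)"
        using xc rc by (intro finsum_cong') (auto simp: l_minus l_neg)
      finally have "?s (\<lambda>i. \<ominus> r i) \<oplus> a = \<zero>" by simp
      then have "\<ominus> a = ?s (\<lambda>i. \<ominus> r i)"
        using ac xc rc by (intro minus_equality) (auto intro!: finsum_closed)
      then show "\<ominus> a \<in> ?J" using rc by (auto intro!: exI[of _ "\<lambda>i. \<ominus> r i"])
      fix b assume "b \<in> ?J"
      then obtain t where t: "t \<in> {..<length xs} \<rightarrow> carrier R" "b = ?s t" by blast
      have tc: "t i \<in> carrier R" if "i < length xs" for i using t that by auto
      have "a \<oplus> b = (\<Oplus>i\<in>{..<length xs}. r i \<otimes> xs ! i \<oplus> t i \<otimes> xs ! i)"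
        unfolding r(2) t(2) using xc rc tc by (intro finsum_addf[symmetric]) auto
      also have "\<dots> = ?s (\<lambda>i. r i \<oplus> t i)"
        using xc rc tc by (intro finsum_cong') (auto simp: l_distr)
      finally show "a \<oplus> b \<in> ?J" using rc tc by (auto intro!: exI[of _ "\<lambda>i. r i \<oplus> t i"])
    qed
    fix a x assume "a \<in> ?J" and x: "x \<in> carrier R"
    then obtain r where r: "r \<in> {..<length xs} \<rightarrow> carrier R" "a = ?s r" by blast
    have rc: "r i \<in> carrier R" if "i < length xs" for i using r that by auto
    have ac: "a \<in> carrier R" unfolding r(2) using xc rc by (intro finsum_closed) auto
    have "x \<otimes> a = (\<Oplus>i\<in>{..<length xs}. x \<otimes> (r i \<otimes> xs ! i))"
      unfolding r(2) using xc rc x by (intro finsum_rdistr) auto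
    also have "\<dots> = ?s (\<lambda>i. x \<otimes> r i)"
      using xc rc x by (intro finsum_cong') (auto simp: m_assoc)
    finally show xa: "x \<otimes> a \<in> ?J" using rc x by (auto intro!: exI[of _ "\<lambda>i. x \<otimes> r i"])
    then show "a \<otimes> x \<in> ?J" using m_comm[OF ac x] by simp
  qed
  moreover have "set xs \<subseteq> ?J"
  proof
    fix x assume "x \<in> set xs"
    then obtain k where k: "k < length xs" "x = xs ! k" by (auto simp: in_set_conv_nth)
    have "?s (\<lambda>i. if k = i then \<one> else \<zero>) = (\<Oplus>i\<in>{..<length xs}. if k = i then xs ! i else \<zero>)"
      using xc by (intro finsum_cong') auto
    also have "\<dots> = xs ! k" using k xc by (intro add.finprod_singleton) auto
    finally show "x \<in> ?J" using k by (auto intro!: exI[of _ "\<lambda>i. if k = i then \<one> else \<zero>"])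
  qed
  ultimately show "Idl (set xs) \<subseteq> ?J" by (rule genideal_minimal)
  interpret I: ideal "Idl (set xs)" R by (rule genideal_ideal[OF xs])
  show "?J \<subseteq> Idl (set xs)"
  proof
    fix a assume "a \<in> ?J"
    then obtain r where r: "r \<in> {..<length xs} \<rightarrow> carrier R" "a = ?s r" by blast
    have "xs ! i \<in> Idl (set xs)" if "i < length xs" for i
      using genideal_self[OF xs] that nth_mem by blast
    then have mem: "r i \<otimes> xs ! i \<in> Idl (set xs)" if "i < length xs" for i
      using r that by (intro I.I_l_closed) auto
    have "(\<Oplus>i\<in>F. r i \<otimes> xs ! i) \<in> Idl (set xs)" if "F \<subseteq> {..<length xs}" for F
      using finite_subset[OF that finite_lessThan] that
    proof (induction F)
      case (insert i F)
      then show ?case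
        using mem I.Icarr by (subst finsum_insert) (auto intro!: I.a_closed)
    qed simp
    then show "a \<in> Idl (set xs)" unfolding r(2) by blast
  qed
qed

text \<open>Nakayama's lemma for R^n modulo W, done by Gaussian elimination. W contains vectors
  congruent to the standard basis modulo m; columns are made exact one after another. The pivots are
  one minus an element of m, hence units.\<close>

lemma nakayama_vectors:
  fixes n :: nat
  defines "\<delta> \<equiv> \<lambda>j l::nat. if j = l then \<one> else \<zero>"
  assumes m: "ideal m R" and unit: "\<And>\<mu>. \<mu> \<in> m \<Longrightarrow> \<one> \<ominus> \<mu> \<in> Units R"
    and W: "\<And>w l. w \<in> W \<Longrightarrow> l < n \<Longrightarrow> w l \<in> carrier R"
    and lin: "\<And>w v c. w \<in> W \<Longrightarrow> v \<in> W \<Longrightarrow> c \<in> carrier R \<Longrightarrow> (\<lambda>l. w l \<oplus> c \<otimes> v l) \<in> W"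
    and gen: "\<And>j. j < n \<Longrightarrow> \<exists>w\<in>W. \<forall>l<n. \<delta> j l \<ominus> w l \<in> m"
    and j: "j < n"
  shows "\<exists>w\<in>W. \<forall>l<n. w l = \<delta> j l"
proof -
  interpret m: ideal m R by fact
  have dc [simp]: "\<delta> j l \<in> carrier R" for j l by (simp add: \<delta>_def)
  \<comment> \<open>k counts the finished columns, taken from the right. The remaining columns keep
    their congruence modulo m.\<close>
  have "\<forall>j<n. \<exists>w\<in>W. \<forall>l<n. (l < n - k \<longrightarrow> \<delta> j l \<ominus> w l \<in> m) \<and> (n - k \<le> l \<longrightarrow> w l = \<delta> j l)" for k
  proof (induction k)
    case 0
    then show ?case using gen by auto
  next
    case (Suc k)
    show ?case
    proof (cases "k < n")
      case False
      then show ?thesis using Suc by simp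
    next
      case True
      define t where "t = n - Suc k"
      have t: "t < n" "n - k = Suc t" using True by (auto simp: t_def)
      obtain v where v: "v \<in> W" "\<And>l. l \<le> t \<Longrightarrow> \<delta> t l \<ominus> v l \<in> m" "\<And>l. t < l \<Longrightarrow> l < n \<Longrightarrow> v l = \<delta> t l"
        using Suc t by (force simp: less_Suc_eq_le Suc_le_eq)
      have vc: "v l \<in> carrier R" if "l < n" for l using W[OF v(1) that] .
      have "v t = \<one> \<ominus> (\<delta> t t \<ominus> v t)"
        using vc[OF t(1)] by (simp add: \<delta>_def minus_eq minus_add a_assoc[symmetric] r_neg)
      then have u: "v t \<in> Units R" using unit[OF v(2)[of t]] by simp
      show ?thesis
      proof (intro allI impI)
        fix j assume "j < n"
        then obtain w where w: "w \<in> W" "\<And>l. l \<le> t \<Longrightarrow> \<delta> j l \<ominus> w l \<in> m" "\<And>l. t < l \<Longrightarrow> l < n \<Longrightarrow> w l = \<delta> j l"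
          using Suc t by (force simp: less_Suc_eq_le Suc_le_eq)
        have wc: "w l \<in> carrier R" if "l < n" for l using W[OF w(1) that] .
        \<comment> \<open>Adding c times the pivot vector v makes column t exact. Since c lies in m,
          the congruences to the left of t persist; to the right of t the vector v is zero, so
          nothing finished is disturbed.\<close>
        define c where "c = (\<delta> j t \<ominus> w t) \<otimes> inv (v t)"
        have cm: "c \<in> m" unfolding c_def using w(2)[of t] u by (intro m.I_r_closed) auto
        have cc: "c \<in> carrier R" using m.Icarr[OF cm] .
        let ?w = "\<lambda>l. w l \<oplus> c \<otimes> v l"
        have "c \<otimes> v t = \<delta> j t \<ominus> w t"
        proof -
          have "(\<delta> j t \<ominus> w t) \<otimes> inv (v t) \<otimes> v t = (\<delta> j t \<ominus> w t) \<otimes> (inv (v t) \<otimes> v t)"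
            using u wc[OF t(1)] vc[OF t(1)] dc by (intro m_assoc) auto
          then show ?thesis
            unfolding c_def using u wc[OF t(1)] dc by (simp add: Units_l_inv)
        qed
        then have wt: "?w t = \<delta> j t"
          using wc[OF t(1)] by (simp add: minus_eq a_lcomm[of "w t"] r_neg)
        have wg: "?w l = \<delta> j l" if "t < l" "l < n" for l
          using v(3)[OF that] w(3)[OF that] that cc by (simp add: \<delta>_def)
        have wl: "\<delta> j l \<ominus> ?w l \<in> m" if "l < t" for l
        proof -
          have ln: "l < n" using that t by simp
          have "\<delta> j l \<ominus> ?w l = (\<delta> j l \<ominus> w l) \<oplus> \<ominus> (c \<otimes> v l)"
            using wc[OF ln] vc[OF ln] cc by (simp add: minus_eq minus_add a_assoc)
          also have "\<dots> \<in> m"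
            using w(2)[of l] that m.I_r_closed[OF cm vc[OF ln]] by (intro m.a_closed m.a_inv_closed) auto
          finally show ?thesis .
        qed
        show "\<exists>w\<in>W. \<forall>l<n. (l < n - Suc k \<longrightarrow> \<delta> j l \<ominus> w l \<in> m) \<and> (n - Suc k \<le> l \<longrightarrow> w l = \<delta> j l)"
        proof (intro bexI[of _ ?w] allI impI conjI)
          show "?w \<in> W" using lin[OF w(1) v(1) cc] .
          show "\<delta> j l \<ominus> ?w l \<in> m" if "l < n - Suc k" for l using wl that by (simp add: t_def)
          show "?w l = \<delta> j l" if "l < n" "n - Suc k \<le> l" for l
            using wt wg[of l] that by (cases "l = t") (auto simp: t_def)
        qed
      qed
    qed
  qed
  from this[of n] show ?thesis using j by auto
qed

end

text \<open>A coefficient outside m is a unit, so the relation would express \<open>xs ! k\<close>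
  through the other entries, and the list without position k would still generate m.\<close>

lemma (in cring) minimal_generators_relation:
  assumes R: "local_ring R m" and xs: "set xs \<subseteq> m" "Idl\<^bsub>R\<^esub> (set xs) = m"
    and min: "\<And>ys. strict_subseq ys xs \<Longrightarrow> Idl\<^bsub>R\<^esub> (set ys) \<noteq> m"
    and c: "\<And>i. i < length xs \<Longrightarrow> c i \<in> carrier R"
    and rel: "(\<Oplus>\<^bsub>R\<^esub>i\<in>{..<length xs}. c i \<otimes>\<^bsub>R\<^esub> xs ! i) = \<zero>\<^bsub>R\<^esub>"
    and k: "k < length xs"
  shows "c k \<in> m"
proof (rule ccontr)
  assume "c k \<notin> m"
  then have u: "c k \<in> Units R" using local_ring_unit[OF R c[OF k]] by simp
  interpret m: maximalideal m R using R by (simp add: local_ring_def)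
  define ys where "ys = take k xs @ drop (Suc k) xs"
  have xsk: "xs = take k xs @ xs ! k # drop (Suc k) xs" using id_take_nth_drop[OF k] .
  have "subseq ys (take k xs @ xs ! k # drop (Suc k) xs)"
    unfolding ys_def by (rule list_emb_append_mono) auto
  then have "subseq ys xs" using xsk by metis
  moreover have "length ys < length xs" using k by (simp add: ys_def)
  ultimately have ss: "strict_subseq ys xs" by (auto simp: strict_subseq_def)
  have "set (take k xs @ xs ! k # drop (Suc k) xs) = insert (xs ! k) (set ys)" by (auto simp: ys_def)
  then have set: "set xs = insert (xs ! k) (set ys)" using xsk by metis
  have xc: "xs ! i \<in> carrier R" if "i < length xs" for i
    using xs that nth_mem m.Icarr by blast
  have yc: "set ys \<subseteq> carrier R" using set xs m.Icarr by auto
  interpret Y: ideal "Idl (set ys)" R by (rule genideal_ideal[OF yc])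
  have ysm: "xs ! i \<in> Idl (set ys)" if "i \<in> {..<length xs} - {k}" for i
  proof -
    have "xs ! i \<in> set ys"
    proof (cases "i < k")
      case True
      then have "xs ! i = take k xs ! i" "i < length (take k xs)" using k by auto
      then show ?thesis unfolding ys_def using nth_mem by (metis UnCI set_append)
    next
      case False
      then have "xs ! i = drop (Suc k) xs ! (i - Suc k)" "i - Suc k < length (drop (Suc k) xs)"
        using that by (auto simp: nth_drop)
      then show ?thesis unfolding ys_def using nth_mem by (metis UnCI set_append)
    qed
    then show ?thesis using genideal_self[OF yc] by blast
  qed
  let ?t = "\<lambda>i. c i \<otimes> xs ! i"
  have tY: "?t i \<in> Idl (set ys)" if "i \<in> {..<length xs} - {k}" for i
    using ysm[OF that] c that by (intro Y.I_l_closed) auto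
  have "(\<Oplus>i\<in>F. ?t i) \<in> Idl (set ys)" if "F \<subseteq> {..<length xs} - {k}" for F
    using finite_subset[OF that] that
  proof (induction F rule: infinite_finite_induct)
    case (insert i F)
    have "?t \<in> F \<rightarrow> carrier R" "?t i \<in> carrier R"
      using insert.prems tY Y.Icarr by blast+
    moreover have "?t i \<in> Idl (set ys)" "(\<Oplus>i\<in>F. ?t i) \<in> Idl (set ys)"
      using insert tY by blast+
    ultimately show ?case using insert.hyps Y.a_closed by simp
  qed auto
  then have rest: "(\<Oplus>i\<in>{..<length xs} - {k}. ?t i) \<in> Idl (set ys)" by blast
  have "(\<Oplus>i\<in>insert k ({..<length xs} - {k}). ?t i) = ?t k \<oplus> (\<Oplus>i\<in>{..<length xs} - {k}. ?t i)"
    using c xc k by (intro finsum_insert) auto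
  moreover have "insert k ({..<length xs} - {k}) = {..<length xs}" using k by auto
  ultimately have "?t k \<oplus> (\<Oplus>i\<in>{..<length xs} - {k}. ?t i) = \<zero>" using rel by simp
  then have "?t k = \<ominus> (\<Oplus>i\<in>{..<length xs} - {k}. ?t i)"
    using c[OF k] xc[OF k] Y.Icarr[OF rest] by (intro minus_equality[symmetric]) auto
  then have "?t k \<in> Idl (set ys)" using rest by simp
  then have "inv (c k) \<otimes> ?t k \<in> Idl (set ys)" by (rule Y.I_l_closed[OF _ Units_inv_closed[OF u]])
  moreover have "inv (c k) \<otimes> ?t k = xs ! k"
    using u c[OF k] xc[OF k] by (simp add: m_assoc[symmetric])
  ultimately have "set xs \<subseteq> Idl (set ys)" using genideal_self[OF yc] set by auto
  then have "m \<subseteq> Idl (set ys)" using genideal_minimal[OF Y.is_ideal] xs(2) by blast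
  moreover have "Idl (set ys) \<subseteq> m" using genideal_minimal[OF m.is_ideal, of "set ys"] xs(1) set by auto
  ultimately show False using min[OF ss] by blast
qed

text \<open>As xs' also generates m, there is a matrix s with xs = s xs' = (s r) xs. The rows of 1 -
  s r are relations between the entries of xs, so by minimality their coefficients lie in m. Thus
  the row space of r contains the standard basis modulo m, and \<open>nakayama_vectors\<close>
  applies to it.\<close>

lemma (in cring) minimal_generators_left_inverse:
  assumes R: "local_ring R m" and xs: "set xs \<subseteq> m" "Idl\<^bsub>R\<^esub> (set xs) = m"
    and min: "\<And>ys. strict_subseq ys xs \<Longrightarrow> Idl\<^bsub>R\<^esub> (set ys) \<noteq> m"
    and xs': "set xs' \<subseteq> m" "Idl\<^bsub>R\<^esub> (set xs') = m"
    and r: "\<And>i l. i < length xs' \<Longrightarrow> l < length xs \<Longrightarrow> r i l \<in> carrier R"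
    and rx: "\<And>i. i < length xs' \<Longrightarrow> xs' ! i = (\<Oplus>\<^bsub>R\<^esub>l\<in>{..<length xs}. r i l \<otimes>\<^bsub>R\<^esub> xs ! l)"
    and j: "j < length xs"
  shows "\<exists>s\<in>{..<length xs'} \<rightarrow> carrier R. \<forall>l<length xs.
           (\<Oplus>\<^bsub>R\<^esub>i\<in>{..<length xs'}. s i \<otimes>\<^bsub>R\<^esub> r i l) = (if j = l then \<one>\<^bsub>R\<^esub> else \<zero>\<^bsub>R\<^esub>)"
proof -
  interpret m: maximalideal m R using R by (simp add: local_ring_def)
  let ?n = "length xs" and ?k = "length xs'"
  have xc: "xs ! l \<in> carrier R" if "l < ?n" for l using xs that nth_mem m.Icarr by blast
  have xc': "set xs' \<subseteq> carrier R" using xs' m.Icarr by blast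
  let ?w = "\<lambda>s l. \<Oplus>i\<in>{..<?k}. s i \<otimes> r i l"
  have wc: "?w s l \<in> carrier R" if "s \<in> {..<?k} \<rightarrow> carrier R" "l < ?n" for s l
    using that r by (intro finsum_closed) auto
  define V where "V = {v. \<exists>s\<in>{..<?k} \<rightarrow> carrier R. \<forall>l<?n. v l = ?w s l}"
  have VI: "v \<in> V" if "s \<in> {..<?k} \<rightarrow> carrier R" "\<And>l. l < ?n \<Longrightarrow> v l = ?w s l" for v s
    using that unfolding V_def by blast
  have "\<exists>v\<in>V. \<forall>l<?n. v l = (if j = l then \<one> else \<zero>)"
  proof (rule nakayama_vectors[where m = m and n = ?n and W = V])
    show "ideal m R" by (rule m.is_ideal)
    show "\<one> \<ominus> \<mu> \<in> Units R" if "\<mu> \<in> m" for \<mu> using local_ring_one_minus[OF R that] .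
    show "w l \<in> carrier R" if "w \<in> V" "l < ?n" for w l using that wc by (auto simp: V_def)
    fix w v c assume w: "w \<in> V" and v: "v \<in> V" and c: "c \<in> carrier R"
    obtain s where s: "s \<in> {..<?k} \<rightarrow> carrier R" "\<And>l. l < ?n \<Longrightarrow> w l = ?w s l" using w unfolding V_def by blast
    obtain t where t: "t \<in> {..<?k} \<rightarrow> carrier R" "\<And>l. l < ?n \<Longrightarrow> v l = ?w t l" using v unfolding V_def by blast
    have sc: "s i \<in> carrier R" and tc: "t i \<in> carrier R" if "i < ?k" for i using s(1) t(1) that by auto
    have "w l \<oplus> c \<otimes> v l = ?w (\<lambda>i. s i \<oplus> c \<otimes> t i) l" if l: "l < ?n" for l
    proof -
      have "c \<otimes> ?w t l = (\<Oplus>i\<in>{..<?k}. c \<otimes> (t i \<otimes> r i l))"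
        using c tc r l by (intro finsum_rdistr) auto
      then have "w l \<oplus> c \<otimes> v l = (\<Oplus>i\<in>{..<?k}. s i \<otimes> r i l \<oplus> c \<otimes> (t i \<otimes> r i l))"
        unfolding s(2)[OF l] t(2)[OF l] using c tc sc r l by (subst finsum_addf) auto
      also have "\<dots> = ?w (\<lambda>i. s i \<oplus> c \<otimes> t i) l"
        using c tc sc r l by (intro finsum_cong') (auto simp: l_distr m_assoc)
      finally show ?thesis .
    qed
    moreover have "(\<lambda>i. s i \<oplus> c \<otimes> t i) \<in> {..<?k} \<rightarrow> carrier R" using c sc tc by auto
    ultimately show "(\<lambda>l. w l \<oplus> c \<otimes> v l) \<in> V" by (intro VI)
  next
    fix j assume j: "j < ?n"
    have "xs ! j \<in> Idl (set xs')" using xs(1) xs'(2) j nth_mem by blast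
    then obtain s where s: "s \<in> {..<?k} \<rightarrow> carrier R" "xs ! j = (\<Oplus>i\<in>{..<?k}. s i \<otimes> xs' ! i)"
      unfolding Idl_list[OF xc'] by blast
    have sc: "s i \<in> carrier R" if "i < ?k" for i using s(1) that by auto
    have "xs ! j = (\<Oplus>i\<in>{..<?k}. \<Oplus>l\<in>{..<?n}. (s i \<otimes> r i l) \<otimes> xs ! l)"
      unfolding s(2)
    proof (rule finsum_cong')
      fix i assume "i \<in> {..<?k}"
      then have i: "i < ?k" by simp
      have "s i \<otimes> xs' ! i = (\<Oplus>l\<in>{..<?n}. s i \<otimes> (r i l \<otimes> xs ! l))"
        unfolding rx[OF i] using sc[OF i] r[OF i] xc by (intro finsum_rdistr) auto
      also have "\<dots> = (\<Oplus>l\<in>{..<?n}. (s i \<otimes> r i l) \<otimes> xs ! l)"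
        using sc[OF i] r[OF i] xc by (intro finsum_cong') (auto simp: m_assoc)
      finally show "s i \<otimes> xs' ! i = (\<Oplus>l\<in>{..<?n}. (s i \<otimes> r i l) \<otimes> xs ! l)" .
    qed (use sc r xc in \<open>auto intro!: finsum_closed\<close>)
    also have "\<dots> = (\<Oplus>l\<in>{..<?n}. \<Oplus>i\<in>{..<?k}. (s i \<otimes> r i l) \<otimes> xs ! l)"
      using sc r xc by (intro finsum_swap) auto
    also have "\<dots> = (\<Oplus>l\<in>{..<?n}. ?w s l \<otimes> xs ! l)"
      using sc r xc by (intro finsum_cong' finsum_ldistr[symmetric]) (auto intro!: finsum_closed)
    finally have eq: "xs ! j = (\<Oplus>l\<in>{..<?n}. ?w s l \<otimes> xs ! l)" .
    let ?d = "\<lambda>l. if j = l then \<one> else \<zero>"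
    have "(\<Oplus>l\<in>{..<?n}. (?d l \<ominus> ?w s l) \<otimes> xs ! l) = (\<Oplus>l\<in>{..<?n}. (if j = l then xs ! l else \<zero>) \<oplus> (\<ominus> \<one>) \<otimes> (?w s l \<otimes> xs ! l))"
      using wc[OF s(1)] xc by (intro finsum_cong') (auto simp: minus_eq l_distr l_minus)
    also have "\<dots> = (\<Oplus>l\<in>{..<?n}. if j = l then xs ! l else \<zero>) \<oplus> (\<Oplus>l\<in>{..<?n}. (\<ominus> \<one>) \<otimes> (?w s l \<otimes> xs ! l))"
      using wc[OF s(1)] xc by (intro finsum_addf) auto
    also have "(\<Oplus>l\<in>{..<?n}. if j = l then xs ! l else \<zero>) = xs ! j"
      using j xc by (intro add.finprod_singleton) auto
    also have "(\<Oplus>l\<in>{..<?n}. (\<ominus> \<one>) \<otimes> (?w s l \<otimes> xs ! l)) = (\<ominus> \<one>) \<otimes> (\<Oplus>l\<in>{..<?n}. ?w s l \<otimes> xs ! l)"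
      using wc[OF s(1)] xc by (intro finsum_rdistr[symmetric]) auto
    also have "\<dots> = \<ominus> (xs ! j)" unfolding eq[symmetric] using xc[OF j] by (simp add: l_minus)
    also have "xs ! j \<oplus> \<ominus> (xs ! j) = \<zero>" using xc[OF j] by (simp add: r_neg)
    finally have "?d l \<ominus> ?w s l \<in> m" if "l < ?n" for l
      using minimal_generators_relation[OF R xs min, of "\<lambda>l. ?d l \<ominus> ?w s l" l] wc[OF s(1)] that by auto
    moreover have "?w s \<in> V" using s(1) by (rule VI) simp
    ultimately show "\<exists>w\<in>V. \<forall>l<?n. ?d l \<ominus> w l \<in> m"
      by (intro bexI[of _ "?w s"] allI impI)
  qed (rule j)
  then obtain v where v: "v \<in> V" "\<forall>l<?n. v l = (if j = l then \<one> else \<zero>)" by (rule bexE)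
  obtain s where s: "s \<in> {..<?k} \<rightarrow> carrier R" "\<forall>l<?n. v l = ?w s l"
    using v(1) unfolding V_def by (elim CollectE bexE)
  show ?thesis
    by (rule bexI[OF _ s(1)]) (metis s(2) v(2))
qed

section \<open>Classes in degree zero\<close>

context comm_dg_ring
begin

abbreviation cls :: "'a \<Rightarrow> 'a set" where
  "cls a \<equiv> coboundaries A 0 +> a"

lemma deg0_sel [simp]:
  "carrier (deg0 A) = grd A 0" "x \<otimes>\<^bsub>deg0 A\<^esub> y = x \<otimes> y" "\<one>\<^bsub>deg0 A\<^esub> = \<one>"
  "x \<oplus>\<^bsub>deg0 A\<^esub> y = x \<oplus> y" "\<zero>\<^bsub>deg0 A\<^esub> = \<zero>"
  by (simp_all add: deg0_def)

lemma ring_deg0: "ring (deg0 A)"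
proof (rule ringI)
  show "abelian_group (deg0 A)"
  proof (rule abelian_groupI)
    fix x assume x: "x \<in> carrier (deg0 A)"
    then show "\<exists>y\<in>carrier (deg0 A). y \<oplus>\<^bsub>deg0 A\<^esub> x = \<zero>\<^bsub>deg0 A\<^esub>"
      using grd_neg[of x 0] l_neg grd_carrier by (intro bexI[of _ "\<ominus> x"]) auto
  qed (auto simp: grd_add grd_zero grd_carrier a_ac)
  show "monoid (deg0 A)"
    by (rule monoidI) (auto simp: grd_mult0 grd_one grd_carrier m_assoc)
qed (auto simp: grd_carrier l_distr r_distr)

lemma coset_deg0: "coboundaries A 0 +>\<^bsub>deg0 A\<^esub> a = cls a"
  by (simp add: a_r_coset_def r_coset_def)

text \<open>Elements of degree 0 are cocycles, so b (d u) = d(b u).\<close>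

lemma ideal_coboundaries: "ideal (coboundaries A 0) (deg0 A)"
proof (rule idealI[OF ring_deg0])
  interpret D: ring "deg0 A" by (rule ring_deg0)
  interpret I: additive_subgroup "coboundaries A 0" A by (rule coboundaries_subgroup)
  show "subgroup (coboundaries A 0) (add_monoid (deg0 A))"
  proof (rule D.add.subgroupI)
    fix x assume x: "x \<in> coboundaries A 0"
    have "\<ominus>\<^bsub>deg0 A\<^esub> x = \<ominus> x"
      using coboundaries_sub[OF x] grd_neg grd_carrier by (intro D.minus_equality) (auto simp: l_neg)
    then show "\<ominus>\<^bsub>deg0 A\<^esub> x \<in> coboundaries A 0" using x by simp
  next
    show "coboundaries A 0 \<noteq> {}" using I.zero_closed by blast
  qed (use coboundaries_sub in auto)
  fix c b assume c: "c \<in> coboundaries A 0" and b: "b \<in> carrier (deg0 A)"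
  then obtain u where u: "u \<in> grd A (-1)" "c = dif A u" by (auto simp: coboundaries_def)
  have b0: "b \<in> grd A 0" using b by simp
  have "dif A (b \<otimes> u) = b \<otimes> c"
    using dif_mult[OF b0 u(1)] u grd_carrier[OF b0] grd_carrier[OF u(1)] by (simp add: dif_grd0[OF b0] sgnpow_def)
  then have "b \<otimes> c \<in> coboundaries A 0"
    using grd_mult0[OF b0 u(1)] unfolding coboundaries_def by (metis diff_0 image_eqI)
  moreover have "c \<otimes> b = b \<otimes> c" using mult_deg0_comm[OF b0] u grd_carrier by simp
  ultimately show "b \<otimes>\<^bsub>deg0 A\<^esub> c \<in> coboundaries A 0" "c \<otimes>\<^bsub>deg0 A\<^esub> b \<in> coboundaries A 0" by auto
qed

lemma cls_hom: "cls \<in> ring_hom (deg0 A) (H0 A)"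
  using ideal.rcos_ring_hom[OF ideal_coboundaries] unfolding H0_def coset_deg0 .

lemma carrier_H0: "carrier (H0 A) = cls ` grd A 0"
  unfolding H0_def FactRing_def A_RCOSETS_def' by (auto simp: coset_deg0)

lemma
  shows cls_closed: "a \<in> grd A 0 \<Longrightarrow> cls a \<in> carrier (H0 A)"
    and cls_add: "a \<in> grd A 0 \<Longrightarrow> b \<in> grd A 0 \<Longrightarrow> cls (a \<oplus> b) = cls a \<oplus>\<^bsub>H0 A\<^esub> cls b"
    and cls_mult: "a \<in> grd A 0 \<Longrightarrow> b \<in> grd A 0 \<Longrightarrow> cls (a \<otimes> b) = cls a \<otimes>\<^bsub>H0 A\<^esub> cls b"
    and cls_one: "cls \<one> = \<one>\<^bsub>H0 A\<^esub>"
  using cls_hom by (auto simp: ring_hom_def)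

lemma cls_zero: "cls \<zero> = \<zero>\<^bsub>H0 A\<^esub>"
  using additive_subgroup.a_subset[OF coboundaries_subgroup] by (simp add: H0_def FactRing_def)

text \<open>Turns an equation in \<open>H0 A\<close> into one in \<open>A\<close> with an explicit
  primitive of degree -1; these primitives become coefficients in the Koszul DG-rings.\<close>

lemma cls_eqD:
  assumes "cls a = cls b" "a \<in> grd A 0" "b \<in> grd A 0"
  shows "\<exists>u\<in>grd A (-1). a = b \<oplus> dif A u"
proof -
  have "a \<in> cls b" using coset_self[OF grd_carrier[OF assms(2)], of 0] assms(1) by simp
  then obtain c where "c \<in> coboundaries A 0" "a = c \<oplus> b"
    using coset_closed[OF grd_carrier[OF assms(3)]] by blast
  then show ?thesis
    using assms(3) grd_carrier by (auto simp: coboundaries_def a_comm)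
qed

lemma cls_dif: "u \<in> grd A (-1) \<Longrightarrow> a \<in> grd A 0 \<Longrightarrow> cls (dif A u \<oplus> a) = cls a"
  by (rule coset_eq) (auto simp: coboundaries_def grd_carrier)

lemma mem_H0:
  assumes "X \<in> carrier (H0 A)" "a \<in> X"
  shows "a \<in> grd A 0" "X = cls a"
proof -
  obtain b where b: "b \<in> grd A 0" "X = cls b" using assms by (auto simp: carrier_H0)
  obtain c where c: "c \<in> coboundaries A 0" "a = c \<oplus> b"
    using coset_closed[OF grd_carrier[OF b(1)]] assms b by blast
  show "a \<in> grd A 0" using c b grd_add coboundaries_sub by blast
  show "X = cls a" unfolding b(2) c(2) using coset_eq(1)[OF grd_carrier[OF b(1)] c(1)] by simp
qed

lemma lifts_cls:
  assumes "lifts as xs" "set xs \<subseteq> carrier (H0 A)"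
  shows "set as \<subseteq> grd A 0" "xs = map cls as"
  using assms unfolding lifts_def
  by (induction as xs rule: list_all2_induct) (auto simp: mem_H0)

lemma cls_finsum:
  assumes "abelian_monoid (H0 A)" "finite I" "\<And>i. i \<in> I \<Longrightarrow> f i \<in> grd A 0"
  shows "cls (finsum A f I) = (\<Oplus>\<^bsub>H0 A\<^esub>i\<in>I. cls (f i))"
  using assms(2,3)
proof (induction I)
  case empty
  interpret abelian_monoid "H0 A" by fact
  show ?case by (simp add: cls_zero)
next
  case (insert i I)
  interpret H: abelian_monoid "H0 A" by fact
  have "f \<in> I \<rightarrow> grd A 0" using insert.prems by auto
  then have "finsum A f I \<in> grd A 0" by (rule grd_finsum)
  moreover have "finsum A f (insert i I) = f i \<oplus> finsum A f I"
    using insert grd_carrier by (intro finsum_insert) auto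
  moreover have "(\<Oplus>\<^bsub>H0 A\<^esub>i\<in>insert i I. cls (f i)) = cls (f i) \<oplus>\<^bsub>H0 A\<^esub> (\<Oplus>\<^bsub>H0 A\<^esub>i\<in>I. cls (f i))"
    using insert cls_closed by (intro H.finsum_insert) auto
  ultimately show ?case using insert by (simp add: cls_add)
qed

section \<open>Maps between Koszul DG-rings\<close>

text \<open>Lifting the coefficients of the ideal membership gives b = (sum of s_l a_l) + d u in
  \<open>A\<close>, and then \<xi> = (sum of s_l e_l) + u has boundary b.\<close>

lemma koszul_boundary:
  assumes H: "cring (H0 A)" and as: "set as \<subseteq> grd A 0" and b: "b \<in> grd A 0"
    and mem: "cls b \<in> Idl\<^bsub>H0 A\<^esub> (set (map cls as))"
  shows "\<exists>\<xi>\<in>grd (koszul A as) (-1). dif (koszul A as) \<xi> = koszul_incl A as b"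
proof -
  interpret H: cring "H0 A" by fact
  interpret K: comm_dg_ring "koszul A as" using dg_ring_koszul[OF as] by (simp add: comm_dg_ring_iff)
  interpret i: dg_ring_hom A "koszul A as" "koszul_incl A as"
    using koszul_incl_hom[OF as] by unfold_locales
  let ?n = "length as"
  have as0: "as ! l \<in> grd A 0" if "l < ?n" for l using as that nth_mem by blast
  have "set (map cls as) \<subseteq> carrier (H0 A)" using as cls_closed by auto
  then obtain r where r: "r \<in> {..<?n} \<rightarrow> carrier (H0 A)" "cls b = (\<Oplus>\<^bsub>H0 A\<^esub>l\<in>{..<?n}. r l \<otimes>\<^bsub>H0 A\<^esub> cls (as ! l))"
  proof -
    assume sub: "set (map cls as) \<subseteq> carrier (H0 A)"
    obtain r where r: "r \<in> {..<?n} \<rightarrow> carrier (H0 A)" "cls b = (\<Oplus>\<^bsub>H0 A\<^esub>l\<in>{..<?n}. r l \<otimes>\<^bsub>H0 A\<^esub> map cls as ! l)"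
      using mem unfolding H.Idl_list[OF sub] by auto
    have "(\<Oplus>\<^bsub>H0 A\<^esub>l\<in>{..<?n}. r l \<otimes>\<^bsub>H0 A\<^esub> map cls as ! l) = (\<Oplus>\<^bsub>H0 A\<^esub>l\<in>{..<?n}. r l \<otimes>\<^bsub>H0 A\<^esub> cls (as ! l))"
      using r(1) as0 cls_closed by (intro H.finsum_cong') auto
    then show ?thesis by (intro that[OF r(1)]) (simp only: r(2))
  qed
  have "\<forall>l. \<exists>s. l < ?n \<longrightarrow> s \<in> grd A 0 \<and> r l = cls s"
    using r(1) by (auto simp: carrier_H0)
  then obtain s where s: "\<And>l. l < ?n \<Longrightarrow> s l \<in> grd A 0" "\<And>l. l < ?n \<Longrightarrow> r l = cls (s l)" by metis
  let ?e = "\<Oplus>l\<in>{..<?n}. s l \<otimes> as ! l"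
  have e: "?e \<in> grd A 0" using s as0 by (intro grd_finsum) (auto intro: grd_mult0)
  have "cls ?e = (\<Oplus>\<^bsub>H0 A\<^esub>l\<in>{..<?n}. cls (s l \<otimes> as ! l))"
    using s as0 by (intro cls_finsum[OF H.abelian_monoid_axioms]) (auto intro: grd_mult0)
  also have "\<dots> = cls b"
    unfolding r(2)
  proof (rule H.finsum_cong')
    show "(\<lambda>l. r l \<otimes>\<^bsub>H0 A\<^esub> cls (as ! l)) \<in> {..<?n} \<rightarrow> carrier (H0 A)"
      using r(1) as0 cls_closed by auto
  qed (use s as0 in \<open>simp_all add: cls_mult\<close>)
  finally have "cls b = cls ?e" by simp
  then obtain u where u: "u \<in> grd A (-1)" "b = ?e \<oplus> dif A u" using cls_eqD[OF _ b e] by blast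
  let ?t = "\<lambda>l. koszul_incl A as (s l) \<otimes>\<^bsub>koszul A as\<^esub> koszul_gen A as l"
  have sK: "koszul_incl A as (s l) \<in> grd (koszul A as) 0" if "l < ?n" for l
    using s(1)[OF that] by (rule i.f_grd)
  have t: "?t l \<in> grd (koszul A as) (-1)" if "l < ?n" for l
    using K.grd_mult0[OF sK[OF that] koszul_gen_grd] .
  have dt: "dif (koszul A as) (?t l) = koszul_incl A as (s l \<otimes> as ! l)" if "l < ?n" for l
  proof -
    have "dif (koszul A as) (?t l) = koszul_incl A as (s l) \<otimes>\<^bsub>koszul A as\<^esub> koszul_incl A as (as ! l)"
      using K.dif_mult[OF sK[OF that] koszul_gen_grd, of l] K.grd_carrier[OF sK[OF that]]
        K.grd_carrier[OF koszul_gen_grd] i.f_closed[OF grd_carrier[OF as0[OF that]]]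
      by (simp add: K.dif_grd0[OF sK[OF that]] koszul_gen_dif[OF as that] sgnpow_def del: koszul_sel)
    then show ?thesis
      by (simp only: i.f_mult[OF grd_carrier[OF s(1)[OF that]] grd_carrier[OF as0[OF that]]])
  qed
  let ?\<xi> = "(\<Oplus>\<^bsub>koszul A as\<^esub>l\<in>{..<?n}. ?t l) \<oplus>\<^bsub>koszul A as\<^esub> koszul_incl A as u"
  have tc: "?t l \<in> carrier (koszul A as)" if "l < ?n" for l using K.grd_carrier[OF t[OF that]] .
  have sum: "(\<Oplus>\<^bsub>koszul A as\<^esub>l\<in>{..<?n}. ?t l) \<in> grd (koszul A as) (-1)"
    using t by (intro K.grd_finsum) auto
  have "?\<xi> \<in> grd (koszul A as) (-1)"
    using sum i.f_grd[OF u(1)] by (rule K.grd_add)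
  moreover have "dif (koszul A as) ?\<xi> = koszul_incl A as b"
  proof -
    have "dif (koszul A as) ?\<xi> = dif (koszul A as) (\<Oplus>\<^bsub>koszul A as\<^esub>l\<in>{..<?n}. ?t l) \<oplus>\<^bsub>koszul A as\<^esub> koszul_incl A as (dif A u)"
      using K.dif_add[OF K.grd_carrier[OF sum] i.f_closed[OF grd_carrier[OF u(1)]]] i.f_dif[OF grd_carrier[OF u(1)]] by simp
    also have "dif (koszul A as) (\<Oplus>\<^bsub>koszul A as\<^esub>l\<in>{..<?n}. ?t l) = (\<Oplus>\<^bsub>koszul A as\<^esub>l\<in>{..<?n}. dif (koszul A as) (?t l))"
      using tc by (intro K.dif_finsum) blast
    also have "\<dots> = (\<Oplus>\<^bsub>koszul A as\<^esub>l\<in>{..<?n}. koszul_incl A as (s l \<otimes> as ! l))"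
    proof (rule K.finsum_cong')
      show "(\<lambda>l. koszul_incl A as (s l \<otimes> as ! l)) \<in> {..<?n} \<rightarrow> carrier (koszul A as)"
        using s(1) as0 grd_carrier i.f_closed by (intro Pi_I) (metis lessThan_iff m_closed)
    qed (use dt in auto)
    also have "\<dots> = koszul_incl A as ?e"
      using s(1)[THEN grd_carrier] as0[THEN grd_carrier] by (intro i.f_finsum[symmetric]) auto
    also have "koszul_incl A as ?e \<oplus>\<^bsub>koszul A as\<^esub> koszul_incl A as (dif A u) = koszul_incl A as b"
      unfolding u(2) using grd_carrier[OF e] grd_carrier[OF u(1)] by (intro i.f_add[symmetric]) auto
    finally show ?thesis .
  qed
  ultimately show ?thesis by blast
qed

text \<open>For every j it suffices to find \<xi> of degree -1 with boundary \<open>as ! j\<close>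
  whose image under \<phi> is e_j up to a coboundary. Then \<open>koszul_lift\<close> yields \<psi>,
  and \<open>koszul_homotopy\<close> compares \<open>\<phi> \<circ> \<psi>\<close> with the
  identity.\<close>

lemma koszul_lift_right_inverse:
  assumes H: "local_ring (H0 A) m" and as: "set as \<subseteq> grd A 0" and as': "set as' \<subseteq> grd A 0"
    and gen: "set (map cls as) \<subseteq> m" "Idl\<^bsub>H0 A\<^esub> (set (map cls as)) = m"
    and gen': "set (map cls as') \<subseteq> m" "Idl\<^bsub>H0 A\<^esub> (set (map cls as')) = m"
    and min: "\<And>ys. strict_subseq ys (map cls as) \<Longrightarrow> Idl\<^bsub>H0 A\<^esub> (set ys) \<noteq> m"
    and \<phi>: "\<phi> \<in> dg_hom (koszul A as') (koszul A as)"
    and \<phi>_incl: "\<And>x. x \<in> carrier A \<Longrightarrow> \<phi> (koszul_incl A as' x) = koszul_incl A as x"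
  shows "\<exists>\<psi>\<in>dg_hom (koszul A as) (koszul A as').
    (\<forall>x\<in>carrier A. \<psi> (koszul_incl A as x) = koszul_incl A as' x) \<and>
    (\<forall>n. \<forall>X\<in>coh_set (koszul A as) n. coh_map (koszul A as) (\<phi> \<circ> \<psi>) n X = X)"
proof -
  interpret H: cring "H0 A" using H by (simp add: local_ring_def)
  let ?K = "koszul A as" and ?K' = "koszul A as'"
  let ?n = "length as" and ?k = "length as'"
  interpret K: comm_dg_ring ?K using dg_ring_koszul[OF as] by (simp add: comm_dg_ring_iff)
  interpret K': comm_dg_ring ?K' using dg_ring_koszul[OF as'] by (simp add: comm_dg_ring_iff)
  interpret i: dg_ring_hom A ?K "koszul_incl A as" using koszul_incl_hom[OF as] by unfold_locales
  interpret i': dg_ring_hom A ?K' "koszul_incl A as'" using koszul_incl_hom[OF as'] by unfold_locales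
  interpret \<phi>: dg_ring_hom ?K' ?K \<phi> using \<phi> by unfold_locales
  have as0: "as ! l \<in> grd A 0" if "l < ?n" for l using as that nth_mem by blast
  have as0': "as' ! l \<in> grd A 0" if "l < ?k" for l using as' that nth_mem by blast
  define y where "y i = \<phi> (koszul_gen A as' i)" for i
  have y: "y i \<in> grd ?K (-1)" for i unfolding y_def by (rule \<phi>.f_grd[OF koszul_gen_grd])
  \<comment> \<open>The coefficient of e_l in the image of the i-th variable. For degree reasons,
    the only other nonzero coefficient of \<open>y i\<close> can be the one at {}.\<close>
  define r where "r i l = y i {l}" for i l
  have r: "r i l \<in> grd A 0" if "l < ?n" for i l
    using PiE_mem[OF y[of i, unfolded koszul_sel], of "{l}"] that by (simp add: r_def)
  have yc: "y i {} \<in> grd A (-1)" for i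
    using PiE_mem[OF y[of i, unfolded koszul_sel], of "{}"] by simp
  \<comment> \<open>The coefficient at {} of the boundary of \<open>y i\<close> shows that r
    expresses as' through as up to coboundaries, so the classes of r form the transition matrix
    required by \<open>minimal_generators_left_inverse\<close>.\<close>
  have rel: "as' ! i = dif A (y i {}) \<oplus> (\<Oplus>l\<in>{..<?n}. r i l \<otimes> as ! l)" if i: "i < ?k" for i
  proof -
    have "dif ?K (y i) = koszul_incl A as (as' ! i)"
      unfolding y_def \<phi>.f_dif[OF K'.grd_carrier[OF koszul_gen_grd], symmetric] koszul_gen_dif[OF as' i]
      using \<phi>_incl[OF grd_carrier[OF as0'[OF i]]] .
    then have "as' ! i = dif ?K (y i) {}" by (simp add: koszul_incl_apply)
    also have "\<dots> = dif A (y i {}) \<oplus> (\<Oplus>l\<in>{..<?n}. as ! l \<otimes> y i {l})"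
      by (simp add: koszul_dif sgnpow_even)
    also have "(\<Oplus>l\<in>{..<?n}. as ! l \<otimes> y i {l}) = (\<Oplus>l\<in>{..<?n}. r i l \<otimes> as ! l)"
      using r[THEN grd_carrier] as0[THEN grd_carrier] mult_deg0_comm[OF as0]
      by (intro finsum_cong') (auto simp: r_def[symmetric])
    finally show ?thesis .
  qed
  have rel_cls: "map cls as' ! i = (\<Oplus>\<^bsub>H0 A\<^esub>l\<in>{..<length (map cls as)}. cls (r i l) \<otimes>\<^bsub>H0 A\<^esub> map cls as ! l)"
    if i: "i < length (map cls as')" for i
  proof -
    have ik: "i < ?k" using i by simp
    have s: "(\<Oplus>l\<in>{..<?n}. r i l \<otimes> as ! l) \<in> grd A 0"
      using r as0 by (intro grd_finsum) (auto intro: grd_mult0)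
    have "map cls as' ! i = cls (\<Oplus>l\<in>{..<?n}. r i l \<otimes> as ! l)"
      using ik rel[OF ik] cls_dif[OF yc s] by simp
    also have "\<dots> = (\<Oplus>\<^bsub>H0 A\<^esub>l\<in>{..<?n}. cls (r i l \<otimes> as ! l))"
      using r as0 by (intro cls_finsum[OF H.abelian_monoid_axioms]) (auto intro: grd_mult0)
    also have "\<dots> = (\<Oplus>\<^bsub>H0 A\<^esub>l\<in>{..<?n}. cls (r i l) \<otimes>\<^bsub>H0 A\<^esub> map cls as ! l)"
      using r as0 by (intro H.finsum_cong') (auto simp: cls_mult intro!: H.m_closed cls_closed)
    finally show ?thesis by simp
  qed
  have "\<exists>\<xi>\<in>grd ?K' (-1). dif ?K' \<xi> = koszul_incl A as' (as ! j) \<and>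
      (\<exists>\<zeta>\<in>grd ?K (-2). \<phi> \<xi> = koszul_gen A as j \<oplus>\<^bsub>?K\<^esub> dif ?K \<zeta>)" if j: "j < ?n" for j
  proof -
    obtain s where s: "s \<in> {..<?k} \<rightarrow> carrier (H0 A)"
      "\<And>l. l < ?n \<Longrightarrow> (\<Oplus>\<^bsub>H0 A\<^esub>i\<in>{..<?k}. s i \<otimes>\<^bsub>H0 A\<^esub> cls (r i l)) = (if j = l then \<one>\<^bsub>H0 A\<^esub> else \<zero>\<^bsub>H0 A\<^esub>)"
      using H.minimal_generators_left_inverse[OF H gen min gen' _ rel_cls, of j] r cls_closed j by auto
    have "\<forall>i. \<exists>t. i < ?k \<longrightarrow> t \<in> grd A 0 \<and> s i = cls t"
      using s(1) by (auto simp: carrier_H0)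
    then obtain t where t: "\<And>i. i < ?k \<Longrightarrow> t i \<in> grd A 0" "\<And>i. i < ?k \<Longrightarrow> s i = cls (t i)" by metis
    have "\<exists>u\<in>grd A (-1). (\<Oplus>i\<in>{..<?k}. t i \<otimes> r i l) = (if j = l then \<one> else \<zero>) \<oplus> dif A u" if l: "l < ?n" for l
    proof (rule cls_eqD)
      have "cls (\<Oplus>i\<in>{..<?k}. t i \<otimes> r i l) = (\<Oplus>\<^bsub>H0 A\<^esub>i\<in>{..<?k}. cls (t i \<otimes> r i l))"
        using t r[OF l] by (intro cls_finsum[OF H.abelian_monoid_axioms]) (auto intro: grd_mult0)
      also have "\<dots> = (\<Oplus>\<^bsub>H0 A\<^esub>i\<in>{..<?k}. s i \<otimes>\<^bsub>H0 A\<^esub> cls (r i l))"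
        using t r[OF l] by (intro H.finsum_cong') (auto simp: cls_mult intro!: H.m_closed cls_closed)
      also have "\<dots> = cls (if j = l then \<one> else \<zero>)"
        unfolding s(2)[OF l] by (simp add: cls_one cls_zero)
      finally show "cls (\<Oplus>i\<in>{..<?k}. t i \<otimes> r i l) = cls (if j = l then \<one> else \<zero>)" .
    qed (use t r[OF l] grd_one grd_zero in \<open>auto intro!: grd_finsum grd_mult0\<close>)
    then obtain u where u: "\<And>l. l < ?n \<Longrightarrow> u l \<in> grd A (-1)"
      "\<And>l. l < ?n \<Longrightarrow> (\<Oplus>i\<in>{..<?k}. t i \<otimes> r i l) = (if j = l then \<one> else \<zero>) \<oplus> dif A (u l)"
      by metis
    \<comment> \<open>The combination of variables prescribed by row j of the left inverse. Its
      image has the coefficients of e_j at all singletons, except for the coboundaries of the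
      u_l.\<close>
    define p where "p = (\<Oplus>\<^bsub>?K'\<^esub>i\<in>{..<?k}. koszul_incl A as' (t i) \<otimes>\<^bsub>?K'\<^esub> koszul_gen A as' i)"
    have tK: "koszul_incl A as' (t i) \<otimes>\<^bsub>?K'\<^esub> koszul_gen A as' i \<in> grd ?K' (-1)" if "i < ?k" for i
      using K'.grd_mult0[OF i'.f_grd[OF t(1)[OF that]] koszul_gen_grd] .
    have p: "p \<in> grd ?K' (-1)" unfolding p_def using tK by (intro K'.grd_finsum) auto
    have \<phi>p: "\<phi> p = (\<Oplus>\<^bsub>?K\<^esub>i\<in>{..<?k}. koszul_incl A as (t i) \<otimes>\<^bsub>?K\<^esub> y i)"
    proof -
      have "\<phi> p = (\<Oplus>\<^bsub>?K\<^esub>i\<in>{..<?k}. \<phi> (koszul_incl A as' (t i) \<otimes>\<^bsub>?K'\<^esub> koszul_gen A as' i))"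
        unfolding p_def using tK K'.grd_carrier by (intro \<phi>.f_finsum) blast
      also have "\<dots> = (\<Oplus>\<^bsub>?K\<^esub>i\<in>{..<?k}. koszul_incl A as (t i) \<otimes>\<^bsub>?K\<^esub> y i)"
      proof (rule K.finsum_cong')
        show "(\<lambda>i. koszul_incl A as (t i) \<otimes>\<^bsub>?K\<^esub> y i) \<in> {..<?k} \<rightarrow> carrier ?K"
          using t(1) grd_carrier i.f_closed y K.grd_carrier by (intro Pi_I K.m_closed) blast+
        fix i assume "i \<in> {..<?k}"
        then have tc: "t i \<in> carrier A" using t(1) grd_carrier by blast
        show "\<phi> (koszul_incl A as' (t i) \<otimes>\<^bsub>?K'\<^esub> koszul_gen A as' i) = koszul_incl A as (t i) \<otimes>\<^bsub>?K\<^esub> y i"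
          unfolding \<phi>.f_mult[OF i'.f_closed[OF tc] K'.grd_carrier[OF koszul_gen_grd]] \<phi>_incl[OF tc] y_def ..
      qed simp
      finally show ?thesis .
    qed
    have \<phi>pl: "\<phi> p {l} = (if j = l then \<one> else \<zero>) \<oplus> dif A (u l)" if l: "l < ?n" for l
    proof -
      have S: "{l} \<subseteq> {..<?n}" using l by simp
      have yK: "y i \<in> carrier ?K" for i using K.grd_carrier[OF y] .
      have "\<phi> p {l} = (\<Oplus>i\<in>{..<?k}. (koszul_incl A as (t i) \<otimes>\<^bsub>?K\<^esub> y i) {l})"
        unfolding \<phi>p using t(1) grd_carrier i.f_closed yK S
        by (intro koszul_finsum_apply Pi_I K.m_closed) blast+
      also have "\<dots> = (\<Oplus>i\<in>{..<?k}. t i \<otimes> r i l)"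
      proof (rule finsum_cong')
        show "(\<lambda>i. t i \<otimes> r i l) \<in> {..<?k} \<rightarrow> carrier A"
          using t(1)[THEN grd_carrier] r[OF l, THEN grd_carrier] by auto
        fix i assume "i \<in> {..<?k}"
        then have t0: "t i \<in> grd A 0" using t(1) by simp
        show "(koszul_incl A as (t i) \<otimes>\<^bsub>?K\<^esub> y i) {l} = t i \<otimes> r i l"
          unfolding koszul_incl_mult[OF grd_carrier[OF t0] yK S] degsgn_deg0[OF dg_group t0] r_def ..
      qed simp
      finally show ?thesis using u(2)[OF l] by simp
    qed
    \<comment> \<open>Chosen to remove these coboundaries. The minus sign compensates the factor
      (-1)^(card S) in the Koszul differential, where \<open>card S\<close> = 1. The boundary of
      \<zeta> may also have a coefficient at {}, which is taken care of by w.\<close>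
    define \<zeta> where "\<zeta> = (\<lambda>S\<in>Pow {..<?n}. if card S = 1 then \<ominus> u (the_elem S) else \<zero>)"
    have \<zeta>: "\<zeta> \<in> grd ?K (-2)"
    proof -
      have "\<ominus> u (the_elem S) \<in> grd A (-1)" if "S \<subseteq> {..<?n}" "card S = 1" for S
        using that u(1) grd_neg by (auto simp: card_1_singleton_iff)
      then show ?thesis using grd_zero by (auto simp: \<zeta>_def)
    qed
    have d\<zeta>: "dif ?K \<zeta> {l} = dif A (u l)" if l: "l < ?n" for l
    proof -
      have S: "{l} \<subseteq> {..<?n}" using l by simp
      have uc: "u l \<in> carrier A" using u(1)[OF l] grd_carrier by blast
      have "(\<Oplus>i\<in>{..<?n} - {l}. sgnpow A (int (card {j \<in> {l}. j < i})) (as ! i \<otimes> \<zeta> (insert i {l}))) = (\<Oplus>i\<in>{..<?n} - {l}. \<zero>)"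
        using l as0[THEN grd_carrier] by (intro finsum_cong') (auto simp: \<zeta>_def sgnpow_def)
      then show ?thesis
        unfolding koszul_dif[OF S] using l uc by (simp add: \<zeta>_def sgnpow_def dif_neg)
    qed
    have d\<zeta>g: "dif ?K \<zeta> \<in> grd ?K (-1)" using K.dif_grd[OF \<zeta>] by simp
    have gg: "koszul_gen A as j \<in> grd ?K (-1)" by (rule koszul_gen_grd)
    have \<phi>pg: "\<phi> p \<in> grd ?K (-1)" by (rule \<phi>.f_grd[OF p])
    note car = K.grd_carrier[OF d\<zeta>g] K.grd_carrier[OF gg] K.grd_carrier[OF \<phi>pg]
    \<comment> \<open>The remaining error vanishes at all singletons, so it comes from
      \<open>A\<close> by \<open>koszul_grd_neg1\<close>. As \<phi> fixes the elements of
      \<open>A\<close>, it can be corrected before \<phi> is applied, namely in \<xi> below.\<close>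
    define w where "w = \<phi> p \<ominus>\<^bsub>?K\<^esub> (koszul_gen A as j \<oplus>\<^bsub>?K\<^esub> dif ?K \<zeta>)"
    have w: "w \<in> grd ?K (-1)"
      unfolding w_def by (intro K.grd_minus K.grd_add \<phi>pg gg d\<zeta>g)
    have "w {l} = \<zero>" if l: "l < ?n" for l
    proof -
      have S: "{l} \<subseteq> {..<?n}" using l by simp
      have uc: "dif A (u l) \<in> carrier A" using u(1)[OF l] grd_carrier by simp
      have "w {l} = \<phi> p {l} \<ominus> (koszul_gen A as j {l} \<oplus> dif ?K \<zeta> {l})"
        unfolding w_def koszul_minus_apply[OF as car(3) K.a_closed[OF car(2,1)] S] using S by simp
      also have "\<dots> = \<zero>"
        unfolding \<phi>pl[OF l] d\<zeta>[OF l] koszul_gen_apply[OF S] using uc by (auto simp: minus_eq r_neg)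
      finally show ?thesis .
    qed
    then have w0: "w = koszul_incl A as (w {})" by (rule koszul_grd_neg1[OF w])
    have wg: "w {} \<in> grd A (-1)" using PiE_mem[OF w[unfolded koszul_sel], of "{}"] by simp
    note wc = grd_carrier[OF wg]
    define \<xi> where "\<xi> = p \<ominus>\<^bsub>?K'\<^esub> koszul_incl A as' (w {})"
    have \<xi>: "\<xi> \<in> grd ?K' (-1)"
      unfolding \<xi>_def by (intro K'.grd_minus p i'.f_grd[OF wg])
    have "\<phi> \<xi> = \<phi> p \<ominus>\<^bsub>?K\<^esub> w"
      unfolding \<xi>_def \<phi>.f_minus[OF K'.grd_carrier[OF p] i'.f_closed[OF wc]] \<phi>_incl[OF wc] w0[symmetric] ..
    also have "\<dots> = koszul_gen A as j \<oplus>\<^bsub>?K\<^esub> dif ?K \<zeta>"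
    proof -
      define P where "P = \<phi> p"
      define Q where "Q = koszul_gen A as j \<oplus>\<^bsub>?K\<^esub> dif ?K \<zeta>"
      have PQ: "P \<in> carrier ?K" "Q \<in> carrier ?K"
        unfolding P_def Q_def using car K.a_closed by blast+
      have "P \<ominus>\<^bsub>?K\<^esub> (P \<ominus>\<^bsub>?K\<^esub> Q) = Q"
        using PQ by (simp add: K.minus_eq K.minus_add K.a_assoc[symmetric] K.r_neg del: koszul_sel)
      then show ?thesis unfolding w_def P_def Q_def .
    qed
    finally have \<phi>\<xi>: "\<phi> \<xi> = koszul_gen A as j \<oplus>\<^bsub>?K\<^esub> dif ?K \<zeta>" .
    \<comment> \<open>The boundary of \<xi> has degree 0 and hence comes from some b in
      \<open>A\<close>. Applying \<phi> determines b: the boundary of e_j + d \<zeta> is the image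
      of \<open>as ! j\<close>.\<close>
    have "dif ?K' \<xi> \<in> grd ?K' 0" using K'.dif_grd[OF \<xi>] by simp
    then obtain b where b: "b \<in> grd A 0" "dif ?K' \<xi> = koszul_incl A as' b"
      using koszul_grd0 by blast
    have "koszul_incl A as b = dif ?K (\<phi> \<xi>)"
      using \<phi>_incl[OF grd_carrier[OF b(1)]] b(2) \<phi>.f_dif[OF K'.grd_carrier[OF \<xi>]] by simp
    also have "\<dots> = dif ?K (koszul_gen A as j) \<oplus>\<^bsub>?K\<^esub> \<zero>\<^bsub>?K\<^esub>"
      unfolding \<phi>\<xi> K.dif_add[OF car(2,1)] K.dif_dif[OF K.grd_carrier[OF \<zeta>]] ..
    also have "\<dots> = koszul_incl A as (as ! j)"
      unfolding koszul_gen_dif[OF as j] by (rule K.r_zero[OF i.f_closed[OF grd_carrier[OF as0[OF j]]]])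
    finally have "koszul_incl A as b {} = koszul_incl A as (as ! j) {}" by (rule fun_cong)
    then have "b = as ! j" by (simp add: koszul_incl_apply)
    then show ?thesis using \<xi> b(2) \<zeta> \<phi>\<xi> by blast
  qed
  then have "\<forall>j. \<exists>\<xi>. j < ?n \<longrightarrow> \<xi> \<in> grd ?K' (-1) \<and> dif ?K' \<xi> = koszul_incl A as' (as ! j) \<and>
      (\<exists>\<zeta>\<in>grd ?K (-2). \<phi> \<xi> = koszul_gen A as j \<oplus>\<^bsub>?K\<^esub> dif ?K \<zeta>)" by blast
  then obtain \<xi> where \<xi>: "\<And>j. j < ?n \<Longrightarrow> \<xi> j \<in> grd ?K' (-1)"
    "\<And>j. j < ?n \<Longrightarrow> dif ?K' (\<xi> j) = koszul_incl A as' (as ! j)"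
    "\<And>j. j < ?n \<Longrightarrow> \<exists>\<zeta>\<in>grd ?K (-2). \<phi> (\<xi> j) = koszul_gen A as j \<oplus>\<^bsub>?K\<^esub> dif ?K \<zeta>"
    by metis
  obtain \<psi> where \<psi>: "\<psi> \<in> dg_hom ?K ?K'" "\<And>x. x \<in> carrier A \<Longrightarrow> \<psi> (koszul_incl A as x) = koszul_incl A as' x"
    "\<And>j. j < ?n \<Longrightarrow> \<psi> (koszul_gen A as j) = \<xi> j"
    using koszul_lift[OF K'.dg_ring i'.hom as \<xi>(1,2)] by blast
  have \<phi>\<psi>: "\<phi> \<circ> \<psi> \<in> dg_hom ?K ?K" by (rule dg_hom_comp[OF \<psi>(1) \<phi>])
  obtain h where h: "dg_homotopy ?K ?K (koszul_incl A as ` grd A 0) (\<phi> \<circ> \<psi>) (\<lambda>x. x) h"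
    using koszul_homotopy[OF K.dg_ring as \<phi>\<psi> id_dg_hom] \<psi> \<phi>_incl \<xi>(3) by auto
  have "coh_map ?K (\<phi> \<circ> \<psi>) n X = X" if "X \<in> coh_set ?K n" for n X
    using homotopy_coh_map[OF K.dg_ring K.dg_ring \<phi>\<psi> id_dg_hom h that] coh_map_id[OF K.dg_ring that] by simp
  then show ?thesis using \<psi>(1,2) by blast
qed

end

section \<open>Comparison maps and the two assertions of the theorem\<close>

lemma koszul_map:
  fixes f :: "'a \<Rightarrow> 'b"
  assumes A: "dg_ring A" and B: "dg_ring B" and H: "cring (H0 B)" and f: "f \<in> dg_hom A B"
    and as: "set as \<subseteq> grd A 0" and bs: "set bs \<subseteq> grd B 0"
    and mem: "\<And>a. a \<in> set as \<Longrightarrow>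
      coboundaries B 0 +>\<^bsub>B\<^esub> f a \<in> Idl\<^bsub>H0 B\<^esub> (set (map ((+>\<^bsub>B\<^esub>) (coboundaries B 0)) bs))"
  shows "\<exists>g\<in>dg_hom (koszul A as) (koszul B bs). \<forall>x\<in>carrier A. g (koszul_incl A as x) = koszul_incl B bs (f x)"
proof -
  interpret A: comm_dg_ring A using A by (simp add: comm_dg_ring_iff)
  interpret B: comm_dg_ring B using B by (simp add: comm_dg_ring_iff)
  interpret f: dg_ring_hom A B f using f by unfold_locales
  have "\<exists>\<xi>\<in>grd (koszul B bs) (-1). dif (koszul B bs) \<xi> = (koszul_incl B bs \<circ> f) (as ! i)" if "i < length as" for i
    unfolding comp_apply using that as mem nth_mem by (intro B.koszul_boundary[OF H bs] f.f_grd) blast+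
  then have "\<forall>i. \<exists>\<xi>. i < length as \<longrightarrow> \<xi> \<in> grd (koszul B bs) (-1) \<and>
      dif (koszul B bs) \<xi> = (koszul_incl B bs \<circ> f) (as ! i)" by meson
  then obtain \<xi> where \<xi>: "\<And>i. i < length as \<Longrightarrow> \<xi> i \<in> grd (koszul B bs) (-1)"
    "\<And>i. i < length as \<Longrightarrow> dif (koszul B bs) (\<xi> i) = (koszul_incl B bs \<circ> f) (as ! i)" by metis
  have hom: "koszul_incl B bs \<circ> f \<in> dg_hom A (koszul B bs)"
    by (rule dg_hom_comp[OF f B.koszul_incl_hom[OF bs]])
  show ?thesis
    using A.koszul_lift[OF B.dg_ring_koszul[OF bs] hom as \<xi>] by auto
qed

lemma alg_qis_ho_iso:
  assumes f: "f \<in> alg_qis A X Y"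
  shows "ho_iso A X Y"
  unfolding ho_iso_def
proof (intro exI conjI)
  have hom: "f \<in> alg_hom A X Y" and alg: "dg_alg A X" "dg_alg A Y"
    using f by (auto simp: alg_qis_def alg_hom_def)
  show "zigzag A X [Mor X f Y] Y" by (intro zigzag.intros hom alg)
  show "zigzag A Y [Inv Y f X] X" by (intro zigzag.intros f alg)
  show "zigzag_eq A X X ([Mor X f Y] @ [Inv Y f X]) []"
    using zigzag_eq_inv_right[OF f] by simp
  show "zigzag_eq A Y Y ([Inv Y f X] @ [Mor X f Y]) []"
    using zigzag_eq_inv_left[OF f] by simp
qed

lemma regular_system_lifts:
  assumes A: "dg_ring A" and m: "local_ring (H0 A) m" and xs: "set xs \<subseteq> m" and as: "lifts as xs"
  shows "set as \<subseteq> grd A 0" "xs = map ((+>\<^bsub>A\<^esub>) (coboundaries A 0)) as"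
proof -
  interpret A: comm_dg_ring A using A by (simp add: comm_dg_ring_iff)
  interpret maximalideal m "H0 A" using m by (simp add: local_ring_def)
  have "set xs \<subseteq> carrier (H0 A)" using xs Icarr by blast
  then show "set as \<subseteq> grd A 0" "xs = map ((+>\<^bsub>A\<^esub>) (coboundaries A 0)) as"
    using A.lifts_cls[OF as] by auto
qed

text \<open>A single quasi-isomorphism of \<open>A\<close>-algebras suffices for an isomorphism in
  the homotopy category. It is bijective on cohomology because it has a left inverse and a right
  inverse there, each induced by a map of DG-rings.\<close>

lemma koszul_ho_iso:
  fixes A :: "'a dg"
  assumes A: "noetherian_local_dg A m"
    and xs: "regular_system_of_parameters A m xs" and ys: "regular_system_of_parameters A m ys"
    and as: "lifts as xs" and bs: "lifts bs ys"
  shows "ho_iso A (koszul_alg A as) (koszul_alg A bs)"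
proof -
  have dgA: "dg_ring A" and loc: "local_ring (H0 A) m"
    using A by (auto simp: noetherian_local_dg_def noetherian_dg_def)
  interpret A: comm_dg_ring A using dgA by (simp add: comm_dg_ring_iff)
  have H: "cring (H0 A)" using loc by (simp add: local_ring_def)
  have x: "set xs \<subseteq> m" "Idl\<^bsub>H0 A\<^esub> (set xs) = m" "\<And>zs. strict_subseq zs xs \<Longrightarrow> Idl\<^bsub>H0 A\<^esub> (set zs) \<noteq> m"
    and y: "set ys \<subseteq> m" "Idl\<^bsub>H0 A\<^esub> (set ys) = m" "\<And>zs. strict_subseq zs ys \<Longrightarrow> Idl\<^bsub>H0 A\<^esub> (set zs) \<noteq> m"
    using xs ys by (auto simp: regular_system_of_parameters_def)
  note a = regular_system_lifts[OF dgA loc x(1) as] and b = regular_system_lifts[OF dgA loc y(1) bs]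
  note x = x[unfolded a(2)] and y = y[unfolded b(2)]
  have dgK: "dg_ring (koszul A as)" "dg_ring (koszul A bs)" using A.dg_ring_koszul a(1) b(1) by auto
  \<comment> \<open>Both systems generate m, so \<open>koszul_map\<close> for the identity of
    \<open>A\<close> supplies the map to start from.\<close>
  have "A.cls z \<in> Idl\<^bsub>H0 A\<^esub> (set (map A.cls as))" if "z \<in> set bs" for z
    unfolding x(2) using y(1) that by auto
  then obtain \<phi> where \<phi>: "\<phi> \<in> dg_hom (koszul A bs) (koszul A as)"
    "\<And>z. z \<in> carrier A \<Longrightarrow> \<phi> (koszul_incl A bs z) = koszul_incl A as z"
    using koszul_map[OF dgA dgA H id_dg_hom b(1) a(1)] by blast
  obtain \<psi> where \<psi>: "\<psi> \<in> dg_hom (koszul A as) (koszul A bs)"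
    and \<psi>P: "(\<forall>z\<in>carrier A. \<psi> (koszul_incl A as z) = koszul_incl A bs z) \<and>
      (\<forall>n. \<forall>X\<in>coh_set (koszul A as) n. coh_map (koszul A as) (\<phi> \<circ> \<psi>) n X = X)"
    using A.koszul_lift_right_inverse[OF loc a(1) b(1) x(1,2) y(1,2) x(3) \<phi>] by (rule bexE)
  have \<psi>_incl: "\<psi> (koszul_incl A as z) = koszul_incl A bs z" if "z \<in> carrier A" for z
    using \<psi>P that by simp
  have \<phi>\<psi>: "coh_map (koszul A as) (\<phi> \<circ> \<psi>) n X = X" if "X \<in> coh_set (koszul A as) n" for n X
    using \<psi>P that by simp
  \<comment> \<open>The same lemma with the two systems exchanged and \<psi> as the given map; now
    the minimality of ys is used.\<close>
  obtain \<phi>' where \<phi>': "\<phi>' \<in> dg_hom (koszul A bs) (koszul A as)"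
    and \<phi>'P: "(\<forall>z\<in>carrier A. \<phi>' (koszul_incl A bs z) = koszul_incl A as z) \<and>
      (\<forall>n. \<forall>X\<in>coh_set (koszul A bs) n. coh_map (koszul A bs) (\<psi> \<circ> \<phi>') n X = X)"
    using A.koszul_lift_right_inverse[OF loc b(1) a(1) y(1,2) x(1,2) y(3) \<psi> \<psi>_incl] by (rule bexE)
  have \<psi>\<phi>': "coh_map (koszul A bs) (\<psi> \<circ> \<phi>') n X = X" if "X \<in> coh_set (koszul A bs) n" for n X
    using \<phi>'P that by simp
  interpret \<psi>: dg_ring_hom "koszul A as" "koszul A bs" \<psi>
    using dgK \<psi> by (simp add: dg_ring_hom_def dg_ring_hom_axioms_def comm_dg_ring_iff)
  interpret \<phi>': dg_ring_hom "koszul A bs" "koszul A as" \<phi>'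
    using \<phi>' by unfold_locales
  have "quasi_iso (koszul A as) (koszul A bs) \<psi>"
    unfolding quasi_iso_def
  proof (intro conjI allI \<psi>)
    fix n
    show "bij_betw (coh_map (koszul A bs) \<psi> n) (coh_set (koszul A as) n) (coh_set (koszul A bs) n)"
    proof (rule bij_betwI')
      fix X Y assume X: "X \<in> coh_set (koszul A as) n" and Y: "Y \<in> coh_set (koszul A as) n"
      show "coh_map (koszul A bs) \<psi> n X = coh_map (koszul A bs) \<psi> n Y \<longleftrightarrow> X = Y"
        \<comment> \<open>Injectivity: \<phi> induces a left inverse of \<psi> on
          cohomology.\<close>
        using \<phi>\<psi>[OF X] \<phi>\<psi>[OF Y] coh_map_comp[OF dgK(1,2,1) \<psi> \<phi>(1)] X Y by metis
    next
      fix X assume "X \<in> coh_set (koszul A as) n"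
      then show "coh_map (koszul A bs) \<psi> n X \<in> coh_set (koszul A bs) n" by (rule \<psi>.coh_map_closed)
    next
      fix Y assume Y: "Y \<in> coh_set (koszul A bs) n"
      then show "\<exists>X\<in>coh_set (koszul A as) n. Y = coh_map (koszul A bs) \<psi> n X"
        \<comment> \<open>Surjectivity: \<phi>' induces a right inverse of \<psi> on
          cohomology.\<close>
        using \<psi>\<phi>'[OF Y] coh_map_comp[OF dgK(2,1,2) \<phi>' \<psi> Y] \<phi>'.coh_map_closed[OF Y] by metis
    qed
  qed
  then have "\<psi> \<in> alg_qis A (koszul_alg A as) (koszul_alg A bs)"
    using \<psi> \<psi>_incl dgA dgK A.koszul_incl_hom a(1) b(1)
    by (simp add: alg_qis_def alg_hom_def dg_alg_def koszul_alg_def)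
  then show ?thesis by (rule alg_qis_ho_iso)
qed

text \<open>As long as some strict subsequence still generates, it replaces the list; its length
  strictly decreases.\<close>

lemma exists_minimal_subseq:
  assumes "Idl\<^bsub>R\<^esub> (set xs) = m"
  shows "\<exists>ys. subseq ys xs \<and> Idl\<^bsub>R\<^esub> (set ys) = m \<and> (\<forall>zs. strict_subseq zs ys \<longrightarrow> Idl\<^bsub>R\<^esub> (set zs) \<noteq> m)"
  using assms
proof (induction "length xs" arbitrary: xs rule: less_induct)
  case less
  show ?case
  proof (cases "\<exists>zs. strict_subseq zs xs \<and> Idl\<^bsub>R\<^esub> (set zs) = m")
    case True
    then obtain zs where zs: "strict_subseq zs xs" "Idl\<^bsub>R\<^esub> (set zs) = m" by blast
    have "length zs < length xs"
      using zs(1) list_emb_length[of "(=)" zs xs] subseq_same_length[of zs xs]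
      by (metis nat_less_le strict_subseq_def)
    then show ?thesis
      using less.hyps[OF _ zs(2)] zs(1) subseq_order.order_trans strict_subseq_def by metis
  next
    case False
    then show ?thesis using less.prems by blast
  qed
qed

text \<open>The generating sequence provided by sequence-regularity is thinned out until it is
  minimal.\<close>

lemma sequence_regular_system_of_parameters:
  assumes "sequence_regular A m"
  shows "\<exists>xs. regular_system_of_parameters A m xs"
proof -
  obtain xs where "Idl\<^bsub>H0 A\<^esub> (set xs) = m" using assms by (auto simp: sequence_regular_def)
  then obtain ys where ys: "Idl\<^bsub>H0 A\<^esub> (set ys) = m" "\<And>zs. strict_subseq zs ys \<Longrightarrow> Idl\<^bsub>H0 A\<^esub> (set zs) \<noteq> m"
    using exists_minimal_subseq by metis
  then have "set ys \<subseteq> m" by (auto simp: genideal_def)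
  then show ?thesis using ys by (auto simp: regular_system_of_parameters_def)
qed

theorem theorem5p4:
  fixes A :: "'a dg" and m :: "'a set set" and abars :: "'a set list"
  assumes "sequence_regular A m"
    and "regular_system_of_parameters A m abars"
  shows
    "(\<forall>ahats. regular_system_of_parameters A m ahats \<longrightarrow>
        (\<forall>as as'. lifts as abars \<longrightarrow> lifts as' ahats \<longrightarrow>
           ho_iso A (koszul_alg A as) (koszul_alg A as'))) \<and>
     (\<forall>(B :: 'b dg) n f.
        sequence_regular B n \<longrightarrow>
        local_dg_hom A m B n f \<longrightarrow>
        flat_hom (H0 A) (H0 B) (coh_map B f 0) \<longrightarrow>
        regular_ring (H0 B Quot (Idl\<^bsub>H0 B\<^esub> (coh_map B f 0 ` m))) \<longrightarrow>
        (\<exists>bbars. regular_system_of_parameters B n bbars \<and>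
           (\<forall>as bs. lifts as abars \<longrightarrow> lifts bs bbars \<longrightarrow>
              (\<exists>g \<in> dg_hom (koszul A as) (koszul B bs).
                 \<forall>x \<in> carrier A. g (koszul_incl A as x) = koszul_incl B bs (f x)))))"
proof (intro conjI allI impI)
  fix ahats as as'
  assume "regular_system_of_parameters A m ahats" "lifts as abars" "lifts as' ahats"
  then show "ho_iso A (koszul_alg A as) (koszul_alg A as')"
    using assms koszul_ho_iso by (auto simp: sequence_regular_def)
next
  fix B :: "'b dg" and n f
  assume B: "sequence_regular B n" and f: "local_dg_hom A m B n f"
  obtain bbars where bbars: "regular_system_of_parameters B n bbars"
    using sequence_regular_system_of_parameters[OF B] by blast
  have dg: "dg_ring A" "dg_ring B" and loc: "local_ring (H0 A) m" "local_ring (H0 B) n"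
    using assms(1) B by (auto simp: sequence_regular_def noetherian_local_dg_def noetherian_dg_def)
  interpret f: dg_ring_hom A B f
    using dg f by (simp add: local_dg_hom_def dg_ring_hom_def dg_ring_hom_axioms_def comm_dg_ring_iff)
  have am: "set abars \<subseteq> m" and bn: "set bbars \<subseteq> n" "Idl\<^bsub>H0 B\<^esub> (set bbars) = n"
    using assms(2) bbars by (auto simp: regular_system_of_parameters_def)
  show "\<exists>bbars. regular_system_of_parameters B n bbars \<and>
         (\<forall>as bs. lifts as abars \<longrightarrow> lifts bs bbars \<longrightarrow>
            (\<exists>g \<in> dg_hom (koszul A as) (koszul B bs).
               \<forall>x \<in> carrier A. g (koszul_incl A as x) = koszul_incl B bs (f x)))"
  proof (intro exI[of _ bbars] conjI allI impI bbars)
    fix as bs assume as: "lifts as abars" and bs: "lifts bs bbars"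
    note a = regular_system_lifts[OF dg(1) loc(1) am as] and b = regular_system_lifts[OF dg(2) loc(2) bn(1) bs]
    show "\<exists>g \<in> dg_hom (koszul A as) (koszul B bs). \<forall>x \<in> carrier A. g (koszul_incl A as x) = koszul_incl B bs (f x)"
    proof (rule koszul_map[OF dg _ f.hom a(1) b(1)])
      show "cring (H0 B)" using loc(2) by (simp add: local_ring_def)
      fix z assume z: "z \<in> set as"
      \<comment> \<open>Locality of f sends the class of z into n, which the chosen parameters of B
        generate. This is the ideal membership that \<open>koszul_map\<close> asks for.\<close>
      then have "f.A.cls z \<in> m" "z \<in> carrier A" using am a f.A.grd_carrier by auto
      then have "f.B.cls (f z) \<in> n"
        using f f.coh_map_coset[of z 0] by (auto simp: local_dg_hom_def)
      then show "f.B.cls (f z) \<in> Idl\<^bsub>H0 B\<^esub> (set (map f.B.cls bs))" using bn(2) b(2) by simp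
    qed
  qed
qed

end
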